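(* Consider a binary symmetric queue-channel with Poisson arrivals of rate $\lambda\in(0,1)$, i.i.d. service times of mean $1$, and flip-probability function $\phi:[0,\infty)\to[0,0.5]$: bit $i$, with waiting time $W_i$, is flipped with probability $\phi(W_i)$. Let $\pi$ be the limiting distribution of the waiting times. If the receiver knows the arrival and departure times, the capacity is $$\lambda\left(1-\mathbf{E}_\pi[H(\phi(W))]\right).$$ If the receiver does not know the arrival and departure times, and the queue is unpredictable given noise, the capacity is $$\lambda\left(1-H\left(\mathbf{E}_\pi[\phi(W)]\right)\right).$$ Here $H(q)=-q\log q-(1-q)\log(1-q)$ is the binary entropy function (base 2).
   Context: Queue. Symbols (qubits) $j=1,2,\dots$ arrive at a single-server FIFO queue. Interarrival times are i.i.d. exponential with rate $\lambda$; service times $S_j$ are i.i.d. with distribution function $F_S$ on $[0,\infty)$, mean $1$, independent of the arrivals; $0<\lambda<1$. The first symbol arrives to an empty system. $A_j$ is the arrival time of symbol $j$, $D_j$ is the time it leaves the waiting line (its service start), and $W_j=D_j-A_j$ is its waiting time. Thus $W_1=0$ and $W_{j+1}=\max(W_j+S_j-(A_{j+1}-A_j),0)$; $\{W_j\}$ is a Markov process with a unique limiting distribution $\pi$. Channel. Inputs $X_j\in\{0,1\}$, outputs $Y_j=X_j\oplus N_j$, where the flip indicators $N_j\in\{0,1\}$ are, given all arrival and service times, independent with $\Pr[N_j=1]=\phi(W_j)$ ($\phi$ measurable), and the inputs are jointly independent of the noise, arrival and service times. The queue is called unpredictable given noise if $\mathbf{P}(W_{n+k}\mid N^n)=\mathbf{P}(W_{n+k})$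 for all $n,k\ge1$, where $N^n=(N_1,\dots,N_n)$. Capacity (bits/sec). An $(n,\tilde R,T)$ code consists of a message set $\mathcal{M}$ with $|\mathcal{M}|=2^{n\tilde R}$, an encoder $X^n=f(M)$ and a decoder $\hat M=g(\cdot)$ acting on $(Y^n,A^n,D^n)$ if the receiver knows the arrival and departure times, and on $Y^n$ only if it does not; $M$ is uniform on $\mathcal{M}$ and the expected time by which all $n$ symbols have been served is less than $T$. A rate $R$ is achievable if for all $\epsilon\in(0,1)$ and $\delta>0$, for all sufficiently large $n$ there is an $(n,\tilde R,T)$ code with $\Pr[\hat M\ne M]<\epsilon$ and $n\tilde R/T>R-\delta$. The capacity is the supremum of achievable rates. *)

theory Defs
  imports "HOL-Probability.Probability"
begin

section \<open>The single-server FIFO queue\<close>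

text \<open>
  Symbols are numbered from 1; the value of any process at index 0 is irrelevant.
  For \<^term>\<open>j \<ge> 2\<close>, \<^term>\<open>tau j\<close> is the time between the arrivals of symbols \<^term>\<open>j - 1\<close>
  and \<^term>\<open>j\<close>; \<^term>\<open>tau 1\<close> is the time from the origin to the first arrival, so that the
  arrivals form a Poisson process on the positive half-line.
\<close>

definition arrival_time :: "(nat \<Rightarrow> 'w \<Rightarrow> real) \<Rightarrow> nat \<Rightarrow> 'w \<Rightarrow> real" where
  "arrival_time tau j \<omega> = (\<Sum>i = 1..j. tau i \<omega>)"

text \<open>
  The time at which a symbol leaves the waiting line: the first symbol finds the system empty,
  every later one starts service once it has arrived and its predecessor is completed.
\<close>

fun departure_time ::
  "(nat \<Rightarrow> 'w \<Rightarrow> real) \<Rightarrow> (nat \<Rightarrow> 'w \<Rightarrow> real) \<Rightarrow> nat \<Rightarrow> 'w \<Rightarrow> real" where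
  "departure_time tau S 0 \<omega> = 0"
| "departure_time tau S (Suc 0) \<omega> = arrival_time tau 1 \<omega>"
| "departure_time tau S (Suc (Suc j)) \<omega> =
     max (arrival_time tau (Suc (Suc j)) \<omega>) (departure_time tau S (Suc j) \<omega> + S (Suc j) \<omega>)"

definition waiting_time ::
  "(nat \<Rightarrow> 'w \<Rightarrow> real) \<Rightarrow> (nat \<Rightarrow> 'w \<Rightarrow> real) \<Rightarrow> nat \<Rightarrow> 'w \<Rightarrow> real" where
  "waiting_time tau S j \<omega> = departure_time tau S j \<omega> - arrival_time tau j \<omega>"

lemma waiting_time_1: "waiting_time tau S 1 \<omega> = 0"
  by (simp add: waiting_time_def)

lemma waiting_time_Suc:
  assumes "1 \<le> j"
  shows "waiting_time tau S (Suc j) \<omega> =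
    max (waiting_time tau S j \<omega> + S j \<omega> - (arrival_time tau (Suc j) \<omega> - arrival_time tau j \<omega>)) 0"
  using assms by (cases j) (auto simp: waiting_time_def)

definition all_served_time ::
  "(nat \<Rightarrow> 'w \<Rightarrow> real) \<Rightarrow> (nat \<Rightarrow> 'w \<Rightarrow> real) \<Rightarrow> nat \<Rightarrow> 'w \<Rightarrow> real" where
  "all_served_time tau S n \<omega> = Max ((\<lambda>j. departure_time tau S j \<omega> + S j \<omega>) ` {1..n})"

text \<open>The sub-sigma-algebra generated by all interarrival and service times.\<close>

definition timing_algebra ::
  "'w measure \<Rightarrow> (nat \<Rightarrow> 'w \<Rightarrow> real) \<Rightarrow> (nat \<Rightarrow> 'w \<Rightarrow> real) \<Rightarrow> 'w measure" where
  "timing_algebra M tau S =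
     vimage_algebra (space M) (\<lambda>\<omega>. \<lambda>j\<in>{1..}. (tau j \<omega>, S j \<omega>)) (\<Pi>\<^sub>M j\<in>{1..}. borel)"

section \<open>The queue-channel\<close>

text \<open>
  \<^term>\<open>FS\<close> is the law of the service times. The bits 0 and 1 are \<^const>\<open>False\<close> and
  \<^const>\<open>True\<close>. The function \<^term>\<open>phi\<close> matters only on the nonnegative reals.
\<close>

locale queue_channel = prob_space M
  for M :: "'w measure" +
  fixes lam :: real
    and FS :: "real measure"
    and phi :: "real \<Rightarrow> real"
    and tau S :: "nat \<Rightarrow> 'w \<Rightarrow> real"
    and N :: "nat \<Rightarrow> 'w \<Rightarrow> bool"
  assumes lam: "0 < lam" "lam < 1"
    and interarrival_indep: "indep_vars (\<lambda>_. borel) tau {1..}"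
    and interarrival_exponential:
      "\<And>j. 1 \<le> j \<Longrightarrow> distributed M lborel (tau j) (exponential_density lam)"
    and service_indep: "indep_vars (\<lambda>_. borel) S {1..}"
    and service_law: "\<And>j. 1 \<le> j \<Longrightarrow> distr M borel (S j) = FS"
    and service_nonneg: "AE s in FS. 0 \<le> s"
    and service_mean: "integrable FS (\<lambda>s. s)" "(\<integral>s. s \<partial>FS) = 1"
    and arrivals_indep_services:
      "indep_var (\<Pi>\<^sub>M j\<in>{1..}. borel) (\<lambda>\<omega>. \<lambda>j\<in>{1..}. tau j \<omega>)
                 (\<Pi>\<^sub>M j\<in>{1..}. borel) (\<lambda>\<omega>. \<lambda>j\<in>{1..}. S j \<omega>)"
    and phi_measurable: "phi \<in> borel_measurable borel"
    and noise_measurable: "\<And>j. 1 \<le> j \<Longrightarrow> N j \<in> M \<rightarrow>\<^sub>M count_space UNIV"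
    and noise_given_timing:
      "\<And>J b. finite J \<Longrightarrow> J \<subseteq> {1..} \<Longrightarrow>
         AE \<omega> in M.
           real_cond_exp M (timing_algebra M tau S)
             (indicator {\<omega> \<in> space M. \<forall>j\<in>J. N j \<omega> = b j}) \<omega>
           = (\<Prod>j\<in>J. if b j then phi (waiting_time tau S j \<omega>)
                     else 1 - phi (waiting_time tau S j \<omega>))"

text \<open>
  As the noise is discrete, conditioning on \<open>N\<^sup>n\<close> means conditioning on each event
  \<open>N\<^sup>n = b\<close> of positive probability.
\<close>

definition unpredictable_given_noise ::
  "'w measure \<Rightarrow> (nat \<Rightarrow> 'w \<Rightarrow> real) \<Rightarrow> (nat \<Rightarrow> 'w \<Rightarrow> real) \<Rightarrow> (nat \<Rightarrow> 'w \<Rightarrow> bool) \<Rightarrow> bool"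
where
  "unpredictable_given_noise M tau S N \<longleftrightarrow>
     (\<forall>n\<ge>1. \<forall>k\<ge>1. \<forall>b. \<forall>B\<in>sets borel.
        \<P>(\<omega> in M. \<forall>j\<in>{1..n}. N j \<omega> = b j) > 0 \<longrightarrow>
        \<P>(\<omega> in M. waiting_time tau S (n + k) \<omega> \<in> B \<bar> \<forall>j\<in>{1..n}. N j \<omega> = b j)
        = \<P>(\<omega> in M. waiting_time tau S (n + k) \<omega> \<in> B))"

definition channel_output ::
  "(nat \<Rightarrow> 'w \<Rightarrow> bool) \<Rightarrow> nat \<Rightarrow> (nat \<Rightarrow> bool) \<Rightarrow> 'w \<Rightarrow> nat \<Rightarrow> bool" where
  "channel_output N n x \<omega> = (\<lambda>j\<in>{1..n}. x j \<noteq> N j \<omega>)"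

section \<open>Codes and capacity\<close>

text \<open>
  What the receiver gets to see is given by a pair of parameters: \<^term>\<open>K n\<close> is the measurable
  space of possible observations for block length \<^term>\<open>n\<close>, and \<^term>\<open>obs n x \<omega>\<close> is the
  observation made when the word \<^term>\<open>x\<close> is sent.
\<close>

definition is_code ::
  "'w measure \<Rightarrow> (nat \<Rightarrow> 'w \<Rightarrow> real) \<Rightarrow> (nat \<Rightarrow> 'w \<Rightarrow> real) \<Rightarrow> (nat \<Rightarrow> 'o measure) \<Rightarrow>
   nat \<Rightarrow> real \<Rightarrow> real \<Rightarrow> nat set \<Rightarrow> (nat \<Rightarrow> nat \<Rightarrow> bool) \<Rightarrow> ('o \<Rightarrow> nat) \<Rightarrow> bool" where
  "is_code M tau S K n Rt T Msgs f g \<longleftrightarrow>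
     1 \<le> n \<and>
     finite Msgs \<and> real (card Msgs) = 2 powr (real n * Rt) \<and>
     f \<in> Msgs \<rightarrow> ({1..n} \<rightarrow>\<^sub>E UNIV) \<and>
     g \<in> K n \<rightarrow>\<^sub>M count_space Msgs \<and>
     (\<integral>\<omega>. all_served_time tau S n \<omega> \<partial>M) < T"

text \<open>
  The message is the first component of a product space, hence uniform and independent of the
  noise and of all arrival and service times.
\<close>

definition error_probability ::
  "'w measure \<Rightarrow> (nat \<Rightarrow> (nat \<Rightarrow> bool) \<Rightarrow> 'w \<Rightarrow> 'o) \<Rightarrow>
   nat \<Rightarrow> nat set \<Rightarrow> (nat \<Rightarrow> nat \<Rightarrow> bool) \<Rightarrow> ('o \<Rightarrow> nat) \<Rightarrow> real" where
  "error_probability M obs n Msgs f g =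
     \<P>((m, \<omega>) in uniform_count_measure Msgs \<Otimes>\<^sub>M M. g (obs n (f m) \<omega>) \<noteq> m)"

definition achievable ::
  "'w measure \<Rightarrow> (nat \<Rightarrow> 'w \<Rightarrow> real) \<Rightarrow> (nat \<Rightarrow> 'w \<Rightarrow> real) \<Rightarrow>
   (nat \<Rightarrow> 'o measure) \<Rightarrow> (nat \<Rightarrow> (nat \<Rightarrow> bool) \<Rightarrow> 'w \<Rightarrow> 'o) \<Rightarrow> real \<Rightarrow> bool" where
  "achievable M tau S K obs R \<longleftrightarrow>
     (\<forall>\<epsilon>\<in>{0<..<1}. \<forall>\<delta>>0. \<forall>\<^sub>F n in sequentially.
        \<exists>Rt T Msgs f g.
          is_code M tau S K n Rt T Msgs f g \<and>
          error_probability M obs n Msgs f g < \<epsilon> \<and>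
          real n * Rt / T > R - \<delta>)"

text \<open>The supremum is taken in \<^typ>\<open>ereal\<close>, where it is meaningful without a boundedness proof.\<close>

definition capacity ::
  "'w measure \<Rightarrow> (nat \<Rightarrow> 'w \<Rightarrow> real) \<Rightarrow> (nat \<Rightarrow> 'w \<Rightarrow> real) \<Rightarrow>
   (nat \<Rightarrow> 'o measure) \<Rightarrow> (nat \<Rightarrow> (nat \<Rightarrow> bool) \<Rightarrow> 'w \<Rightarrow> 'o) \<Rightarrow> ereal" where
  "capacity M tau S K obs = (SUP R\<in>{R. achievable M tau S K obs R}. ereal R)"

definition capacity_unknown_times ::
  "'w measure \<Rightarrow> (nat \<Rightarrow> 'w \<Rightarrow> real) \<Rightarrow> (nat \<Rightarrow> 'w \<Rightarrow> real) \<Rightarrow> (nat \<Rightarrow> 'w \<Rightarrow> bool) \<Rightarrow> ereal"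
where
  "capacity_unknown_times M tau S N =
     capacity M tau S (\<lambda>n. \<Pi>\<^sub>M j\<in>{1..n}. count_space UNIV) (channel_output N)"

definition capacity_known_times ::
  "'w measure \<Rightarrow> (nat \<Rightarrow> 'w \<Rightarrow> real) \<Rightarrow> (nat \<Rightarrow> 'w \<Rightarrow> real) \<Rightarrow> (nat \<Rightarrow> 'w \<Rightarrow> bool) \<Rightarrow> ereal"
where
  "capacity_known_times M tau S N =
     capacity M tau S
       (\<lambda>n. (\<Pi>\<^sub>M j\<in>{1..n}. count_space UNIV) \<Otimes>\<^sub>M
            (\<Pi>\<^sub>M j\<in>{1..n}. borel) \<Otimes>\<^sub>M (\<Pi>\<^sub>M j\<in>{1..n}. borel))
       (\<lambda>n x \<omega>. (channel_output N n x \<omega>,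
                 \<lambda>j\<in>{1..n}. arrival_time tau j \<omega>,
                 \<lambda>j\<in>{1..n}. departure_time tau S j \<omega>))"

text \<open>Since \<^term>\<open>log 2 0 = 0\<close>, the usual convention \<open>0 log 0 = 0\<close> is built in.\<close>

definition binary_entropy :: "real \<Rightarrow> real" where
  "binary_entropy q = - q * log 2 q - (1 - q) * log 2 (1 - q)"

end

(*
  Known and unknown timing are two instances of additive noise whose flip indicators are
  conditionally independent given a sub-sigma-algebra F: for known times F is generated by the
  timing and the flip probabilities are phi(W_j); for unknown times F is trivial, since
  unpredictability makes the flip indicators independent with flip probabilities E phi(W_j).

  Achievability: codewords chosen greedily, so that they do as well as random ones on average, and
  threshold decoding of the likelihood. Converse: for a given received word the decoder succeeds for
  one message only, so a typical noise word of likelihood at most t contributes at most t 2^n in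
  total. Both bounds meet because -(1/n) log of the likelihood of the noise tends to the entropy in
  probability: by conditional independence the covariances of the information densities are those
  of the entropies H(phi(W_j)).

  The waiting times form a random walk with negative drift reflected at 0. Copies started at
  different heights merge once the higher one reaches 0; hence W_j converges in total variation
  (phi need not be continuous) and H(phi(W_i)), H(phi(W_j)) decorrelate as |i - j| grows.
  Truncating the increments gives E W_n = o(n), so the expected time per symbol tends to 1/lambda.
*)

theory Submission
  imports Defs
begin

section \<open>Reflected random walks\<close>

text \<open>The service times have a mean only, so second moments of W_n need not exist; the
  second-moment argument for the walk is therefore applied to clipped increments. The limit law
  enters as a weak limit, possibly with atoms, while \<open>phi\<close> is merely measurable:
  coupling shows that the laws of W_k and W_{i+k} are close on every Borel set uniformly in i, and
  outer regularity then brings in \<pi>. The information densities -log q are unbounded, since a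
  flip probability may be arbitrarily small; the bound p (ln p)^2 <= 4 nevertheless gives them
  second moments bounded uniformly in q. Mixed moments are centred at the limiting entropy and not
  at the means of the single terms: then one small factor suffices, and no stationary version of the
  queue has to be constructed. Time enters only through the exact value n/lambda + E W_n + 1 of the
  expected completion time: n/lambda as a lower bound serves the converse, E W_n = o(n) the
  achievability.\<close>

text \<open>Lindley's recursion for a queue that starts empty. The index is such that
  \<open>reflected_walk v k\<close> will be the waiting time of symbol k + 1.\<close>

fun reflected_walk :: "(nat \<Rightarrow> real) \<Rightarrow> nat \<Rightarrow> real" where
  "reflected_walk v 0 = 0"
| "reflected_walk v (Suc k) = max 0 (reflected_walk v k + v k)"

lemma reflected_walk_nonneg: "0 \<le> reflected_walk v k"
  by (cases k) auto

lemma reflected_walk_cong: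
  assumes "\<And>l. l < k \<Longrightarrow> v l = u l"
  shows "reflected_walk v k = reflected_walk u k"
  using assms by (induction k) auto

lemma sum_le_reflected_walk: "(\<Sum>l<k. v l) \<le> reflected_walk v k"
  by (induction k) (auto simp: max_def)

text \<open>Reflection is monotone, and adding a nonnegative amount before it raises the result by
  at most that amount. Used with \<open>u\<close> the clipped increments and \<open>e\<close> the
  part cut off.\<close>

lemma reflected_walk_excess:
  assumes "\<And>l. v l \<le> u l + e l" "\<And>l. 0 \<le> e l"
  shows "reflected_walk v k \<le> reflected_walk u k + (\<Sum>l<k. e l)"
proof (induction k)
  case (Suc k)
  have "0 \<le> (\<Sum>l<k. e l)" using assms(2) by (intro sum_nonneg) auto
  with Suc assms(1)[of k] assms(2)[of k] show ?case by (auto simp: max_def)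
qed simp

text \<open>If the walk is still above the one restarted from 0 at time \<^term>\<open>i\<close>, it has not been reflected
  since, so it equals the unreflected sum.\<close>

lemma reflected_walk_coupling:
  assumes "reflected_walk v i + (\<Sum>l<k. v (i + l)) \<le> 0"
  shows "reflected_walk v (i + k) = reflected_walk (\<lambda>l. v (i + l)) k"
proof -
  \<comment> \<open>The first conjunct closes the induction: at a step where the upper walk is
    pushed to 0, the restarted walk below it is pushed to 0 as well, and the two merge.\<close>
  have "reflected_walk (\<lambda>l. v (i + l)) k \<le> reflected_walk v (i + k) \<and>
    (reflected_walk v (i + k) = reflected_walk (\<lambda>l. v (i + l)) k \<or>
     reflected_walk v (i + k) = reflected_walk v i + (\<Sum>l<k. v (i + l)) \<and>
     0 < reflected_walk v i + (\<Sum>l<k. v (i + l)))"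
  proof (induction k)
    case 0
    show ?case using reflected_walk_nonneg[of v i] by auto
  next
    case (Suc k)
    then show ?case by (auto simp: max_def)
  qed
  with assms show ?thesis by auto
qed

lemma borel_measurable_reflected_walk:
  assumes "\<And>l. l < k \<Longrightarrow> (\<lambda>x. f x l) \<in> borel_measurable A"
  shows "(\<lambda>x. reflected_walk (f x) k) \<in> borel_measurable A"
  using assms by (induction k) auto

section \<open>Moment bounds for reflected walks\<close>

context prob_space
begin

text \<open>Reflection does not increase the square, and R_k is nonnegative and independent of V_k.
  So the cross term 2 E R_k E V_k is at most 0, and each step adds at most E V_k^2 <= c^2.\<close>

lemma reflected_walk_second_moment:
  assumes indep: "indep_vars (\<lambda>_. borel) V UNIV"
    and mean: "\<And>l. expectation (V l) \<le> 0"
    and bound: "\<And>l \<omega>. \<bar>V l \<omega>\<bar> \<le> c"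
  shows "expectation (\<lambda>\<omega>. (reflected_walk (\<lambda>l. V l \<omega>) k)\<^sup>2) \<le> real k * c\<^sup>2"
proof -
  have V[measurable]: "V l \<in> borel_measurable M" for l
    using indep by (auto simp: indep_vars_def)
  define R where "R = (\<lambda>k \<omega>. reflected_walk (\<lambda>l. V l \<omega>) k)"
  have [measurable]: "R k \<in> borel_measurable M" for k
    unfolding R_def by (intro borel_measurable_reflected_walk) auto
  have c: "0 \<le> c" using bound[of 0 undefined] by linarith
  have R_nonneg: "0 \<le> R k \<omega>" for k \<omega>
    by (simp add: R_def reflected_walk_nonneg)
  have R_le: "R k \<omega> \<le> real k * c" for k \<omega>
  proof (induction k)
    case (Suc k)
    have "R (Suc k) \<omega> = max 0 (R k \<omega> + V k \<omega>)" by (simp add: R_def)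
    with Suc bound[of k \<omega>] c show ?case by (auto simp: max_def algebra_simps)
  qed (simp add: R_def)
  have int[intro, simp]: "integrable M (R k)" "integrable M (\<lambda>\<omega>. (R k \<omega>)\<^sup>2)" "integrable M (V k)"
     "integrable M (\<lambda>\<omega>. (V k \<omega>)\<^sup>2)" for k
  proof -
    show "integrable M (R k)"
      by (rule integrable_const_bound[where B="real k * c"]) (use R_nonneg R_le in auto)
    show "integrable M (\<lambda>\<omega>. (R k \<omega>)\<^sup>2)"
      by (rule integrable_const_bound[where B="(real k * c)\<^sup>2"]) (use R_nonneg R_le in \<open>auto intro!: power_mono\<close>)
    show "integrable M (V k)"
      by (rule integrable_const_bound[where B=c]) (use bound in auto)
    show "integrable M (\<lambda>\<omega>. (V k \<omega>)\<^sup>2)"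
      by (rule integrable_const_bound[where B="c\<^sup>2"]) (use bound c in \<open>auto simp: power2_le_iff_abs_le\<close>)
  qed
  have ind: "indep_var borel (R k) borel (V k)" for k
  proof -
    have "indep_var borel ((\<lambda>f. reflected_walk f k) \<circ> (\<lambda>\<omega>. restrict (\<lambda>i. V i \<omega>) {..<k}))
        borel ((\<lambda>f. f k) \<circ> (\<lambda>\<omega>. restrict (\<lambda>i. V i \<omega>) {k}))"
      by (intro indep_var_compose[OF indep_var_restrict[OF indep]] borel_measurable_reflected_walk) auto
    moreover have "(\<lambda>f. reflected_walk f k) \<circ> (\<lambda>\<omega>. restrict (\<lambda>i. V i \<omega>) {..<k}) = R k"
      by (auto simp: R_def fun_eq_iff intro!: reflected_walk_cong)
    moreover have "(\<lambda>f. f k) \<circ> (\<lambda>\<omega>. restrict (\<lambda>i. V i \<omega>) {k}) = V k" by auto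
    ultimately show ?thesis by simp
  qed
  have "expectation (\<lambda>\<omega>. (R k \<omega>)\<^sup>2) \<le> real k * c\<^sup>2"
  proof (induction k)
    case (Suc k)
    have prod: "integrable M (\<lambda>\<omega>. R k \<omega> * V k \<omega>)"
      "expectation (\<lambda>\<omega>. R k \<omega> * V k \<omega>) = expectation (R k) * expectation (V k)"
      using indep_var_integrable[OF ind] indep_var_lebesgue_integral[OF ind] by auto
    have "expectation (R k) * expectation (V k) \<le> 0"
      using mean[of k] R_nonneg by (intro mult_nonneg_nonpos) auto
    moreover have "expectation (\<lambda>\<omega>. (V k \<omega>)\<^sup>2) \<le> c\<^sup>2"
      by (rule integral_le_const) (use bound c in \<open>auto simp: power2_le_iff_abs_le\<close>)
    moreover have "expectation (\<lambda>\<omega>. (R (Suc k) \<omega>)\<^sup>2)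
       \<le> expectation (\<lambda>\<omega>. (R k \<omega>)\<^sup>2 + 2 * (R k \<omega> * V k \<omega>) + (V k \<omega>)\<^sup>2)"
    proof (rule integral_mono)
      fix \<omega>
      have "(R (Suc k) \<omega>)\<^sup>2 \<le> (R k \<omega> + V k \<omega>)\<^sup>2" by (auto simp: R_def max_def)
      then show "(R (Suc k) \<omega>)\<^sup>2 \<le> (R k \<omega>)\<^sup>2 + 2 * (R k \<omega> * V k \<omega>) + (V k \<omega>)\<^sup>2"
        by (simp add: power2_sum)
    qed (use prod in auto)
    ultimately show ?case using Suc prod by (simp add: algebra_simps)
  qed (simp add: R_def)
  then show ?thesis by (simp add: R_def)
qed

text \<open>With increments clipped at n, the second moment bounds the mean of the walk by n sqrt k.
  What clipping removes is at most the excess above n of each increment, whose mean is below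
  epsilon/2 for large n. A first moment of the increments is enough for this.\<close>

lemma reflected_walk_sublinear:
  assumes indep: "indep_vars (\<lambda>_. borel) V UNIV"
    and ident: "\<And>l. distr M borel (V l) = distr M borel (V 0)"
    and int: "integrable M (V 0)"
    and drift: "expectation (V 0) < 0"
    and "0 < \<epsilon>"
  shows "\<forall>\<^sub>F k in sequentially. expectation (\<lambda>\<omega>. reflected_walk (\<lambda>l. V l \<omega>) k) \<le> \<epsilon> * real k"
    and "integrable M (\<lambda>\<omega>. reflected_walk (\<lambda>l. V l \<omega>) k)"
proof -
  have V[measurable]: "V l \<in> borel_measurable M" for l
    using indep by (auto simp: indep_vars_def)
  have same: "expectation (\<lambda>\<omega>. f (V l \<omega>)) = expectation (\<lambda>\<omega>. f (V 0 \<omega>))"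
    "integrable M (\<lambda>\<omega>. f (V l \<omega>)) \<longleftrightarrow> integrable M (\<lambda>\<omega>. f (V 0 \<omega>))"
    if [measurable]: "f \<in> borel_measurable borel" for f :: "real \<Rightarrow> real" and l
    using integral_distr[of "V l" M borel f] integral_distr[of "V 0" M borel f] ident[of l]
      integrable_distr_eq[of "V l" M borel f] integrable_distr_eq[of "V 0" M borel f] by auto
  have intV: "integrable M (V l)" for l using same(2)[of "\<lambda>x. x" l] int by simp
  have [measurable]: "(\<lambda>\<omega>. reflected_walk (\<lambda>l. V l \<omega>) k) \<in> borel_measurable M" for k
    by (intro borel_measurable_reflected_walk) auto
  show intR: "integrable M (\<lambda>\<omega>. reflected_walk (\<lambda>l. V l \<omega>) k)" for k
    by (induction k) (auto intro!: integrable_max intV)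
  \<comment> \<open>Clipping from below at -n only raises an increment, so the part lost is the
    excess above n alone; both sides are clipped to make the increments bounded.\<close>
  define cl where "cl = (\<lambda>n x :: real. max (- real n) (min x (real n)))"
  have [measurable]: "cl n \<in> borel_measurable borel" for n unfolding cl_def by measurable
  have cl_bound: "\<bar>cl n x\<bar> \<le> real n" for n x by (auto simp: cl_def)
  have lim1: "(\<lambda>n. expectation (\<lambda>\<omega>. cl n (V 0 \<omega>))) \<longlonglongrightarrow> expectation (V 0)"
  proof (rule integral_dominated_convergence[where w="\<lambda>\<omega>. \<bar>V 0 \<omega>\<bar>"])
    show "AE \<omega> in M. (\<lambda>n. cl n (V 0 \<omega>)) \<longlonglongrightarrow> V 0 \<omega>"
    proof (intro AE_I2 tendsto_eventually)
      fix \<omega>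
      obtain n0 where "\<bar>V 0 \<omega>\<bar> \<le> real n0" using real_arch_simple by blast
      then show "\<forall>\<^sub>F n in sequentially. cl n (V 0 \<omega>) = V 0 \<omega>"
        by (intro eventually_sequentiallyI[of n0]) (auto simp: cl_def)
    qed
  qed (use int in \<open>auto simp: cl_def\<close>)
  have lim2: "(\<lambda>n. expectation (\<lambda>\<omega>. max 0 (V 0 \<omega> - real n))) \<longlonglongrightarrow> expectation (\<lambda>_. 0)"
  proof (rule integral_dominated_convergence[where w="\<lambda>\<omega>. \<bar>V 0 \<omega>\<bar>"])
    show "AE \<omega> in M. (\<lambda>n. max 0 (V 0 \<omega> - real n)) \<longlonglongrightarrow> 0"
    proof (intro AE_I2 tendsto_eventually)
      fix \<omega>
      obtain n0 where "\<bar>V 0 \<omega>\<bar> \<le> real n0" using real_arch_simple by blast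
      then show "\<forall>\<^sub>F n in sequentially. max 0 (V 0 \<omega> - real n) = 0"
        by (intro eventually_sequentiallyI[of n0]) auto
    qed
  qed (use int in auto)
  \<comment> \<open>Two demands on n: the clipped drift must still be negative, and the mean excess
    must be below epsilon/2.\<close>
  have "\<forall>\<^sub>F n in sequentially. expectation (\<lambda>\<omega>. cl n (V 0 \<omega>)) < 0 \<and>
      expectation (\<lambda>\<omega>. max 0 (V 0 \<omega> - real n)) < \<epsilon> / 2"
    using order_tendstoD(2)[OF lim1 drift] order_tendstoD(2)[OF lim2, of "\<epsilon>/2"] \<open>0 < \<epsilon>\<close>
    by (intro eventually_conj) auto
  then obtain n where n: "expectation (\<lambda>\<omega>. cl n (V 0 \<omega>)) < 0"
      "expectation (\<lambda>\<omega>. max 0 (V 0 \<omega> - real n)) < \<epsilon> / 2"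
    using eventually_happens'[OF sequentially_bot] by blast
  have bd: "expectation (\<lambda>\<omega>. reflected_walk (\<lambda>l. V l \<omega>) k) \<le> sqrt (real k) * real n + real k * (\<epsilon>/2)" for k
  proof -
    define R where "R = (\<lambda>\<omega>. reflected_walk (\<lambda>l. cl n (V l \<omega>)) k)"
    have [measurable]: "R \<in> borel_measurable M"
      unfolding R_def by (intro borel_measurable_reflected_walk) auto
    have intc: "integrable M (\<lambda>\<omega>. cl n (V l \<omega>))" for l
      by (rule integrable_const_bound[where B="real n"]) (use cl_bound in auto)
    have R_le: "R \<omega> \<le> real k * n" for \<omega>
    proof -
      have "reflected_walk (\<lambda>l. cl n (V l \<omega>)) k \<le> reflected_walk (\<lambda>_. 0) k + (\<Sum>l<k. real n)"
        by (rule reflected_walk_excess) (use cl_bound in \<open>auto simp: abs_le_iff\<close>)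
      moreover have "reflected_walk (\<lambda>_. 0) k = 0" by (induction k) auto
      ultimately show ?thesis by (simp add: R_def)
    qed
    have R_nonneg: "0 \<le> R \<omega>" for \<omega> by (simp add: R_def reflected_walk_nonneg)
    have R2: "expectation (\<lambda>\<omega>. (R \<omega>)\<^sup>2) \<le> real k * (real n)\<^sup>2"
      unfolding R_def
    proof (rule reflected_walk_second_moment)
      show "indep_vars (\<lambda>_. borel) (\<lambda>l \<omega>. cl n (V l \<omega>)) UNIV"
        by (rule indep_vars_compose2[OF indep]) auto
      show "expectation (\<lambda>\<omega>. cl n (V l \<omega>)) \<le> 0" for l
        using n(1) same(1)[of "cl n" l] by simp
    qed (rule cl_bound)
    have iR: "integrable M R"
      by (rule integrable_const_bound[where B="real k * n"]) (use R_nonneg R_le in auto)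
    have iR2: "integrable M (\<lambda>\<omega>. (R \<omega>)\<^sup>2)"
      by (rule integrable_const_bound[where B="(real k * n)\<^sup>2"]) (use R_nonneg R_le in \<open>auto intro!: power_mono\<close>)
    have "(expectation R)\<^sup>2 \<le> expectation (\<lambda>\<omega>. (R \<omega>)\<^sup>2)"
      using variance_positive[of R] variance_eq[OF iR iR2] by simp
    with R2 have "(expectation R)\<^sup>2 \<le> (sqrt (real k) * real n)\<^sup>2" by (simp add: power_mult_distrib)
    then have ER: "expectation R \<le> sqrt (real k) * real n" by (rule power2_le_imp_le) simp
    have ie: "integrable M (\<lambda>\<omega>. max 0 (V l \<omega> - real n))" for l
      by (intro integrable_max Bochner_Integration.integrable_diff intV) auto
    have "expectation (\<lambda>\<omega>. reflected_walk (\<lambda>l. V l \<omega>) k)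
        \<le> expectation (\<lambda>\<omega>. R \<omega> + (\<Sum>l<k. max 0 (V l \<omega> - real n)))"
    proof (rule integral_mono)
      fix \<omega>
      show "reflected_walk (\<lambda>l. V l \<omega>) k \<le> R \<omega> + (\<Sum>l<k. max 0 (V l \<omega> - real n))"
        unfolding R_def by (rule reflected_walk_excess) (auto simp: cl_def)
    qed (use iR ie intR in auto)
    also have "\<dots> = expectation R + (\<Sum>l<k. expectation (\<lambda>\<omega>. max 0 (V l \<omega> - real n)))"
      using iR ie by simp
    also have "(\<Sum>l<k. expectation (\<lambda>\<omega>. max 0 (V l \<omega> - real n))) = real k * expectation (\<lambda>\<omega>. max 0 (V 0 \<omega> - real n))"
      by (subst sum.cong[OF refl same(1)[of "\<lambda>x. max 0 (x - real n)"]]) auto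
    also have "\<dots> \<le> real k * (\<epsilon>/2)" using n(2) by (intro mult_left_mono) auto
    finally show ?thesis using ER by simp
  qed
  \<comment> \<open>From here on n sqrt k is at most k epsilon/2, the other half of the
    budget.\<close>
  obtain k0 where k0: "(2 * real n / \<epsilon>)\<^sup>2 \<le> real k0" using real_arch_simple by blast
  show "\<forall>\<^sub>F k in sequentially. expectation (\<lambda>\<omega>. reflected_walk (\<lambda>l. V l \<omega>) k) \<le> \<epsilon> * real k"
  proof (rule eventually_sequentiallyI[of k0])
    fix k assume "k0 \<le> k"
    with k0 have "(2 * real n / \<epsilon>)\<^sup>2 \<le> real k" by linarith
    then have "2 * real n / \<epsilon> \<le> sqrt (real k)" by (rule real_le_rsqrt)
    then have "real n \<le> sqrt (real k) * (\<epsilon> / 2)" using \<open>0 < \<epsilon>\<close> by (simp add: field_simps)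
    then have "sqrt (real k) * real n \<le> sqrt (real k) * (sqrt (real k) * (\<epsilon> / 2))"
      by (intro mult_left_mono) auto
    also have "\<dots> = real k * (\<epsilon> / 2)" by (simp flip: mult.assoc)
    finally show "expectation (\<lambda>\<omega>. reflected_walk (\<lambda>l. V l \<omega>) k) \<le> \<epsilon> * real k"
      using bd[of k] by (simp add: algebra_simps)
  qed
qed

end

text \<open>Both walks see the same increments, and at time \<open>i\<close> the restarted one is at
  0, the other at a nonnegative height; the recursion is monotone. For identically distributed
  increments this makes W_i stochastically increasing in i.\<close>

lemma reflected_walk_shift_le:
  "reflected_walk (\<lambda>l. v (i + l)) k \<le> reflected_walk v (i + k)"
  using reflected_walk_nonneg[of v i] by (induction k) (auto simp: max_def)

section \<open>From weak convergence to bounded measurable functions\<close>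

text \<open>Half of the portmanteau theorem: an open set is approximated from below by continuous
  functions, whose integrals converge.\<close>

lemma weak_limit_open_le:
  fixes \<mu> :: "nat \<Rightarrow> real measure"
  assumes \<mu>: "\<And>n. real_distribution (\<mu> n)" and \<nu>: "real_distribution \<nu>"
    and conv: "weak_conv_m \<mu> \<nu>"
    and U: "open U" and bound: "\<And>n. n \<ge> k \<Longrightarrow> measure (\<mu> n) U \<le> a"
  shows "measure \<nu> U \<le> a"
\<comment> \<open>The whole line is treated apart: its complement is empty, \<open>infdist\<close>
  to the empty set is 0, and the approximating functions would all vanish.\<close>
proof (cases "U = UNIV")
  case True
  interpret k: real_distribution "\<mu> k" by (rule \<mu>)
  interpret l: real_distribution \<nu> by (rule \<nu>)
  show ?thesis using bound[of k] True k.prob_space l.prob_space by simp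
next
  case False
  interpret l: real_distribution \<nu> by (rule \<nu>)
  have [measurable]: "U \<in> sets borel" using U by simp
  \<comment> \<open>A ramp of slope m in the distance to the complement: 0 outside U, and equal to 1
    at any given point of U once m is large.\<close>
  define f where "f = (\<lambda>m x. min 1 (real m * infdist x (- U)))"
  have f_cont: "isCont (f m) x" for m x
    unfolding f_def by (intro continuous_intros)
  have f_meas[measurable]: "f m \<in> borel_measurable borel" for m
    by (rule borel_measurable_continuous_onI) (use f_cont in \<open>auto simp: continuous_at_imp_continuous_on\<close>)
  have f_range: "0 \<le> f m x" "f m x \<le> 1" for m x
    by (auto simp: f_def infdist_nonneg)
  have f_le: "f m x \<le> indicator U x" for m x
    using f_range[of m x] by (auto simp: indicator_def f_def)
  have f_lim: "(\<lambda>m. f m x) \<longlonglongrightarrow> indicator U x" for x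
  proof (cases "x \<in> U")
    case True
    then have "infdist x (- U) \<noteq> 0"
      using U False in_closed_iff_infdist_zero[of "- U" x] by auto
    then have pos: "0 < infdist x (- U)" using infdist_nonneg[of x "- U"] by linarith
    obtain n0 where n0: "1 / infdist x (- U) \<le> real n0" using real_arch_simple by blast
    have "f m x = 1" if "n0 \<le> m" for m
    proof -
      have "1 / infdist x (- U) \<le> real m" using n0 that by linarith
      with pos show ?thesis by (simp add: f_def field_simps)
    qed
    with True show ?thesis by (intro tendsto_eventually eventually_sequentiallyI[of n0]) auto
  next
    case False
    then show ?thesis by (simp add: f_def)
  qed
  have int_le: "(\<integral>x. f m x \<partial>\<nu>) \<le> a" for m
  proof (rule LIMSEQ_le_const2)
    show "(\<lambda>n. \<integral>x. f m x \<partial>\<mu> n) \<longlonglongrightarrow> (\<integral>x. f m x \<partial>\<nu>)"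
      by (rule weak_conv_imp_integral_bdd_continuous_conv[OF \<mu> \<nu> conv f_cont, where B=1])
        (use f_range in auto)
    show "\<exists>N. \<forall>n\<ge>N. (\<integral>x. f m x \<partial>\<mu> n) \<le> a"
    proof (intro exI allI impI)
      fix n assume "k \<le> n"
      interpret n: real_distribution "\<mu> n" by (rule \<mu>)
      have "(\<integral>x. f m x \<partial>\<mu> n) \<le> (\<integral>x. indicator U x \<partial>\<mu> n)"
        by (rule integral_mono)
          (use f_range f_le in \<open>auto intro!: n.integrable_const_bound[where B=1]\<close>)
      also have "\<dots> = measure (\<mu> n) U" by simp
      also have "\<dots> \<le> a" using bound \<open>k \<le> n\<close> by simp
      finally show "(\<integral>x. f m x \<partial>\<mu> n) \<le> a" .
    qed
  qed
  have "(\<lambda>m. \<integral>x. f m x \<partial>\<nu>) \<longlonglongrightarrow> (\<integral>x. indicator U x \<partial>\<nu>)"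
    by (rule integral_dominated_convergence[where w="\<lambda>_. 1"]) (use f_lim f_range in auto)
  then have "(\<integral>x. indicator U x \<partial>\<nu>) \<le> a"
    using int_le by (intro LIMSEQ_le_const2) auto
  then show ?thesis by simp
qed

text \<open>Layer cake: up to 1/n, \<open>h\<close> is the average of the indicators of the n
  superlevel sets {h >= i/n}, and each of them contributes at most epsilon/n to the
  difference.\<close>

lemma setwise_close_imp_integral_close:
  fixes \<mu> \<nu> :: "real measure"
  assumes "real_distribution \<mu>" "real_distribution \<nu>"
    and close: "\<And>B. B \<in> sets borel \<Longrightarrow> \<bar>measure \<mu> B - measure \<nu> B\<bar> \<le> \<epsilon>"
    and h[measurable]: "h \<in> borel_measurable borel" and range: "\<And>x. h x \<in> {0..1}"
  shows "\<bar>(\<integral>x. h x \<partial>\<mu>) - (\<integral>x. h x \<partial>\<nu>)\<bar> \<le> \<epsilon>"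
proof (rule field_le_epsilon)
  fix e :: real assume "0 < e"
  interpret m: real_distribution \<mu> by fact
  interpret n: real_distribution \<nu> by fact
  \<comment> \<open>The discretisation error 1/n is paid once for each of the two measures.\<close>
  obtain n where n: "2 / e < real n" using reals_Archimedean2 by blast
  have "0 < n" using n \<open>0 < e\<close> by (cases n) (auto simp: field_simps)
  define g where "g = (\<lambda>x. \<Sum>i\<in>{1..n}. indicator {x. real i / real n \<le> h x} x / real n)"
  have g_eq: "g x = real_of_int \<lfloor>real n * h x\<rfloor> / real n" for x
  proof -
    let ?k = "nat \<lfloor>real n * h x\<rfloor>"
    have "real n * h x \<le> real n" using range[of x] \<open>0 < n\<close> by (simp add: mult_left_le)
    then have "?k \<le> n" by linarith
    have "{i\<in>{1..n}. real i / real n \<le> h x} = {1..?k}"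
    proof -
      have "real i / real n \<le> h x \<longleftrightarrow> i \<le> ?k" if "1 \<le> i" for i
        using \<open>0 < n\<close> that range[of x] by (simp add: field_simps le_nat_iff le_floor_iff)
      with \<open>?k \<le> n\<close> show ?thesis by auto
    qed
    moreover have "g x = real (card {i\<in>{1..n}. real i / real n \<le> h x}) / real n"
      by (auto simp: g_def indicator_def intro!: arg_cong[where f=card] simp flip: sum_divide_distrib sum.inter_filter)
    ultimately show ?thesis using range[of x] by simp
  qed
  have gh: "\<bar>h x - g x\<bar> \<le> 1 / real n" for x
  proof -
    have "\<bar>h x - g x\<bar> = (real n * h x - real_of_int \<lfloor>real n * h x\<rfloor>) / real n"
      using \<open>0 < n\<close> unfolding g_eq by (simp add: field_simps abs_if) linarith
    also have "\<dots> \<le> 1 / real n" by (intro divide_right_mono) linarith+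
    finally show ?thesis .
  qed
  have g_range: "\<bar>g x\<bar> \<le> 2" for x
  proof -
    have "1 / real n \<le> 1" using \<open>0 < n\<close> by simp
    then show ?thesis using gh[of x] range[of x] by auto
  qed
  have [measurable]: "g \<in> borel_measurable borel" unfolding g_def by measurable
  have diff: "\<bar>(\<integral>x. h x \<partial>\<kappa>) - (\<integral>x. g x \<partial>\<kappa>)\<bar> \<le> 1 / real n" if "real_distribution \<kappa>" for \<kappa>
  proof -
    interpret k: real_distribution \<kappa> by fact
    have i: "integrable \<kappa> h" "integrable \<kappa> g"
      using range g_range by (auto intro!: k.integrable_const_bound[where B=2] AE_I2) (smt (verit) range atLeastAtMost_iff)+
    then have "\<bar>(\<integral>x. h x \<partial>\<kappa>) - (\<integral>x. g x \<partial>\<kappa>)\<bar> = \<bar>\<integral>x. h x - g x \<partial>\<kappa>\<bar>" by simp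
    also have "\<dots> \<le> (\<integral>x. \<bar>h x - g x\<bar> \<partial>\<kappa>)" by (rule integral_abs_bound)
    also have "\<dots> \<le> 1 / real n"
      by (rule k.integral_le_const) (use i gh in auto)
    finally show ?thesis .
  qed
  have g_int: "(\<integral>x. g x \<partial>\<kappa>) = (\<Sum>i\<in>{1..n}. measure \<kappa> {x. real i / real n \<le> h x} / real n)"
    if "real_distribution \<kappa>" for \<kappa>
  proof -
    interpret k: real_distribution \<kappa> by fact
    show ?thesis unfolding g_def
      by (subst Bochner_Integration.integral_sum) (auto simp: less_top[symmetric])
  qed
  have "\<bar>(\<integral>x. g x \<partial>\<mu>) - (\<integral>x. g x \<partial>\<nu>)\<bar> \<le> (\<Sum>i\<in>{1..n}. \<epsilon> / real n)"
    unfolding g_int[OF assms(1)] g_int[OF assms(2)] sum_subtractf[symmetric] diff_divide_distrib[symmetric]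
    by (intro order_trans[OF sum_abs] sum_mono) (auto simp: abs_divide intro!: divide_right_mono close)
  also have "\<dots> = \<epsilon>" using \<open>0 < n\<close> by simp
  finally have "\<bar>(\<integral>x. h x \<partial>\<mu>) - (\<integral>x. h x \<partial>\<nu>)\<bar> \<le> \<epsilon> + 2 * (1 / real n)"
    using diff[OF assms(1)] diff[OF assms(2)] by linarith
  moreover have "2 * (1 / real n) \<le> e" using n \<open>0 < n\<close> \<open>0 < e\<close> by (simp add: field_simps)
  ultimately show "\<bar>(\<integral>x. h x \<partial>\<mu>) - (\<integral>x. h x \<partial>\<nu>)\<bar> \<le> \<epsilon> + e" by linarith
qed

section \<open>Tightness, coupling and mixing\<close>

locale negative_drift_walk = prob_space M for M :: "'w measure" +
  fixes V :: "nat \<Rightarrow> 'w \<Rightarrow> real"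
  assumes indep: "indep_vars (\<lambda>_. borel) V UNIV"
    and ident: "\<And>l. distr M borel (V l) = distr M borel (V 0)"
    and increment_integrable: "integrable M (V 0)"
    and drift: "expectation (V 0) < 0"
begin

abbreviation W :: "nat \<Rightarrow> 'w \<Rightarrow> real" where
  "W k \<omega> \<equiv> reflected_walk (\<lambda>l. V l \<omega>) k"

lemma V_measurable[measurable]: "V l \<in> borel_measurable M"
  using indep by (auto simp: indep_vars_def)

lemma W_measurable[measurable]: "W k \<in> borel_measurable M"
  by (intro borel_measurable_reflected_walk) auto

lemma shifted_walk_measurable[measurable]:
  "(\<lambda>\<omega>. reflected_walk (\<lambda>l. V (i + l) \<omega>) k) \<in> borel_measurable M"
  by (intro borel_measurable_reflected_walk) auto

text \<open>Every window of k increments has the same product law, so no functional of it can tell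
  where it starts. The empty window is separate because the product characterisation of independence
  is for nonempty index sets.\<close>

lemma distr_shift:
  assumes [measurable]: "f \<in> borel_measurable (\<Pi>\<^sub>M l\<in>{..<k}. borel)"
  shows "distr M borel (\<lambda>\<omega>. f (\<lambda>l\<in>{..<k}. V (i + l) \<omega>)) = distr M borel (\<lambda>\<omega>. f (\<lambda>l\<in>{..<k}. V l \<omega>))"
proof (cases "k = 0")
  case False
  have ind: "indep_vars (\<lambda>_. borel) (\<lambda>l. V (i + l)) {..<k}" for i
  proof -
    have "indep_vars (\<lambda>l. PiM {i + l} (\<lambda>_. borel)) (\<lambda>l \<omega>. restrict (\<lambda>j. V j \<omega>) {i + l}) {..<k}"
      by (rule indep_vars_restrict[OF indep]) (auto simp: disjoint_family_on_def)
    from indep_vars_compose2[OF this, of "\<lambda>l f. f (i + l)" "\<lambda>_. borel"]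
    show ?thesis by simp
  qed
  have *: "distr M (\<Pi>\<^sub>M l\<in>{..<k}. borel) (\<lambda>\<omega>. \<lambda>l\<in>{..<k}. V (i + l) \<omega>) =
      (\<Pi>\<^sub>M l\<in>{..<k}. distr M borel (V 0))" for i
  proof -
    have "distr M (\<Pi>\<^sub>M l\<in>{..<k}. borel) (\<lambda>\<omega>. \<lambda>l\<in>{..<k}. V (i + l) \<omega>) =
      (\<Pi>\<^sub>M l\<in>{..<k}. distr M borel (V (i + l)))"
      using ind[of i] False by (subst (asm) indep_vars_iff_distr_eq_PiM) (auto simp: lessThan_empty_iff)
    then show ?thesis by (simp only: ident[of "i + _"])
  qed
  have d: "distr M borel (\<lambda>\<omega>. f (\<lambda>l\<in>{..<k}. V (i + l) \<omega>)) =
      distr (distr M (\<Pi>\<^sub>M l\<in>{..<k}. borel) (\<lambda>\<omega>. \<lambda>l\<in>{..<k}. V (i + l) \<omega>)) borel f" for i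
    by (subst distr_distr) (auto simp: comp_def)
  moreover have "distr M (\<Pi>\<^sub>M l\<in>{..<k}. borel) (\<lambda>\<omega>. \<lambda>l\<in>{..<k}. V l \<omega>) = (\<Pi>\<^sub>M l\<in>{..<k}. distr M borel (V 0))"
    using *[of 0] by simp
  ultimately show ?thesis using d[of i] d[of 0] by (simp add: *)
qed (simp add: restrict_def)

lemma distr_shifted_walk:
  "distr M borel (\<lambda>\<omega>. reflected_walk (\<lambda>l. V (i + l) \<omega>) k) = distr M borel (W k)"
proof -
  have "(\<lambda>v. reflected_walk v k) \<in> borel_measurable (\<Pi>\<^sub>M l\<in>{..<k}. borel)"
    by (intro borel_measurable_reflected_walk) auto
  from distr_shift[OF this, of i] show ?thesis
    by (simp cong: reflected_walk_cong)
qed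

lemma distr_shifted_sum:
  "distr M borel (\<lambda>\<omega>. \<Sum>l<k. V (i + l) \<omega>) = distr M borel (\<lambda>\<omega>. \<Sum>l<k. V l \<omega>)"
proof -
  have "(\<lambda>v. \<Sum>l<k. v l :: real) \<in> borel_measurable (\<Pi>\<^sub>M l\<in>{..<k}. borel)"
    by (rule borel_measurable_sum[of "{..<k}" "\<lambda>l v. v l"]) auto
  from distr_shift[OF this, of i] show ?thesis by simp
qed

text \<open>W_i uses the increments before \<open>i\<close>, the walk restarted at \<open>i\<close>
  those from \<open>i\<close> on; disjoint blocks are independent.\<close>

lemma indep_walk_shifted_walk:
  "indep_var borel (W i) borel (\<lambda>\<omega>. reflected_walk (\<lambda>l. V (i + l) \<omega>) k)"
proof -
  have "indep_var borel ((\<lambda>f. reflected_walk f i) \<circ> (\<lambda>\<omega>. restrict (\<lambda>i. V i \<omega>) {..<i}))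
      borel ((\<lambda>f. reflected_walk (\<lambda>l. f (i + l)) k) \<circ> (\<lambda>\<omega>. restrict (\<lambda>i. V i \<omega>) {i..<i+k}))"
    by (intro indep_var_compose[OF indep_var_restrict[OF indep]] borel_measurable_reflected_walk) auto
  moreover have "(\<lambda>f. reflected_walk f i) \<circ> (\<lambda>\<omega>. restrict (\<lambda>i. V i \<omega>) {..<i}) = W i"
    by (auto simp: fun_eq_iff intro!: reflected_walk_cong)
  moreover have "(\<lambda>f. reflected_walk (\<lambda>l. f (i + l)) k) \<circ> (\<lambda>\<omega>. restrict (\<lambda>i. V i \<omega>) {i..<i+k})
      = (\<lambda>\<omega>. reflected_walk (\<lambda>l. V (i + l) \<omega>) k)"
    by (auto simp: fun_eq_iff intro!: reflected_walk_cong)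
  ultimately show ?thesis by simp
qed

text \<open>The part of the weak law of large numbers that coupling requires, obtained from
  sublinear growth: raising every increment by half of the absolute drift m keeps the drift
  negative, and on the event in question the raised walk is at height at least km/4, which is rare
  by Markov's inequality.\<close>

lemma sum_below:
  assumes "0 < \<epsilon>"
  shows "\<forall>\<^sub>F k in sequentially. prob {\<omega>\<in>space M. - c < (\<Sum>l<k. V l \<omega>)} \<le> \<epsilon>"
proof -
  define m where "m = - expectation (V 0)"
  have m: "0 < m" using drift by (simp add: m_def)
  define V' where "V' = (\<lambda>l \<omega>. V l \<omega> + m / 2)"
  define R where "R = (\<lambda>k \<omega>. reflected_walk (\<lambda>l. V' l \<omega>) k)"
  have ind: "indep_vars (\<lambda>_. borel) V' UNIV"
    unfolding V'_def by (rule indep_vars_compose2[OF indep]) auto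
  have id: "distr M borel (V' l) = distr M borel (V' 0)" for l
    using distr_distr[of "\<lambda>x. x + m / 2" borel borel "V l" M] distr_distr[of "\<lambda>x. x + m / 2" borel borel "V 0" M]
    by (simp add: V'_def comp_def ident[of l])
  have int: "integrable M (V' 0)" using increment_integrable by (simp add: V'_def)
  have "expectation (V' 0) = - m + m / 2"
    using increment_integrable by (simp add: V'_def m_def prob_space)
  then have neg: "expectation (V' 0) < 0" using m by simp
  \<comment> \<open>This growth rate yields exactly epsilon when Markov's inequality is applied at
    height km/4.\<close>
  have pos: "0 < \<epsilon> * m / 4" using assms m by simp
  have R: "\<forall>\<^sub>F k in sequentially. expectation (R k) \<le> \<epsilon> * m / 4 * real k" "integrable M (R k)" for k
    unfolding R_def using reflected_walk_sublinear[OF ind id int neg pos] by auto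
  \<comment> \<open>Ensures c <= km/4: half of the total raise km/2 pays for the level -c.\<close>
  obtain k0 where k0: "4 * c / m \<le> real k0" using real_arch_simple by blast
  have "\<forall>\<^sub>F k in sequentially. k \<ge> max 1 k0" by (rule eventually_ge_at_top)
  with R(1) show ?thesis
  proof eventually_elim
    case (elim k)
    have kpos: "0 < real k" using elim by simp
    have "4 * c / m \<le> real k" using elim k0 by linarith
    then have c: "c \<le> real k * m / 4" using m by (simp add: field_simps)
    have incl: "{\<omega>\<in>space M. - c < (\<Sum>l<k. V l \<omega>)} \<subseteq> {\<omega>\<in>space M. real k * m / 4 \<le> R k \<omega>}"
    proof safe
      fix \<omega> assume "- c < (\<Sum>l<k. V l \<omega>)"
      moreover have "(\<Sum>l<k. V' l \<omega>) \<le> R k \<omega>" unfolding R_def by (rule sum_le_reflected_walk)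
      moreover have "(\<Sum>l<k. V' l \<omega>) = (\<Sum>l<k. V l \<omega>) + real k * m / 2"
        by (simp add: V'_def sum.distrib)
      ultimately show "real k * m / 4 \<le> R k \<omega>" using c by linarith
    qed
    have [measurable]: "R k \<in> borel_measurable M" using R(2) by (rule borel_measurable_integrable)
    have "prob {\<omega>\<in>space M. - c < (\<Sum>l<k. V l \<omega>)} \<le> prob {\<omega>\<in>space M. real k * m / 4 \<le> R k \<omega>}"
      by (rule finite_measure_mono[OF incl]) measurable
    also have "\<dots> \<le> expectation (R k) / (real k * m / 4)"
      by (rule integral_Markov_inequality_measure[OF R(2), of "{}"])
        (use m kpos in \<open>auto simp: R_def reflected_walk_nonneg\<close>)
    also have "\<dots> \<le> (\<epsilon> * m / 4 * real k) / (real k * m / 4)"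
      by (rule divide_right_mono) (use elim m in auto)
    also have "\<dots> = \<epsilon>" using m kpos by simp
    finally show ?case .
  qed
qed

end

locale walk_with_limit = negative_drift_walk +
  fixes \<pi> :: "real measure"
  assumes limit_distribution: "real_distribution \<pi>"
    and walk_converges: "weak_conv_m (\<lambda>k. distr M borel (W k)) \<pi>"
begin

sublocale \<pi>: real_distribution \<pi> by (rule limit_distribution)

text \<open>The walk started at 0 is stochastically increasing in time, which turns tightness of the
  limit into uniform tightness.\<close>

lemma walk_tight:
  assumes "0 < \<epsilon>"
  shows "\<exists>c. \<forall>i. prob {\<omega>\<in>space M. c < W i \<omega>} \<le> \<epsilon>"
proof -
  \<comment> \<open>A continuous ramp from 0 at n to 1 at n + 1: weak convergence applies to its
    mean, and it dominates the indicator of heights above n + 1.\<close>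
  define f where "f = (\<lambda>n x::real. min 1 (max 0 (x - real n)))"
  have f_cont: "isCont (f n) x" for n x unfolding f_def by (intro continuous_intros)
  have [measurable]: "f n \<in> borel_measurable borel" for n unfolding f_def by measurable
  have f_range: "0 \<le> f n x" "f n x \<le> 1" for n x by (auto simp: f_def)
  have int: "integrable M (\<lambda>\<omega>. f n (X \<omega>))" if "X \<in> borel_measurable M" for X n
    by (rule integrable_const_bound[where B=1]) (use f_range that in auto)
  \<comment> \<open>The walk restarted at \<open>d\<close> has at time d + i the law of W_i and lies
    below W at that time.\<close>
  have mono: "expectation (\<lambda>\<omega>. f n (W i \<omega>)) \<le> expectation (\<lambda>\<omega>. f n (W (d + i) \<omega>))" for n i d
  proof -
    have "expectation (\<lambda>\<omega>. f n (W i \<omega>)) = expectation (\<lambda>\<omega>. f n (reflected_walk (\<lambda>l. V (d + l) \<omega>) i))"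
      using integral_distr[of "W i" M borel "f n"] distr_shifted_walk[of d i]
        integral_distr[of "\<lambda>\<omega>. reflected_walk (\<lambda>l. V (d + l) \<omega>) i" M borel "f n"] by simp
    also have "\<dots> \<le> expectation (\<lambda>\<omega>. f n (W (d + i) \<omega>))"
    proof (intro integral_mono int)
      fix \<omega>
      have "reflected_walk (\<lambda>l. V (d + l) \<omega>) i \<le> W (d + i) \<omega>" by (rule reflected_walk_shift_le)
      then show "f n (reflected_walk (\<lambda>l. V (d + l) \<omega>) i) \<le> f n (W (d + i) \<omega>)"
        by (auto simp: f_def)
    qed auto
    finally show ?thesis .
  qed
  \<comment> \<open>Means that increase in time stay below their limit, so a single tail of the
    limit law bounds the tails at all times.\<close>
  have le: "expectation (\<lambda>\<omega>. f n (W i \<omega>)) \<le> (\<integral>x. f n x \<partial>\<pi>)" for n i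
  proof (rule LIMSEQ_le_const)
    show "(\<lambda>k. expectation (\<lambda>\<omega>. f n (W k \<omega>))) \<longlonglongrightarrow> (\<integral>x. f n x \<partial>\<pi>)"
      using weak_conv_imp_integral_bdd_continuous_conv[OF _ limit_distribution walk_converges, of "f n" 1]
        f_cont f_range by (simp add: integral_distr)
    show "\<exists>N. \<forall>k\<ge>N. expectation (\<lambda>\<omega>. f n (W i \<omega>)) \<le> expectation (\<lambda>\<omega>. f n (W k \<omega>))"
      using mono[of n i] by (metis le_add_diff_inverse2)
  qed
  have "(\<lambda>n. \<integral>x. f n x \<partial>\<pi>) \<longlonglongrightarrow> (\<integral>x. 0 \<partial>\<pi>)"
  proof (rule integral_dominated_convergence[where w="\<lambda>_. 1"])
    show "AE x in \<pi>. (\<lambda>n. f n x) \<longlonglongrightarrow> 0"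
    proof (intro AE_I2 tendsto_eventually)
      fix x :: real
      obtain n0 where "x \<le> real n0" using real_arch_simple by blast
      then show "\<forall>\<^sub>F n in sequentially. f n x = 0"
        by (intro eventually_sequentiallyI[of n0]) (auto simp: f_def)
    qed
  qed (use f_range in auto)
  then have "\<forall>\<^sub>F n in sequentially. (\<integral>x. f n x \<partial>\<pi>) < \<epsilon>"
    using assms by (auto dest: order_tendstoD(2))
  then obtain n where n: "(\<integral>x. f n x \<partial>\<pi>) < \<epsilon>"
    using eventually_happens'[OF sequentially_bot] by blast
  have "prob {\<omega>\<in>space M. real n + 1 < W i \<omega>} \<le> \<epsilon>" for i
  proof -
    have "prob {\<omega>\<in>space M. real n + 1 < W i \<omega>} = expectation (indicator {\<omega>\<in>space M. real n + 1 < W i \<omega>})"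
      by simp
    also have "\<dots> \<le> expectation (\<lambda>\<omega>. f n (W i \<omega>))"
      by (intro integral_mono int) (auto simp: f_def indicator_def less_top[symmetric])
    finally show ?thesis using le[of n i] n by linarith
  qed
  then show ?thesis by blast
qed

text \<open>By \<open>reflected_walk_coupling\<close> the walk and its restart at \<open>i\<close>
  can differ at i + k only if W_i > c or the k increments from \<open>i\<close> on sum to more than
  -c. Tightness provides c and \<open>sum_below\<close> then K, neither depending on
  \<open>i\<close>.\<close>

lemma coupling_probability:
  assumes "0 < \<epsilon>"
  shows "\<exists>K. \<forall>i. \<forall>k\<ge>K. prob {\<omega>\<in>space M. W (i + k) \<omega> \<noteq> reflected_walk (\<lambda>l. V (i + l) \<omega>) k} \<le> \<epsilon>"
proof -
  obtain c where c: "\<And>i. prob {\<omega>\<in>space M. c < W i \<omega>} \<le> \<epsilon> / 2"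
    using walk_tight[of "\<epsilon> / 2"] assms by auto
  obtain K where K: "\<And>k. k \<ge> K \<Longrightarrow> prob {\<omega>\<in>space M. - c < (\<Sum>l<k. V l \<omega>)} \<le> \<epsilon> / 2"
    using sum_below[of "\<epsilon> / 2" c] assms by (auto simp: eventually_sequentially)
  have "prob {\<omega>\<in>space M. W (i + k) \<omega> \<noteq> reflected_walk (\<lambda>l. V (i + l) \<omega>) k} \<le> \<epsilon>" if "K \<le> k" for i k
  proof -
    have "{\<omega>\<in>space M. W (i + k) \<omega> \<noteq> reflected_walk (\<lambda>l. V (i + l) \<omega>) k} \<subseteq>
        {\<omega>\<in>space M. c < W i \<omega>} \<union> {\<omega>\<in>space M. - c < (\<Sum>l<k. V (i + l) \<omega>)}"
    proof (safe, goal_cases)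
      case (1 \<omega>)
      with reflected_walk_coupling[of "\<lambda>l. V l \<omega>" i k] show ?case by force
    qed
    then have "prob {\<omega>\<in>space M. W (i + k) \<omega> \<noteq> reflected_walk (\<lambda>l. V (i + l) \<omega>) k} \<le>
        prob ({\<omega>\<in>space M. c < W i \<omega>} \<union> {\<omega>\<in>space M. - c < (\<Sum>l<k. V (i + l) \<omega>)})"
      by (rule finite_measure_mono) measurable
    also have "\<dots> \<le> prob {\<omega>\<in>space M. c < W i \<omega>} + prob {\<omega>\<in>space M. - c < (\<Sum>l<k. V (i + l) \<omega>)}"
      by (rule measure_Un_le) measurable
    also have "prob {\<omega>\<in>space M. - c < (\<Sum>l<k. V (i + l) \<omega>)} = prob {\<omega>\<in>space M. - c < (\<Sum>l<k. V l \<omega>)}"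
    proof -
      have "prob {\<omega>\<in>space M. - c < (\<Sum>l<k. V (i + l) \<omega>)} = measure (distr M borel (\<lambda>\<omega>. \<Sum>l<k. V (i + l) \<omega>)) {- c <..}" for i
        by (subst measure_distr) (auto intro!: arg_cong[where f=prob])
      from this[of i] this[of 0] show ?thesis by (simp add: distr_shifted_sum)
    qed
    finally show ?thesis using c[of i] K[OF that] by linarith
  qed
  then show ?thesis by blast
qed

text \<open>The laws at times k and i + k differ on every Borel set by at most the coupling error,
  uniformly in i. Letting i tend to infinity compares the law at time k with \<pi>, at first on open
  sets only, as weak convergence gives no more.\<close>

lemma walk_expectation_tendsto:
  fixes h :: "real \<Rightarrow> real"
  assumes h[measurable]: "h \<in> borel_measurable borel" and range: "\<And>x. h x \<in> {0..1}"
  shows "(\<lambda>k. expectation (\<lambda>\<omega>. h (W k \<omega>))) \<longlonglongrightarrow> (\<integral>x. h x \<partial>\<pi>)"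
proof (rule LIMSEQ_I)
  fix e :: real assume "0 < e"
  then obtain K where K: "\<And>i k. k \<ge> K \<Longrightarrow>
      prob {\<omega>\<in>space M. W (i + k) \<omega> \<noteq> reflected_walk (\<lambda>l. V (i + l) \<omega>) k} \<le> e / 2"
    using coupling_probability[of "e / 2"] by auto
  have "\<bar>(\<integral>x. h x \<partial>distr M borel (W k)) - (\<integral>x. h x \<partial>\<pi>)\<bar> \<le> e / 2" if k: "K \<le> k" for k
  proof (rule setwise_close_imp_integral_close[OF _ limit_distribution _ h range])
    let ?P = "\<lambda>k. distr M borel (W k)"
    show rd: "real_distribution (?P k)" for k by simp
    \<comment> \<open>The restart at \<open>i\<close> has the law of W_k, whatever i is.\<close>
    have near: "measure (?P (i + k)) B \<le> measure (?P k) B + e / 2" if [measurable]: "B \<in> sets borel" for i B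
    proof -
      let ?R = "\<lambda>\<omega>. reflected_walk (\<lambda>l. V (i + l) \<omega>) k"
      have "measure (?P (i + k)) B = prob {\<omega>\<in>space M. W (i + k) \<omega> \<in> B}"
        by (subst measure_distr) (auto intro!: arg_cong[where f=prob])
      also have "\<dots> \<le> prob ({\<omega>\<in>space M. ?R \<omega> \<in> B} \<union> {\<omega>\<in>space M. W (i + k) \<omega> \<noteq> ?R \<omega>})"
        by (rule finite_measure_mono) auto
      also have "\<dots> \<le> prob {\<omega>\<in>space M. ?R \<omega> \<in> B} + prob {\<omega>\<in>space M. W (i + k) \<omega> \<noteq> ?R \<omega>}"
        by (rule measure_Un_le) measurable
      also have "prob {\<omega>\<in>space M. ?R \<omega> \<in> B} = measure (distr M borel ?R) B"
        by (subst measure_distr) (auto intro!: arg_cong[where f=prob])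
      finally show ?thesis using K[OF k, of i] by (simp add: distr_shifted_walk)
    qed
    have open_le: "measure \<pi> U \<le> measure (?P k) U + e / 2" if "open U" for U
    proof (rule weak_limit_open_le[OF rd limit_distribution walk_converges that, of k])
      fix n assume "k \<le> n"
      then show "measure (?P n) U \<le> measure (?P k) U + e / 2"
        using near[of U "n - k"] that by auto
    qed
    \<comment> \<open>The Borel set is enclosed in an open one that is hardly larger for the law at
      the finite time k; the passage to \<pi> is then made on the open set.\<close>
    have le: "measure \<pi> B \<le> measure (?P k) B + e / 2" if B[measurable]: "B \<in> sets borel" for B
    proof (rule field_le_epsilon)
      fix d :: real assume "0 < d"
      interpret p: real_distribution "?P k" by (rule rd)
      have "(INF U \<in> {U. B \<subseteq> U \<and> open U}. emeasure (?P k) U) < ennreal (measure (?P k) B + d)"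
        using outer_regular[of "?P k" B] \<open>0 < d\<close> p.emeasure_eq_measure
        by (auto simp: ennreal_less_iff)
      then obtain U where U: "B \<subseteq> U" "open U" "emeasure (?P k) U < ennreal (measure (?P k) B + d)"
        by (auto simp: INF_less_iff)
      then have "measure (?P k) U < measure (?P k) B + d"
        by (simp add: p.emeasure_eq_measure ennreal_less_iff)
      moreover have "measure \<pi> B \<le> measure \<pi> U"
        using U by (intro \<pi>.finite_measure_mono) auto
      ultimately show "measure \<pi> B \<le> measure (?P k) B + e / 2 + d"
        using open_le[OF U(2)] by linarith
    qed
    fix B :: "real set" assume B[measurable]: "B \<in> sets borel"
    interpret p: real_distribution "?P k" by (rule rd)
    \<comment> \<open>The inequality for the complement of B is the reverse inequality for
      B.\<close>
    have "measure \<pi> (UNIV - B) = 1 - measure \<pi> B" "measure (?P k) (UNIV - B) = 1 - measure (?P k) B"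
      using \<pi>.prob_compl[of B] p.prob_compl[of B] by auto
    with le[of B] le[of "UNIV - B"] have "measure \<pi> B \<le> measure (?P k) B + e / 2"
        "measure (?P k) B \<le> measure \<pi> B + e / 2" by auto
    then show "\<bar>measure (?P k) B - measure \<pi> B\<bar> \<le> e / 2" by linarith
  qed
  moreover have "(\<integral>x. h x \<partial>distr M borel (W k)) = expectation (\<lambda>\<omega>. h (W k \<omega>))" for k
    by (simp add: integral_distr)
  ultimately show "\<exists>no. \<forall>k\<ge>no. norm (expectation (\<lambda>\<omega>. h (W k \<omega>)) - (\<integral>x. h x \<partial>\<pi>)) < e"
    using \<open>0 < e\<close> by (intro exI[of _ K]) (smt (verit) real_norm_def field_sum_of_halves)
qed

text \<open>W at time i + k is replaced by the walk restarted at \<open>i\<close>, at a cost of at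
  most twice the coupling error. The replacement is independent of W_i and distributed as W_k, so
  its mean is close to \<open>c\<close>. Because of the centring at the limit, the product of the
  two means is small through the second factor alone, uniformly in \<open>i\<close>.\<close>

lemma walk_decorrelates:
  fixes h :: "real \<Rightarrow> real"
  assumes h[measurable]: "h \<in> borel_measurable borel" and range: "\<And>x. h x \<in> {0..1}" and "0 < \<epsilon>"
  defines "c \<equiv> \<integral>x. h x \<partial>\<pi>"
  shows "\<exists>K. \<forall>i. \<forall>k\<ge>K. \<bar>expectation (\<lambda>\<omega>. (h (W i \<omega>) - c) * (h (W (i + k) \<omega>) - c))\<bar> \<le> \<epsilon>"
proof -
  obtain K1 where K1: "\<And>k. k \<ge> K1 \<Longrightarrow> \<bar>expectation (\<lambda>\<omega>. h (W k \<omega>)) - c\<bar> \<le> \<epsilon> / 4"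
    using LIMSEQ_D[OF walk_expectation_tendsto[OF h range], of "\<epsilon> / 4"] \<open>0 < \<epsilon>\<close>
    unfolding c_def real_norm_def by (metis less_imp_le zero_less_divide_iff zero_less_numeral)
  obtain K2 where K2: "\<And>i k. k \<ge> K2 \<Longrightarrow>
      prob {\<omega>\<in>space M. W (i + k) \<omega> \<noteq> reflected_walk (\<lambda>l. V (i + l) \<omega>) k} \<le> \<epsilon> / 4"
    using coupling_probability[of "\<epsilon> / 4"] \<open>0 < \<epsilon>\<close> by auto
  have hb: "integrable \<pi> h"
    by (rule \<pi>.integrable_const_bound[where B=1]) (use range in auto)
  have "0 \<le> c" "c \<le> 1" unfolding c_def
    using range by (auto intro!: integral_nonneg \<pi>.integral_le_const hb)
  define g where "g = (\<lambda>x. h x - c)"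
  have [measurable]: "g \<in> borel_measurable borel" unfolding g_def by measurable
  have g: "\<bar>g x\<bar> \<le> 1" for x
    using range[of x] \<open>0 \<le> c\<close> \<open>c \<le> 1\<close> by (auto simp: g_def)
  have gg: "\<bar>g x * g y\<bar> \<le> 1" for x y
    using mult_mono[OF g[of x] g[of y]] by (simp add: abs_mult)
  have int: "integrable M (\<lambda>\<omega>. g (X \<omega>))" if "X \<in> borel_measurable M" for X
    by (rule integrable_const_bound[where B=1]) (use g that in auto)
  have int2: "integrable M (\<lambda>\<omega>. g (X \<omega>) * g (Y \<omega>))" if "X \<in> borel_measurable M" "Y \<in> borel_measurable M" for X Y
    by (rule integrable_const_bound[where B=1]) (use gg that in auto)
  have "\<bar>expectation (\<lambda>\<omega>. g (W i \<omega>) * g (W (i + k) \<omega>))\<bar> \<le> \<epsilon>" if k: "k \<ge> max K1 K2" for i k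
  proof -
    let ?R = "\<lambda>\<omega>. reflected_walk (\<lambda>l. V (i + l) \<omega>) k"
    let ?E = "{\<omega>\<in>space M. W (i + k) \<omega> \<noteq> ?R \<omega>}"
    have "indep_var borel (g \<circ> W i) borel (g \<circ> ?R)"
      by (rule indep_var_compose[OF indep_walk_shifted_walk]) auto
    then have prod: "expectation (\<lambda>\<omega>. g (W i \<omega>) * g (?R \<omega>)) = expectation (\<lambda>\<omega>. g (W i \<omega>)) * expectation (\<lambda>\<omega>. g (?R \<omega>))"
      by (subst indep_var_lebesgue_integral[symmetric]) (auto simp: comp_def int)
    have "expectation (\<lambda>\<omega>. g (?R \<omega>)) = expectation (\<lambda>\<omega>. g (W k \<omega>))"
      using integral_distr[of "W k" M borel g] integral_distr[of ?R M borel g]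
      by (simp add: distr_shifted_walk)
    also have "\<dots> = expectation (\<lambda>\<omega>. h (W k \<omega>)) - c"
      unfolding g_def by (subst Bochner_Integration.integral_diff)
        (use range in \<open>auto simp: prob_space intro!: integrable_const_bound[where B=1]\<close>)
    finally have R: "\<bar>expectation (\<lambda>\<omega>. g (?R \<omega>))\<bar> \<le> \<epsilon> / 4" using K1[of k] k by simp
    have "\<bar>expectation (\<lambda>\<omega>. g (W i \<omega>))\<bar> \<le> expectation (\<lambda>\<omega>. \<bar>g (W i \<omega>)\<bar>)"
      by (rule integral_abs_bound)
    also have "\<dots> \<le> 1" by (rule integral_le_const) (use g int in auto)
    finally have "\<bar>expectation (\<lambda>\<omega>. g (W i \<omega>) * g (?R \<omega>))\<bar> \<le> 1 * (\<epsilon> / 4)"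
      unfolding prod abs_mult using R by (intro mult_mono) auto
    moreover have "\<bar>expectation (\<lambda>\<omega>. g (W i \<omega>) * g (W (i + k) \<omega>)) - expectation (\<lambda>\<omega>. g (W i \<omega>) * g (?R \<omega>))\<bar>
        \<le> 2 * (\<epsilon> / 4)"
    proof -
      have "\<bar>expectation (\<lambda>\<omega>. g (W i \<omega>) * g (W (i + k) \<omega>)) - expectation (\<lambda>\<omega>. g (W i \<omega>) * g (?R \<omega>))\<bar>
        = \<bar>expectation (\<lambda>\<omega>. g (W i \<omega>) * g (W (i + k) \<omega>) - g (W i \<omega>) * g (?R \<omega>))\<bar>"
        using int2 by simp
      also have "\<dots> \<le> expectation (\<lambda>\<omega>. \<bar>g (W i \<omega>) * g (W (i + k) \<omega>) - g (W i \<omega>) * g (?R \<omega>)\<bar>)"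
        by (rule integral_abs_bound)
      also have "\<dots> \<le> expectation (\<lambda>\<omega>. 2 * indicator ?E \<omega>)"
      proof (rule integral_mono)
        fix \<omega> assume "\<omega> \<in> space M"
        then show "\<bar>g (W i \<omega>) * g (W (i + k) \<omega>) - g (W i \<omega>) * g (?R \<omega>)\<bar> \<le> 2 * indicator ?E \<omega>"
          using gg[of "W i \<omega>" "W (i + k) \<omega>"] gg[of "W i \<omega>" "?R \<omega>"]
          by (auto simp: indicator_def)
      qed (use int2 in \<open>auto simp: less_top[symmetric]\<close>)
      also have "\<dots> = 2 * prob ?E" by simp
      also have "\<dots> \<le> 2 * (\<epsilon> / 4)" using K2[of k i] k by (intro mult_left_mono) auto
      finally show ?thesis .
    qed
    ultimately show ?thesis using \<open>0 < \<epsilon>\<close> by linarith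
  qed
  then show ?thesis unfolding g_def by blast
qed

end

section \<open>Entropy and the equipartition property\<close>

text \<open>The inequality ln y <= y - 1 at y = 1 / sqrt p gives -ln p <= 2 / sqrt p. This is what
  bounds the second moment of an information density however small the probability p.\<close>

lemma mult_ln_square_le:
  assumes "0 \<le> p" "p \<le> (1::real)"
  shows "p * (ln p)\<^sup>2 \<le> 4"
proof (cases "p = 0")
  case False
  with assms have p: "0 < p" by simp
  have "ln (1 / sqrt p) \<le> 1 / sqrt p - 1" using p by (intro ln_le_minus_one) simp
  then have "- ln p \<le> 2 / sqrt p" using p by (simp add: ln_div ln_sqrt)
  moreover have "0 \<le> - ln p" using p assms by simp
  ultimately have "(- ln p)\<^sup>2 \<le> (2 / sqrt p)\<^sup>2" by (intro power_mono)
  also have "\<dots> = 4 / p" using p by (simp add: power_divide)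
  finally show ?thesis using p by (simp add: field_simps)
qed simp

text \<open>Only the point 0 needs an argument: there |x ln x| <= 2 sqrt x by
  \<open>mult_ln_square_le\<close>.\<close>

lemma continuous_on_mult_ln: "continuous_on {0..} (\<lambda>x::real. x * ln x)"
  unfolding continuous_on_eq_continuous_within
proof
  fix x :: real assume "x \<in> {0..}"
  show "continuous (at x within {0..}) (\<lambda>x. x * ln x)"
  proof (cases "x = 0")
    case True
    have "((\<lambda>x::real. x * ln x) \<longlongrightarrow> 0) (at 0 within {0..})"
    proof (rule Lim_null_comparison)
      have "norm (x * ln x) \<le> 2 * sqrt x" if "0 \<le> x" "x \<le> 1" for x :: real
      proof -
        have "(x * ln x)\<^sup>2 = x * (x * (ln x)\<^sup>2)" by (simp add: power2_eq_square)
        also have "\<dots> \<le> x * 4" using mult_ln_square_le[OF that] that by (intro mult_left_mono) auto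
        also have "\<dots> = (2 * sqrt x)\<^sup>2" using that by (simp add: power_mult_distrib)
        finally have "\<bar>x * ln x\<bar>\<^sup>2 \<le> (2 * sqrt x)\<^sup>2" by simp
        then show ?thesis unfolding real_norm_def by (rule power2_le_imp_le) (use that in simp)
      qed
      then show "\<forall>\<^sub>F x in at 0 within {0..}. norm (x * ln x) \<le> 2 * sqrt x"
        by (auto simp: eventually_at dist_real_def intro!: exI[of _ "1::real"])
      show "((\<lambda>x. 2 * sqrt x) \<longlongrightarrow> 0) (at 0 within {0..})"
        by (rule tendsto_eq_intros | simp)+
    qed
    with True show ?thesis by (simp add: continuous_within)
  next
    case False
    then show ?thesis by (intro continuous_intros)
  qed
qed

lemma continuous_on_binary_entropy: "continuous_on {0..1} binary_entropy"
proof -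
  have "continuous_on {0..1} (\<lambda>q::real. - (q * ln q) / ln 2 - ((1 - q) * ln (1 - q)) / ln 2)"
    by (intro continuous_intros continuous_on_subset[OF continuous_on_mult_ln]
        continuous_on_compose2[OF continuous_on_mult_ln, of _ "\<lambda>q. 1 - q"]) auto
  also have "(\<lambda>q::real. - (q * ln q) / ln 2 - ((1 - q) * ln (1 - q)) / ln 2) = binary_entropy"
    by (simp add: binary_entropy_def log_def fun_eq_iff)
  finally show ?thesis .
qed

lemma binary_entropy_range:
  assumes "q \<in> {0..1}"
  shows "binary_entropy q \<in> {0..1}"
proof -
  \<comment> \<open>The right-hand side of the first inequality is the tangent of -x ln x at 1/2;
    its values at q and 1 - q add up to ln 2.\<close>
  have key: "- x * ln x \<le> x * ln 2 + (1/2 - x) \<and> 0 \<le> - x * ln x" if "0 \<le> x" "x \<le> 1" for x :: real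
  proof (cases "x = 0")
    case False
    with that have x: "0 < x" by simp
    have "ln (1 / (2 * x)) \<le> 1 / (2 * x) - 1" using x by (intro ln_le_minus_one) simp
    then have "x * ln (1 / (2 * x)) \<le> x * (1 / (2 * x) - 1)" using x by (intro mult_left_mono) auto
    also have "\<dots> = 1/2 - x" using x by (simp add: field_simps)
    finally have "x * ln (1 / (2 * x)) \<le> 1/2 - x" .
    moreover have "x * ln (1 / (2 * x)) = - x * ln x - x * ln 2"
      using x by (simp add: ln_div ln_mult algebra_simps)
    moreover have "x * ln x \<le> 0" using x that by (intro mult_nonneg_nonpos) auto
    ultimately show ?thesis by simp
  qed simp
  have q: "0 \<le> q" "q \<le> 1" "0 \<le> 1 - q" "1 - q \<le> 1" using assms by auto
  have "binary_entropy q = (- q * ln q + - (1 - q) * ln (1 - q)) / ln 2"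
    by (simp add: binary_entropy_def log_def field_simps)
  moreover have "- q * ln q + - (1 - q) * ln (1 - q) \<le> ln 2"
    using key[OF q(1,2)] key[OF q(3,4)] by (simp add: algebra_simps)
  moreover have "0 \<le> - q * ln q + - (1 - q) * ln (1 - q)"
    using key[OF q(1,2)] key[OF q(3,4)] by linarith
  ultimately show ?thesis by (simp add: divide_le_eq)
qed

section \<open>Greedy selection and a weak law for decorrelating sequences\<close>

text \<open>The bound is the one that independent uniform codewords satisfy on average. Given k
  codewords, the average over X of the cost of a further one against them is at most k B / |X|, so
  some candidate is that good. By symmetry it adds at most twice this amount, and k (k - 1) + 2 k =
  (k + 1) k. Codewords may repeat.\<close>

lemma greedy_codewords:
  fixes c :: "'a \<Rightarrow> 'a \<Rightarrow> real"
  assumes "finite X" "X \<noteq> {}"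
    and sym: "\<And>x x'. x \<in> X \<Longrightarrow> x' \<in> X \<Longrightarrow> c x x' = c x' x"
    and total: "\<And>x. x \<in> X \<Longrightarrow> (\<Sum>x'\<in>X. c x x') \<le> B"
  shows "\<exists>f. (\<forall>m. f m \<in> X) \<and>
    (\<Sum>m<k. \<Sum>m'\<in>{..<k} - {m}. c (f m) (f m')) \<le> real k * (real k - 1) * (B / real (card X))"
proof (induction k)
  case 0
  show ?case using assms(2) by auto
next
  case (Suc k)
  then obtain f where f: "\<And>m. f m \<in> X"
    "(\<Sum>m<k. \<Sum>m'\<in>{..<k} - {m}. c (f m) (f m')) \<le> real k * (real k - 1) * (B / real (card X))" by auto
  have X: "0 < real (card X)" using assms by (simp add: card_gt_0_iff)
  have "\<exists>x\<in>X. (\<Sum>m<k. c (f m) x) \<le> real k * (B / real (card X))"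
  proof (rule ccontr)
    assume "\<not> ?thesis"
    then have "(\<Sum>x\<in>X. real k * (B / real (card X))) < (\<Sum>x\<in>X. \<Sum>m<k. c (f m) x)"
      by (intro sum_strict_mono assms) auto
    also have "\<dots> = (\<Sum>m<k. \<Sum>x\<in>X. c (f m) x)" by (rule sum.swap)
    also have "\<dots> \<le> (\<Sum>m<k. B)" by (intro sum_mono total f)
    finally show False using X by simp
  qed
  then obtain x where x: "x \<in> X" "(\<Sum>m<k. c (f m) x) \<le> real k * (B / real (card X))" by auto
  let ?g = "f(k := x)"
  have "(\<Sum>m<Suc k. \<Sum>m'\<in>{..<Suc k} - {m}. c (?g m) (?g m'))
    = (\<Sum>m<k. (\<Sum>m'\<in>{..<k} - {m}. c (f m) (f m')) + c (f m) x) + (\<Sum>m<k. c x (f m))"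
  proof -
    have "(\<Sum>m'\<in>{..<Suc k} - {m}. c (?g m) (?g m')) = (\<Sum>m'\<in>{..<k} - {m}. c (f m) (f m')) + c (f m) x" if "m < k" for m
    proof -
      have "{..<Suc k} - {m} = insert k ({..<k} - {m})" using that by auto
      then show ?thesis using that by (simp add: add.commute)
    qed
    moreover have "(\<Sum>m'\<in>{..<Suc k} - {k}. c (?g k) (?g m')) = (\<Sum>m<k. c x (f m))"
      by (rule sum.cong) auto
    ultimately show ?thesis by simp
  qed
  also have "(\<Sum>m<k. c x (f m)) = (\<Sum>m<k. c (f m) x)"
    using f x by (intro sum.cong) (auto intro: sym)
  finally have "(\<Sum>m<Suc k. \<Sum>m'\<in>{..<Suc k} - {m}. c (?g m) (?g m'))
      \<le> real k * (real k - 1) * (B / real (card X)) + 2 * (real k * (B / real (card X)))"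
    using f(2) x(2) by (simp add: sum.distrib)
  also have "\<dots> = real (Suc k) * (real (Suc k) - 1) * (B / real (card X))"
    by (simp add: algebra_simps add_divide_distrib)
  finally show ?case using f x by (intro exI[of _ ?g]) auto
qed

text \<open>Chebyshev's inequality: in the double sum for the second moment, the pairs at distance
  at most K contribute at most n (2K + 1) C, all others at most epsilon each.\<close>

lemma (in prob_space) second_moment_weak_law:
  fixes Y :: "nat \<Rightarrow> 'a \<Rightarrow> real"
  assumes Y[measurable]: "\<And>i. 1 \<le> i \<Longrightarrow> Y i \<in> borel_measurable M"
    and sq: "\<And>i. 1 \<le> i \<Longrightarrow> integrable M (\<lambda>\<omega>. (Y i \<omega>)\<^sup>2)"
    and C: "\<And>i. 1 \<le> i \<Longrightarrow> expectation (\<lambda>\<omega>. (Y i \<omega>)\<^sup>2) \<le> C"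
    and decor: "\<And>\<epsilon>. 0 < \<epsilon> \<Longrightarrow> \<exists>K. \<forall>i\<ge>1. \<forall>k\<ge>K. \<bar>expectation (\<lambda>\<omega>. Y i \<omega> * Y (i + k) \<omega>)\<bar> \<le> \<epsilon>"
    and "0 < \<eta>"
  shows "(\<lambda>n. prob {\<omega>\<in>space M. \<eta> * real n \<le> \<bar>\<Sum>j=1..n. Y j \<omega>\<bar>}) \<longlonglongrightarrow> 0"
proof (rule LIMSEQ_I)
  fix e :: real assume "0 < e"
  \<comment> \<open>For large n both parts of the second moment are at most n^2 epsilon, so the
    final bound is e/2.\<close>
  define \<epsilon> where "\<epsilon> = \<eta>\<^sup>2 * e / 4"
  have \<epsilon>: "0 < \<epsilon>" using \<open>0 < e\<close> \<open>0 < \<eta>\<close> by (simp add: \<epsilon>_def)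
  obtain K where K: "\<And>i k. 1 \<le> i \<Longrightarrow> K \<le> k \<Longrightarrow> \<bar>expectation (\<lambda>\<omega>. Y i \<omega> * Y (i + k) \<omega>)\<bar> \<le> \<epsilon>"
    using decor[OF \<epsilon>] by blast
  have "0 \<le> expectation (\<lambda>\<omega>. (Y 1 \<omega>)\<^sup>2)" by (rule Bochner_Integration.integral_nonneg) simp
  then have C0: "0 \<le> C" using C[of 1] by linarith
  have int: "integrable M (\<lambda>\<omega>. Y i \<omega> * Y j \<omega>)" "\<bar>expectation (\<lambda>\<omega>. Y i \<omega> * Y j \<omega>)\<bar> \<le> C"
    if "1 \<le> i" "1 \<le> j" for i j
  proof -
    have le: "\<bar>Y i \<omega> * Y j \<omega>\<bar> \<le> ((Y i \<omega>)\<^sup>2 + (Y j \<omega>)\<^sup>2) / 2" for \<omega>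
    proof -
      have "0 \<le> (\<bar>Y i \<omega>\<bar> - \<bar>Y j \<omega>\<bar>)\<^sup>2" by simp
      then show ?thesis by (simp add: power2_diff abs_mult)
    qed
    show i: "integrable M (\<lambda>\<omega>. Y i \<omega> * Y j \<omega>)"
      by (rule Bochner_Integration.integrable_bound[of M "\<lambda>\<omega>. ((Y i \<omega>)\<^sup>2 + (Y j \<omega>)\<^sup>2) / 2"])
        (use that sq le in auto)
    have "\<bar>expectation (\<lambda>\<omega>. Y i \<omega> * Y j \<omega>)\<bar> \<le> expectation (\<lambda>\<omega>. \<bar>Y i \<omega> * Y j \<omega>\<bar>)"
      by (rule integral_abs_bound)
    also have "\<dots> \<le> expectation (\<lambda>\<omega>. ((Y i \<omega>)\<^sup>2 + (Y j \<omega>)\<^sup>2) / 2)"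
      by (intro integral_mono le) (use i that sq in auto)
    also have "\<dots> \<le> C" using C[OF that(1)] C[OF that(2)] sq that by simp
    finally show "\<bar>expectation (\<lambda>\<omega>. Y i \<omega> * Y j \<omega>)\<bar> \<le> C" .
  qed
  \<comment> \<open>Near the diagonal only the crude bound C is available. The subtraction
    \<open>i - K\<close> is truncated at 0, which excludes no j from the band.\<close>
  have entry: "expectation (\<lambda>\<omega>. Y i \<omega> * Y j \<omega>) \<le> \<epsilon> + (if j \<in> {i - K..i + K} then C else 0)"
    if "1 \<le> i" "1 \<le> j" for i j
  proof (cases "j \<in> {i - K..i + K}")
    case True
    then show ?thesis using int(2)[OF that] \<epsilon> by auto
  next
    case False
    then consider "j = i + (j - i)" "K \<le> j - i" | "i = j + (i - j)" "K \<le> i - j" by fastforce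
    then have "\<bar>expectation (\<lambda>\<omega>. Y i \<omega> * Y j \<omega>)\<bar> \<le> \<epsilon>"
    proof cases
      case 1
      then show ?thesis using K[of i "j - i"] that by simp
    next
      case 2
      then show ?thesis using K[of j "i - j"] that by (simp add: mult.commute)
    qed
    with False show ?thesis by auto
  qed
  have moment: "expectation (\<lambda>\<omega>. (\<Sum>j=1..n. Y j \<omega>)\<^sup>2) \<le> (real n)\<^sup>2 * \<epsilon> + real n * (real (2 * K + 1) * C)"
    and moment_int: "integrable M (\<lambda>\<omega>. (\<Sum>j=1..n. Y j \<omega>)\<^sup>2)" for n
  proof -
    have eq: "(\<Sum>j=1..n. Y j \<omega>)\<^sup>2 = (\<Sum>i=1..n. \<Sum>j=1..n. Y i \<omega> * Y j \<omega>)" for \<omega>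
      by (simp add: power2_eq_square sum_product)
    show "integrable M (\<lambda>\<omega>. (\<Sum>j=1..n. Y j \<omega>)\<^sup>2)" unfolding eq
      by (intro Bochner_Integration.integrable_sum int) auto
    have "expectation (\<lambda>\<omega>. (\<Sum>j=1..n. Y j \<omega>)\<^sup>2) = (\<Sum>i=1..n. \<Sum>j=1..n. expectation (\<lambda>\<omega>. Y i \<omega> * Y j \<omega>))"
      unfolding eq using int(1) by (subst Bochner_Integration.integral_sum) (auto intro!: Bochner_Integration.integrable_sum)
    also have "\<dots> \<le> (\<Sum>i=1..n. \<Sum>j=1..n. \<epsilon> + (if j \<in> {i - K..i + K} then C else 0))"
      by (intro sum_mono entry) auto
    also have "\<dots> \<le> (\<Sum>i=1..n. real n * \<epsilon> + real (2 * K + 1) * C)"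
    proof (intro sum_mono)
      fix i
      have "(\<Sum>j=1..n. if j \<in> {i - K..i + K} then C else 0) = real (card ({1..n} \<inter> {i - K..i + K})) * C"
        by (simp only: sum.inter_restrict[OF finite_atLeastAtMost, symmetric] sum_constant)
      then have "(\<Sum>j=1..n. \<epsilon> + (if j \<in> {i - K..i + K} then C else 0)) =
          real n * \<epsilon> + real (card ({1..n} \<inter> {i - K..i + K})) * C"
        by (simp only: sum.distrib sum_constant) simp
      moreover have "card ({1..n} \<inter> {i - K..i + K}) \<le> 2 * K + 1"
        by (rule order_trans[OF card_mono[of "{i - K..i + K}"]]) auto
      ultimately show "(\<Sum>j=1..n. \<epsilon> + (if j \<in> {i - K..i + K} then C else 0)) \<le> real n * \<epsilon> + real (2 * K + 1) * C"
        using C0 by (simp add: mult_right_mono del: of_nat_add of_nat_mult)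
    qed
    also have "\<dots> = (real n)\<^sup>2 * \<epsilon> + real n * (real (2 * K + 1) * C)"
      by (simp add: algebra_simps power2_eq_square)
    finally show "expectation (\<lambda>\<omega>. (\<Sum>j=1..n. Y j \<omega>)\<^sup>2) \<le> (real n)\<^sup>2 * \<epsilon> + real n * (real (2 * K + 1) * C)" .
  qed
  let ?D = "real (2 * K + 1) * C"
  obtain n0 where n0: "?D / \<epsilon> \<le> real n0" using real_arch_simple by blast
  have "prob {\<omega>\<in>space M. \<eta> * real n \<le> \<bar>\<Sum>j=1..n. Y j \<omega>\<bar>} < e" if n: "max 1 n0 \<le> n" for n
  proof -
    have npos: "0 < real n" using n by simp
    have "?D / \<epsilon> \<le> real n" using n0 n by linarith
    then have D: "?D \<le> real n * \<epsilon>" using \<epsilon> by (simp add: field_simps)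
    have "prob {\<omega>\<in>space M. \<eta> * real n \<le> \<bar>\<Sum>j=1..n. Y j \<omega>\<bar>} \<le>
        prob {\<omega>\<in>space M. (\<eta> * real n)\<^sup>2 \<le> (\<Sum>j=1..n. Y j \<omega>)\<^sup>2}"
    proof (rule finite_measure_mono)
      show "{\<omega>\<in>space M. \<eta> * real n \<le> \<bar>\<Sum>j=1..n. Y j \<omega>\<bar>} \<subseteq> {\<omega>\<in>space M. (\<eta> * real n)\<^sup>2 \<le> (\<Sum>j=1..n. Y j \<omega>)\<^sup>2}"
        using \<open>0 < \<eta>\<close> npos by (auto simp: abs_le_square_iff[symmetric])
    qed measurable
    also have "\<dots> \<le> expectation (\<lambda>\<omega>. (\<Sum>j=1..n. Y j \<omega>)\<^sup>2) / (\<eta> * real n)\<^sup>2"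
      by (rule integral_Markov_inequality_measure[OF moment_int, of "{}"]) (use \<open>0 < \<eta>\<close> npos in auto)
    also have "\<dots> \<le> ((real n)\<^sup>2 * \<epsilon> + real n * (real n * \<epsilon>)) / (\<eta> * real n)\<^sup>2"
      using moment[of n] mult_left_mono[OF D, of "real n"] by (intro divide_right_mono) auto
    also have "\<dots> = e / 2"
      using npos \<open>0 < \<eta>\<close> by (simp add: \<epsilon>_def power2_eq_square field_simps)
    finally show ?thesis using \<open>0 < e\<close> by linarith
  qed
  then show "\<exists>no. \<forall>n\<ge>no. norm (prob {\<omega>\<in>space M. \<eta> * real n \<le> \<bar>\<Sum>j=1..n. Y j \<omega>\<bar>} - 0) < e"
    by (intro exI[of _ "max 1 n0"]) auto
qed

lemma sum_bool: "(\<Sum>b\<in>UNIV. g b) = g True + g False"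
  by (simp add: UNIV_bool add.commute)

lemma integral_double_sum:
  fixes f :: "'a \<Rightarrow> 'b \<Rightarrow> 'c \<Rightarrow> real"
  assumes "\<And>a b. integrable M (f a b)"
  shows "(\<integral>x. (\<Sum>a\<in>A. \<Sum>b\<in>B. f a b x) \<partial>M) = (\<Sum>a\<in>A. \<Sum>b\<in>B. \<integral>x. f a b x \<partial>M)"
  using assms by (simp add: Bochner_Integration.integral_sum)

section \<open>Binary words and conditionally independent flips\<close>

abbreviation words :: "nat \<Rightarrow> (nat \<Rightarrow> bool) set" where
  "words n \<equiv> {1..n} \<rightarrow>\<^sub>E UNIV"

lemma words_finite: "finite (words n)" by (intro finite_PiE) auto

lemma card_words: "card (words n) = 2 ^ n"
  by (simp add: card_PiE)

definition xor_word :: "nat \<Rightarrow> (nat \<Rightarrow> bool) \<Rightarrow> (nat \<Rightarrow> bool) \<Rightarrow> nat \<Rightarrow> bool" where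
  "xor_word n x y = (\<lambda>j\<in>{1..n}. x j \<noteq> y j)"

lemma xor_word_in_words: "xor_word n x y \<in> words n"
  by (auto simp: xor_word_def)

text \<open>XOR with a fixed word is its own inverse. For a fixed codeword, summing over noise words
  is therefore summing over received words.\<close>

lemma bij_betw_xor_word: "bij_betw (xor_word n x) (words n) (words n)"
proof (rule bij_betw_byWitness[where f'="xor_word n x"])
  show inv: "\<forall>a\<in>words n. xor_word n x (xor_word n x a) = a"
    by (auto simp: xor_word_def restrict_def fun_eq_iff PiE_def extensional_def)
  show "\<forall>a\<in>words n. xor_word n x (xor_word n x a) = a" by (rule inv)
qed (auto simp: xor_word_def)

lemma channel_output_eq_xor_word:
  assumes "\<forall>j\<in>{1..n}. N j \<omega> = b j"
  shows "channel_output N n x \<omega> = xor_word n x b"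
  using assms by (auto simp: channel_output_def xor_word_def)

text \<open>Given \<^term>\<open>F\<close>, the flip indicator \<^term>\<open>N j\<close> has the value \<^term>\<open>b\<close> with conditional probability
  \<^term>\<open>q j b\<close>, independently of the others.\<close>

locale additive_noise = prob_space M for M :: "'w measure" +
  fixes F :: "'w measure" and q :: "nat \<Rightarrow> bool \<Rightarrow> 'w \<Rightarrow> real" and N :: "nat \<Rightarrow> 'w \<Rightarrow> bool"
  assumes subalg: "subalgebra M F"
    and N_measurable: "\<And>j. 1 \<le> j \<Longrightarrow> N j \<in> M \<rightarrow>\<^sub>M count_space UNIV"
    and q_measurable_F: "\<And>j b. 1 \<le> j \<Longrightarrow> q j b \<in> borel_measurable F"
    and q_nonneg: "\<And>j b \<omega>. 0 \<le> q j b \<omega>"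
    and q_sum: "\<And>j \<omega>. q j True \<omega> + q j False \<omega> = 1"
    and q_cond: "\<And>J b A. finite J \<Longrightarrow> J \<subseteq> {1..} \<Longrightarrow> A \<in> sets F \<Longrightarrow>
      prob (A \<inter> {\<omega>\<in>space M. \<forall>j\<in>J. N j \<omega> = b j}) = (\<integral>\<omega>. indicator A \<omega> * (\<Prod>j\<in>J. q j (b j) \<omega>) \<partial>M)"
begin

lemma space_F: "space F = space M"
  using subalg by (simp add: subalgebra_def)

lemma sets_F: "A \<in> sets F \<Longrightarrow> A \<in> sets M"
  using subalg by (auto simp: subalgebra_def)

lemma measurable_F: "f \<in> F \<rightarrow>\<^sub>M L \<Longrightarrow> f \<in> M \<rightarrow>\<^sub>M L"
  using measurable_from_subalg[OF subalg] .

lemma q_measurable: "1 \<le> j \<Longrightarrow> q j b \<in> borel_measurable M"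
  by (intro measurable_F q_measurable_F)

lemma q_le_1: "q j b \<omega> \<le> 1"
  using q_sum[of j \<omega>] q_nonneg[of j True \<omega>] q_nonneg[of j False \<omega>] by (cases b) auto

lemma noise_event: "finite J \<Longrightarrow> J \<subseteq> {1..} \<Longrightarrow> {\<omega>\<in>space M. \<forall>j\<in>J. N j \<omega> = b j} \<in> sets M"
proof -
  assume J: "finite J" "J \<subseteq> {1..}"
  have "{\<omega>\<in>space M. N j \<omega> = b j} \<in> sets M" if "j \<in> J" for j
    using measurable_sets[OF N_measurable[of j], of "{b j}"] that J
    by (auto simp: vimage_def Int_def conj_commute)
  with J show ?thesis by (intro sets.sets_Collect_finite_All) auto
qed

lemma q_at_noise_measurable:
  assumes "1 \<le> j"
  shows "(\<lambda>\<omega>. q j (x \<noteq> N j \<omega>) \<omega>) \<in> borel_measurable M"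
proof -
  have "(\<lambda>\<omega>. if N j \<omega> then q j (\<not> x) \<omega> else q j x \<omega>) \<in> borel_measurable M"
    using N_measurable[OF assms] q_measurable[OF assms]
    by (intro measurable_If) (auto simp: pred_def)
  also have "(\<lambda>\<omega>. if N j \<omega> then q j (\<not> x) \<omega> else q j x \<omega>) = (\<lambda>\<omega>. q j (x \<noteq> N j \<omega>) \<omega>)"
    by (cases x) (auto simp: fun_eq_iff)
  finally show ?thesis .
qed

lemma prod_q_range: "0 \<le> (\<Prod>j\<in>J. q j (b j) \<omega>)" "(\<Prod>j\<in>J. q j (b j) \<omega>) \<le> 1"
  by (auto intro: prod_nonneg prod_le_1 simp: q_nonneg q_le_1)

lemma prod_q_measurable_F:
  assumes "J \<subseteq> {1..}"
  shows "(\<lambda>\<omega>. \<Prod>j\<in>J. q j (b j) \<omega>) \<in> borel_measurable F"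
  using assms by (intro borel_measurable_prod q_measurable_F) auto

text \<open>By \<open>q_cond\<close> the weights \<open>indicator E\<close> and the product of the
  \<open>q j (b j)\<close> define the same measure on \<open>F\<close>, hence the same integrals of
  \<open>F\<close>-measurable functions. Integrability is transferred as well because
  \<open>G\<close> will contain unbounded logarithms.\<close>

lemma conditional_integral:
  fixes b :: "nat \<Rightarrow> bool" and G :: "'w \<Rightarrow> real"
  assumes J: "finite J" "J \<subseteq> {1..}" and G: "G \<in> borel_measurable F"
  defines "E \<equiv> {\<omega>\<in>space M. \<forall>j\<in>J. N j \<omega> = b j}"
  shows "integrable M (\<lambda>\<omega>. indicator E \<omega> * G \<omega>) \<longleftrightarrow> integrable M (\<lambda>\<omega>. (\<Prod>j\<in>J. q j (b j) \<omega>) * G \<omega>)"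
    and "(\<integral>\<omega>. indicator E \<omega> * G \<omega> \<partial>M) = (\<integral>\<omega>. (\<Prod>j\<in>J. q j (b j) \<omega>) * G \<omega> \<partial>M)"
proof -
  let ?Q = "\<lambda>\<omega>. \<Prod>j\<in>J. q j (b j) \<omega>"
  have E[measurable]: "E \<in> sets M" unfolding E_def using J by (rule noise_event)
  have Q[measurable]: "?Q \<in> borel_measurable M" using prod_q_measurable_F[OF J(2)] by (rule measurable_F)
  have id[measurable]: "(\<lambda>\<omega>. \<omega>) \<in> M \<rightarrow>\<^sub>M F" using subalg by (auto simp: subalgebra_def measurable_def)
  have idE[measurable]: "(\<lambda>\<omega>. \<omega>) \<in> density M (\<lambda>\<omega>. ennreal (indicator E \<omega>)) \<rightarrow>\<^sub>M F" by simp
  have idQ[measurable]: "(\<lambda>\<omega>. \<omega>) \<in> density M (\<lambda>\<omega>. ennreal (?Q \<omega>)) \<rightarrow>\<^sub>M F" by simp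
  have eq: "distr (density M (\<lambda>\<omega>. ennreal (indicator E \<omega>))) F (\<lambda>\<omega>. \<omega>) =
      distr (density M (\<lambda>\<omega>. ennreal (?Q \<omega>))) F (\<lambda>\<omega>. \<omega>)"
  proof (rule measure_eqI)
    fix A assume "A \<in> sets (distr (density M (\<lambda>\<omega>. ennreal (indicator E \<omega>))) F (\<lambda>\<omega>. \<omega>))"
    then have A: "A \<in> sets F" by simp
    then have [measurable]: "A \<in> sets M" by (rule sets_F)
    have AM: "A \<subseteq> space M" using A sets.sets_into_space space_F by blast
    have "emeasure (distr (density M (\<lambda>\<omega>. ennreal (indicator E \<omega>))) F (\<lambda>\<omega>. \<omega>)) A = emeasure (density M (\<lambda>\<omega>. ennreal (indicator E \<omega>))) A"
      using A AM by (subst emeasure_distr) (auto simp: Int_absorb2)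
    also have "\<dots> = (\<integral>\<^sup>+\<omega>. ennreal (indicator E \<omega>) * indicator A \<omega> \<partial>M)"
      by (rule emeasure_density) auto
    also have "\<dots> = (\<integral>\<^sup>+\<omega>. indicator (A \<inter> E) \<omega> \<partial>M)"
      by (intro nn_integral_cong) (auto simp: indicator_def)
    also have "\<dots> = ennreal (prob (A \<inter> E))" by (simp add: emeasure_eq_measure)
    also have "prob (A \<inter> E) = (\<integral>\<omega>. indicator A \<omega> * ?Q \<omega> \<partial>M)"
      unfolding E_def by (rule q_cond[OF J A])
    also have "ennreal \<dots> = (\<integral>\<^sup>+\<omega>. ennreal (indicator A \<omega> * ?Q \<omega>) \<partial>M)"
      by (intro nn_integral_eq_integral[symmetric] integrable_const_bound[where B=1])
        (auto simp: prod_q_range indicator_def)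
    also have "\<dots> = (\<integral>\<^sup>+\<omega>. ennreal (?Q \<omega>) * indicator A \<omega> \<partial>M)"
      by (intro nn_integral_cong) (auto simp: indicator_def)
    also have "\<dots> = emeasure (density M (\<lambda>\<omega>. ennreal (?Q \<omega>))) A"
      by (rule emeasure_density[symmetric]) auto
    also have "\<dots> = emeasure (distr (density M (\<lambda>\<omega>. ennreal (?Q \<omega>))) F (\<lambda>\<omega>. \<omega>)) A"
      using A AM by (subst emeasure_distr) (auto simp: Int_absorb2)
    finally show "emeasure (distr (density M (\<lambda>\<omega>. ennreal (indicator E \<omega>))) F (\<lambda>\<omega>. \<omega>)) A =
      emeasure (distr (density M (\<lambda>\<omega>. ennreal (?Q \<omega>))) F (\<lambda>\<omega>. \<omega>)) A" .
  qed simp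
  have GM[measurable]: "G \<in> borel_measurable M" using G by (rule measurable_F)
  have "integrable M (\<lambda>\<omega>. indicator E \<omega> * G \<omega>) \<longleftrightarrow> integrable (distr (density M (\<lambda>\<omega>. ennreal (indicator E \<omega>))) F (\<lambda>\<omega>. \<omega>)) G"
    using G by (subst integrable_distr_eq) (auto simp: integrable_density)
  also have "\<dots> \<longleftrightarrow> integrable M (\<lambda>\<omega>. ?Q \<omega> * G \<omega>)"
    unfolding eq using G by (subst integrable_distr_eq) (auto simp: integrable_density prod_q_range)
  finally show "integrable M (\<lambda>\<omega>. indicator E \<omega> * G \<omega>) \<longleftrightarrow> integrable M (\<lambda>\<omega>. ?Q \<omega> * G \<omega>)" .
  have "(\<integral>\<omega>. indicator E \<omega> * G \<omega> \<partial>M) = integral\<^sup>L (distr (density M (\<lambda>\<omega>. ennreal (indicator E \<omega>))) F (\<lambda>\<omega>. \<omega>)) G"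
    using G by (subst integral_distr) (auto simp: integral_density)
  also have "\<dots> = (\<integral>\<omega>. ?Q \<omega> * G \<omega> \<partial>M)"
    unfolding eq using G by (subst integral_distr) (auto simp: integral_density prod_q_range)
  finally show "(\<integral>\<omega>. indicator E \<omega> * G \<omega> \<partial>M) = (\<integral>\<omega>. ?Q \<omega> * G \<omega> \<partial>M)" .
qed

text \<open>The information density of the flip that occurred. Its conditional mean given
  \<open>F\<close> is the binary entropy of the flip probability.\<close>

definition information :: "nat \<Rightarrow> 'w \<Rightarrow> real" where
  "information j \<omega> = - log 2 (q j (N j \<omega>) \<omega>)"

lemma information_measurable: "1 \<le> j \<Longrightarrow> information j \<in> borel_measurable M"
  unfolding information_def using q_at_noise_measurable[of j False] by simp

lemma log_q_measurable_F: "1 \<le> j \<Longrightarrow> (\<lambda>\<omega>. log 2 (q j b \<omega>)) \<in> borel_measurable F"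
  using q_measurable_F[of j b] by simp

lemma entropy_eq: "binary_entropy (q j True \<omega>) = (\<Sum>b\<in>UNIV. q j b \<omega> * (- log 2 (q j b \<omega>)))"
proof -
  have "q j False \<omega> = 1 - q j True \<omega>" using q_sum[of j \<omega>] by simp
  then show ?thesis by (simp add: UNIV_bool binary_entropy_def)
qed

text \<open>Splitting by the value b of the flip turns its indicator into the factor
  \<open>q j b\<close>, which tames the squared logarithm by \<open>mult_ln_square_le\<close>. With
  (x + y)^2 <= 2 x^2 + 2 y^2, each of the two values of b contributes at most 8 / (ln 2)^2 +
  2.\<close>

lemma centred_second_moment:
  assumes j: "1 \<le> j" and c: "c \<in> {0..1}"
  shows "integrable M (\<lambda>\<omega>. (information j \<omega> - c)\<^sup>2)"
    and "expectation (\<lambda>\<omega>. (information j \<omega> - c)\<^sup>2) \<le> 16 / (ln 2)\<^sup>2 + 4"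
proof -
  let ?E = "\<lambda>b. {\<omega>\<in>space M. \<forall>i\<in>{j}. N i \<omega> = b}"
  let ?G = "\<lambda>b \<omega>. (- log 2 (q j b \<omega>) - c)\<^sup>2"
  have G: "?G b \<in> borel_measurable F" for b
    using log_q_measurable_F[OF j, of b] by measurable
  have bound: "0 \<le> q j b \<omega> * ?G b \<omega> \<and> q j b \<omega> * ?G b \<omega> \<le> 8 / (ln 2)\<^sup>2 + 2" for b \<omega>
  proof -
    let ?q = "q j b \<omega>"
    have "?G b \<omega> \<le> 2 * (log 2 ?q)\<^sup>2 + 2 * c\<^sup>2"
      using sum_squares_ge_zero[of "log 2 ?q - c" 0] by (simp add: power2_eq_square algebra_simps)
    then have "?q * ?G b \<omega> \<le> ?q * (2 * (log 2 ?q)\<^sup>2 + 2 * c\<^sup>2)"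
      by (intro mult_left_mono q_nonneg)
    also have "\<dots> = 2 * (?q * (ln ?q)\<^sup>2 / (ln 2)\<^sup>2) + 2 * (?q * c\<^sup>2)"
      by (simp add: log_def power_divide algebra_simps)
    also have "\<dots> \<le> 2 * (4 / (ln 2)\<^sup>2) + 2 * (1 * 1)"
      by (intro add_mono mult_mono divide_right_mono mult_ln_square_le q_nonneg q_le_1)
        (use c in \<open>auto intro: power_le_one simp: q_nonneg\<close>)
    finally show ?thesis by (simp add: q_nonneg)
  qed
  have qm[measurable]: "q j b \<in> borel_measurable M" for b using j by (rule q_measurable)
  have [measurable]: "?G b \<in> borel_measurable M" for b using G by (rule measurable_F)
  have intQ: "integrable M (\<lambda>\<omega>. q j b \<omega> * ?G b \<omega>)" for b
    by (rule integrable_const_bound[where B="8 / (ln 2)\<^sup>2 + 2"]) (use bound in auto)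
  have intE: "integrable M (\<lambda>\<omega>. indicator (?E b) \<omega> * ?G b \<omega>)" for b
    using conditional_integral(1)[of "{j}" "?G b" "\<lambda>_. b"] j G intQ[of b] by simp
  have eq: "(information j \<omega> - c)\<^sup>2 = (\<Sum>b\<in>UNIV. indicator (?E b) \<omega> * ?G b \<omega>)" if "\<omega> \<in> space M" for \<omega>
    unfolding sum_bool using that by (cases "N j \<omega>") (auto simp: information_def)
  have "integrable M (\<lambda>\<omega>. \<Sum>b\<in>UNIV. indicator (?E b) \<omega> * ?G b \<omega>)"
    by (intro Bochner_Integration.integrable_sum intE)
  then show "integrable M (\<lambda>\<omega>. (information j \<omega> - c)\<^sup>2)"
    by (subst Bochner_Integration.integrable_cong[OF refl eq]) auto
  have "expectation (\<lambda>\<omega>. (information j \<omega> - c)\<^sup>2) = expectation (\<lambda>\<omega>. \<Sum>b\<in>UNIV. indicator (?E b) \<omega> * ?G b \<omega>)"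
    by (rule Bochner_Integration.integral_cong[OF refl eq])
  also have "\<dots> = (\<Sum>b\<in>UNIV. expectation (\<lambda>\<omega>. indicator (?E b) \<omega> * ?G b \<omega>))"
    by (intro Bochner_Integration.integral_sum intE)
  also have "\<dots> = (\<Sum>b\<in>UNIV. expectation (\<lambda>\<omega>. q j b \<omega> * ?G b \<omega>))"
  proof (rule sum.cong[OF refl])
    fix b
    show "expectation (\<lambda>\<omega>. indicator (?E b) \<omega> * ?G b \<omega>) = expectation (\<lambda>\<omega>. q j b \<omega> * ?G b \<omega>)"
      using conditional_integral(2)[of "{j}" "?G b" "\<lambda>_. b"] j G by simp
  qed
  also have "\<dots> \<le> (\<Sum>b\<in>(UNIV::bool set). 8 / (ln 2)\<^sup>2 + 2)"
    by (intro sum_mono integral_le_const intQ) (use bound in auto)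
  also have "\<dots> = 16 / (ln 2)\<^sup>2 + 4" by (simp add: UNIV_bool)
  finally show "expectation (\<lambda>\<omega>. (information j \<omega> - c)\<^sup>2) \<le> 16 / (ln 2)\<^sup>2 + 4" .
qed

text \<open>Given \<open>F\<close>, flips at distinct positions are independent, so the conditional
  mean of the product is the product of the conditional means, which are the entropies minus
  \<open>c\<close>. All dependence between the information densities thus comes from
  \<open>F\<close>.\<close>

lemma centred_product_moment:
  assumes ij: "1 \<le> i" "1 \<le> j" "i \<noteq> j"
  shows "expectation (\<lambda>\<omega>. (information i \<omega> - c) * (information j \<omega> - c)) =
    expectation (\<lambda>\<omega>. (binary_entropy (q i True \<omega>) - c) * (binary_entropy (q j True \<omega>) - c))"
proof -
  let ?b = "\<lambda>a b k. if k = i then a else b"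
  let ?E = "\<lambda>a b. {\<omega>\<in>space M. \<forall>k\<in>{i, j}. N k \<omega> = ?b a b k}"
  let ?l = "\<lambda>k a \<omega>. - log 2 (q k a \<omega>) - c"
  let ?G = "\<lambda>a b \<omega>. ?l i a \<omega> * ?l j b \<omega>"
  have G: "?G a b \<in> borel_measurable F" for a b
    using log_q_measurable_F[OF ij(1), of a] log_q_measurable_F[OF ij(2), of b] by measurable
  \<comment> \<open>The logarithm is unbounded, but weighted with its own probability it is bounded;
    this supplies the integrability of all four terms.\<close>
  have bound: "\<bar>q k a \<omega> * ?l k a \<omega>\<bar> \<le> 2 / ln 2 * 2 + \<bar>c\<bar>" for k a \<omega>
  proof -
    let ?q = "q k a \<omega>"
    have "(?q * ln ?q)\<^sup>2 = ?q * (?q * (ln ?q)\<^sup>2)" by (simp add: power2_eq_square)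
    also have "\<dots> \<le> 1 * 4"
      by (intro mult_mono mult_ln_square_le q_nonneg q_le_1) (auto simp: q_nonneg)
    finally have "\<bar>?q * ln ?q\<bar>\<^sup>2 \<le> 2\<^sup>2" by simp
    then have "\<bar>?q * ln ?q\<bar> \<le> 2" by (rule power2_le_imp_le) simp
    then have "\<bar>?q * ln ?q\<bar> / ln 2 \<le> 2 / ln 2" by (intro divide_right_mono) auto
    moreover have "\<bar>?q * ?l k a \<omega>\<bar> \<le> \<bar>?q * ln ?q\<bar> / ln 2 + \<bar>?q * c\<bar>"
    proof -
      have "?q * ?l k a \<omega> = - (?q * ln ?q / ln 2) - ?q * c" by (simp add: log_def algebra_simps)
      moreover have "\<bar>?q * ln ?q / ln 2\<bar> = \<bar>?q * ln ?q\<bar> / ln 2" by (simp add: abs_divide)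
      ultimately show ?thesis by linarith
    qed
    moreover have "\<bar>?q * c\<bar> \<le> 1 * \<bar>c\<bar>"
      unfolding abs_mult by (intro mult_right_mono) (auto simp: q_nonneg q_le_1)
    moreover have "0 \<le> 2 / ln (2::real)" by simp
    ultimately show ?thesis by linarith
  qed
  have [measurable]: "q i a \<in> borel_measurable M" "q j a \<in> borel_measurable M" for a
    using ij by (auto intro: q_measurable)
  have intQ: "integrable M (\<lambda>\<omega>. (q i a \<omega> * ?l i a \<omega>) * (q j b \<omega> * ?l j b \<omega>))" for a b
  proof (rule integrable_const_bound)
    show "AE \<omega> in M. norm ((q i a \<omega> * ?l i a \<omega>) * (q j b \<omega> * ?l j b \<omega>)) \<le> (2 / ln 2 * 2 + \<bar>c\<bar>) * (2 / ln 2 * 2 + \<bar>c\<bar>)"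
      unfolding real_norm_def abs_mult[of "q i a _ * _"]
      by (intro AE_I2 mult_mono bound) auto
  qed measurable
  have prod_eq: "(\<Prod>k\<in>{i, j}. q k (?b a b k) \<omega>) * ?G a b \<omega> = (q i a \<omega> * ?l i a \<omega>) * (q j b \<omega> * ?l j b \<omega>)" for a b \<omega>
    using ij by (simp add: mult_ac)
  have J: "finite {i, j}" "{i, j} \<subseteq> {1..}" using ij by auto
  have intE: "integrable M (\<lambda>\<omega>. indicator (?E a b) \<omega> * ?G a b \<omega>)" for a b
    using conditional_integral(1)[OF J G, of "?b a b" a b] intQ[of a b] unfolding prod_eq by simp
  have eq: "(information i \<omega> - c) * (information j \<omega> - c) = (\<Sum>a\<in>UNIV. \<Sum>b\<in>UNIV. indicator (?E a b) \<omega> * ?G a b \<omega>)" if "\<omega> \<in> space M" for \<omega>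
    unfolding sum_bool using that ij by (cases "N i \<omega>"; cases "N j \<omega>") (simp_all add: information_def indicator_def)
  have "expectation (\<lambda>\<omega>. (information i \<omega> - c) * (information j \<omega> - c)) =
     expectation (\<lambda>\<omega>. \<Sum>a\<in>UNIV. \<Sum>b\<in>UNIV. indicator (?E a b) \<omega> * ?G a b \<omega>)"
    by (rule Bochner_Integration.integral_cong[OF refl eq])
  also have "\<dots> = (\<Sum>a\<in>UNIV. \<Sum>b\<in>UNIV. expectation (\<lambda>\<omega>. indicator (?E a b) \<omega> * ?G a b \<omega>))"
    by (rule integral_double_sum) (rule intE)
  also have "\<dots> = (\<Sum>a\<in>UNIV. \<Sum>b\<in>UNIV. expectation (\<lambda>\<omega>. (q i a \<omega> * ?l i a \<omega>) * (q j b \<omega> * ?l j b \<omega>)))"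
    by (intro sum.cong refl) (simp only: conditional_integral(2)[OF J G] prod_eq)
  also have "\<dots> = expectation (\<lambda>\<omega>. \<Sum>a\<in>UNIV. \<Sum>b\<in>UNIV. (q i a \<omega> * ?l i a \<omega>) * (q j b \<omega> * ?l j b \<omega>))"
    by (rule integral_double_sum[symmetric]) (rule intQ)
  also have "\<dots> = expectation (\<lambda>\<omega>. (binary_entropy (q i True \<omega>) - c) * (binary_entropy (q j True \<omega>) - c))"
  proof (rule Bochner_Integration.integral_cong[OF refl])
    fix \<omega>
    have "(\<Sum>a\<in>UNIV. q k a \<omega> * ?l k a \<omega>) = binary_entropy (q k True \<omega>) - c" for k
    proof -
      have "(\<Sum>a\<in>UNIV. q k a \<omega> * ?l k a \<omega>) = binary_entropy (q k True \<omega>) - (q k True \<omega> + q k False \<omega>) * c"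
        by (simp add: entropy_eq UNIV_bool algebra_simps)
      then show ?thesis by (simp add: q_sum)
    qed
    then show "(\<Sum>a\<in>UNIV. \<Sum>b\<in>UNIV. (q i a \<omega> * ?l i a \<omega>) * (q j b \<omega> * ?l j b \<omega>)) =
        (binary_entropy (q i True \<omega>) - c) * (binary_entropy (q j True \<omega>) - c)"
      by (simp only: sum_product[symmetric])
  qed
  finally show ?thesis .
qed

text \<open>The conditional probability, given \<open>F\<close>, of the noise word that actually
  occurred.\<close>

definition likelihood :: "nat \<Rightarrow> 'w \<Rightarrow> real" where
  "likelihood n \<omega> = (\<Prod>j\<in>{1..n}. q j (N j \<omega>) \<omega>)"

lemma likelihood_measurable: "likelihood n \<in> borel_measurable M"
  unfolding likelihood_def using q_at_noise_measurable[of _ False] by (intro borel_measurable_prod) auto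

text \<open>The exception is where the realised flip had conditional probability 0: there the
  likelihood is 0, while \<open>log 2 0 = 0\<close> gives that factor the value 1. This event is
  null by \<open>q_cond\<close> for the \<open>F\<close>-set on which \<open>q j b\<close>
  vanishes.\<close>

lemma likelihood_eq_information:
  "AE \<omega> in M. likelihood n \<omega> = 2 powr (- (\<Sum>j=1..n. information j \<omega>))"
proof -
  have pos: "AE \<omega> in M. 0 < q j (N j \<omega>) \<omega>" if j: "1 \<le> j" for j
  proof -
    have z: "prob ({\<omega>\<in>space M. q j b \<omega> = 0} \<inter> {\<omega>\<in>space M. \<forall>i\<in>{j}. N i \<omega> = b}) = 0" for b
    proof -
      have "{\<omega>\<in>space F. q j b \<omega> = 0} \<in> sets F" using q_measurable_F[OF j, of b] by measurable
      then have "prob ({\<omega>\<in>space M. q j b \<omega> = 0} \<inter> {\<omega>\<in>space M. \<forall>i\<in>{j}. N i \<omega> = b})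
        = (\<integral>\<omega>. indicator {\<omega>\<in>space M. q j b \<omega> = 0} \<omega> * (\<Prod>i\<in>{j}. q i b \<omega>) \<partial>M)"
        using j by (intro q_cond) (auto simp: space_F)
      also have "\<dots> = (\<integral>\<omega>. 0 \<partial>M)" by (intro Bochner_Integration.integral_cong) (auto simp: indicator_def)
      finally show ?thesis by simp
    qed
    have "AE \<omega> in M. \<omega> \<notin> {\<omega>\<in>space M. q j b \<omega> = 0} \<inter> {\<omega>\<in>space M. \<forall>i\<in>{j}. N i \<omega> = b}" for b
    proof (rule AE_not_in, rule null_setsI)
      show "emeasure M ({\<omega>\<in>space M. q j b \<omega> = 0} \<inter> {\<omega>\<in>space M. \<forall>i\<in>{j}. N i \<omega> = b}) = 0"
        by (simp only: emeasure_eq_measure z) simp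
      have [measurable]: "q j b \<in> borel_measurable M" using j by (rule q_measurable)
      show "{\<omega>\<in>space M. q j b \<omega> = 0} \<inter> {\<omega>\<in>space M. \<forall>i\<in>{j}. N i \<omega> = b} \<in> sets M"
        using noise_event[of "{j}" "\<lambda>_. b"] j by (intro sets.Int) auto
    qed
    from this[of True] this[of False] AE_space show ?thesis
    proof eventually_elim
      case (elim \<omega>)
      then show ?case using q_nonneg[of j "N j \<omega>" \<omega>] by (cases "N j \<omega>") auto
    qed
  qed
  then have "AE \<omega> in M. \<forall>j\<in>{1..n}. 0 < q j (N j \<omega>) \<omega>" by (intro AE_finite_allI) auto
  then show ?thesis
  proof eventually_elim
    case (elim \<omega>)
    have "2 powr (- (\<Sum>j=1..n. information j \<omega>)) = (\<Prod>j=1..n. 2 powr (log 2 (q j (N j \<omega>) \<omega>)))"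
      by (simp add: information_def sum_negf powr_sum)
    also have "\<dots> = likelihood n \<omega>"
      unfolding likelihood_def using elim by (intro prod.cong) auto
    finally show ?case by simp
  qed
qed

text \<open>Minus the logarithm of the likelihood is a sum of information densities. Their second
  moments are uniformly bounded and their mixed moments about \<open>c\<close> are those of the
  entropies, so \<open>second_moment_weak_law\<close> applies; \<open>c\<close> acts as the entropy
  per symbol.\<close>

lemma equipartition:
  assumes c: "c \<in> {0..1}" and "0 < \<eta>"
    and decor: "\<And>\<epsilon>. 0 < \<epsilon> \<Longrightarrow> \<exists>K. \<forall>i\<ge>1. \<forall>k\<ge>K. \<bar>expectation (\<lambda>\<omega>.
      (binary_entropy (q i True \<omega>) - c) * (binary_entropy (q (i + k) True \<omega>) - c))\<bar> \<le> \<epsilon>"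
  shows "(\<lambda>n. prob {\<omega>\<in>space M. likelihood n \<omega> < 2 powr (- (real n * (c + \<eta>)))}) \<longlonglongrightarrow> 0"
    and "(\<lambda>n. prob {\<omega>\<in>space M. 2 powr (- (real n * (c - \<eta>))) < likelihood n \<omega>}) \<longlonglongrightarrow> 0"
proof -
  have dev: "(\<lambda>n. prob {\<omega>\<in>space M. \<eta> * real n \<le> \<bar>\<Sum>j=1..n. information j \<omega> - c\<bar>}) \<longlonglongrightarrow> 0"
  proof (rule second_moment_weak_law[where C="16 / (ln 2)\<^sup>2 + 4", OF _ _ _ _ \<open>0 < \<eta>\<close>])
    fix \<epsilon> :: real assume "0 < \<epsilon>"
    then obtain K where K: "\<And>i k. 1 \<le> i \<Longrightarrow> K \<le> k \<Longrightarrow> \<bar>expectation (\<lambda>\<omega>.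
      (binary_entropy (q i True \<omega>) - c) * (binary_entropy (q (i + k) True \<omega>) - c))\<bar> \<le> \<epsilon>"
      using decor by blast
    show "\<exists>K. \<forall>i\<ge>1. \<forall>k\<ge>K. \<bar>expectation (\<lambda>\<omega>. (information i \<omega> - c) * (information (i + k) \<omega> - c))\<bar> \<le> \<epsilon>"
    \<comment> \<open>A lag of at least 1 keeps i and i + k distinct, as
      \<open>centred_product_moment\<close> requires.\<close>
    proof (intro exI[of _ "max 1 K"] allI impI)
      fix i k :: nat assume "1 \<le> i" "max 1 K \<le> k"
      then show "\<bar>expectation (\<lambda>\<omega>. (information i \<omega> - c) * (information (i + k) \<omega> - c))\<bar> \<le> \<epsilon>"
        by (subst centred_product_moment) (auto intro: K)
    qed
  qed (use centred_second_moment[OF _ c] information_measurable in auto)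
  have L[measurable]: "likelihood n \<in> borel_measurable M" for n by (rule likelihood_measurable)
  have [measurable]: "(\<lambda>\<omega>. \<Sum>j=1..n. information j \<omega> - c) \<in> borel_measurable M" for n
    by (intro borel_measurable_sum borel_measurable_diff information_measurable) auto
  have ae: "AE \<omega> in M. likelihood n \<omega> = 2 powr (- (\<Sum>j=1..n. information j \<omega> - c) - real n * c)" for n
    using likelihood_eq_information[of n] by eventually_elim (simp add: sum_subtractf)
  have le: "prob {\<omega>\<in>space M. likelihood n \<omega> < 2 powr (- (real n * (c + \<eta>)))}
      \<le> prob {\<omega>\<in>space M. \<eta> * real n \<le> \<bar>\<Sum>j=1..n. information j \<omega> - c\<bar>}"
    "prob {\<omega>\<in>space M. 2 powr (- (real n * (c - \<eta>))) < likelihood n \<omega>}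
      \<le> prob {\<omega>\<in>space M. \<eta> * real n \<le> \<bar>\<Sum>j=1..n. information j \<omega> - c\<bar>}" for n
  proof -
    show "prob {\<omega>\<in>space M. likelihood n \<omega> < 2 powr (- (real n * (c + \<eta>)))}
      \<le> prob {\<omega>\<in>space M. \<eta> * real n \<le> \<bar>\<Sum>j=1..n. information j \<omega> - c\<bar>}"
    proof (rule finite_measure_mono_AE)
      show "AE \<omega> in M. \<omega> \<in> {\<omega>\<in>space M. likelihood n \<omega> < 2 powr (- (real n * (c + \<eta>)))} \<longrightarrow>
         \<omega> \<in> {\<omega>\<in>space M. \<eta> * real n \<le> \<bar>\<Sum>j=1..n. information j \<omega> - c\<bar>}"
        using ae[of n] by eventually_elim (auto simp: algebra_simps)
    qed measurable
    show "prob {\<omega>\<in>space M. 2 powr (- (real n * (c - \<eta>))) < likelihood n \<omega>}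
      \<le> prob {\<omega>\<in>space M. \<eta> * real n \<le> \<bar>\<Sum>j=1..n. information j \<omega> - c\<bar>}"
    proof (rule finite_measure_mono_AE)
      show "AE \<omega> in M. \<omega> \<in> {\<omega>\<in>space M. 2 powr (- (real n * (c - \<eta>))) < likelihood n \<omega>} \<longrightarrow>
         \<omega> \<in> {\<omega>\<in>space M. \<eta> * real n \<le> \<bar>\<Sum>j=1..n. information j \<omega> - c\<bar>}"
        using ae[of n] by eventually_elim (auto simp: algebra_simps)
    qed measurable
  qed
  show "(\<lambda>n. prob {\<omega>\<in>space M. likelihood n \<omega> < 2 powr (- (real n * (c + \<eta>)))}) \<longlonglongrightarrow> 0"
    by (rule tendsto_sandwich[OF _ _ tendsto_const dev]) (use le in auto)
  show "(\<lambda>n. prob {\<omega>\<in>space M. 2 powr (- (real n * (c - \<eta>))) < likelihood n \<omega>}) \<longlonglongrightarrow> 0"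
    by (rule tendsto_sandwich[OF _ _ tendsto_const dev]) (use le in auto)
qed

end

section \<open>Coding\<close>

text \<open>The error event is the disjoint union of one rectangle per message, and each message has
  weight 1 / |Msgs|.\<close>

lemma (in prob_space) error_probability_eq_average:
  assumes Msgs: "finite Msgs" "Msgs \<noteq> {}"
    and meas: "\<And>m. m \<in> Msgs \<Longrightarrow> {\<omega>\<in>space M. g (obs n (f m) \<omega>) \<noteq> m} \<in> sets M"
  shows "error_probability M obs n Msgs f g =
    (\<Sum>m\<in>Msgs. prob {\<omega>\<in>space M. g (obs n (f m) \<omega>) \<noteq> m}) / real (card Msgs)"
proof -
  interpret U: prob_space "uniform_count_measure Msgs"
    using Msgs by (rule prob_space_uniform_count_measure)
  interpret P: pair_prob_space "uniform_count_measure Msgs" M ..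
  let ?E = "\<lambda>m. {m} \<times> {\<omega>\<in>space M. g (obs n (f m) \<omega>) \<noteq> m}"
  have E: "?E m \<in> sets (uniform_count_measure Msgs \<Otimes>\<^sub>M M)" if "m \<in> Msgs" for m
    using that meas by (intro pair_measureI) (auto simp: sets_uniform_count_measure)
  have "error_probability M obs n Msgs f g = measure (uniform_count_measure Msgs \<Otimes>\<^sub>M M) (\<Union>m\<in>Msgs. ?E m)"
    unfolding error_probability_def
    by (intro arg_cong[where f="measure (uniform_count_measure Msgs \<Otimes>\<^sub>M M)"])
      (auto simp: space_pair_measure space_uniform_count_measure)
  also have "\<dots> = (\<Sum>m\<in>Msgs. measure (uniform_count_measure Msgs \<Otimes>\<^sub>M M) (?E m))"
    using Msgs E by (intro P.P.finite_measure_finite_Union) (auto simp: disjoint_family_on_def)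
  also have "\<dots> = (\<Sum>m\<in>Msgs. prob {\<omega>\<in>space M. g (obs n (f m) \<omega>) \<noteq> m} / real (card Msgs))"
  proof (rule sum.cong[OF refl])
    fix m assume m: "m \<in> Msgs"
    have "emeasure (uniform_count_measure Msgs \<Otimes>\<^sub>M M) (?E m) =
        emeasure (uniform_count_measure Msgs) {m} * emeasure M {\<omega>\<in>space M. g (obs n (f m) \<omega>) \<noteq> m}"
      using m meas by (intro emeasure_pair_measure_Times) (auto simp: sets_uniform_count_measure)
    then show "measure (uniform_count_measure Msgs \<Otimes>\<^sub>M M) (?E m) = prob {\<omega>\<in>space M. g (obs n (f m) \<omega>) \<noteq> m} / real (card Msgs)"
      using m Msgs by (simp add: measure_def enn2real_mult emeasure_uniform_count_measure)
  qed
  also have "\<dots> = (\<Sum>m\<in>Msgs. prob {\<omega>\<in>space M. g (obs n (f m) \<omega>) \<noteq> m}) / real (card Msgs)"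
    by (rule sum_divide_distrib[symmetric])
  finally show ?thesis .
qed

lemma powr_neg_tendsto_0:
  assumes "0 < (\<eta>::real)"
  shows "(\<lambda>n. 2 powr (- (real n * \<eta>))) \<longlonglongrightarrow> 0"
proof -
  have "2 powr - \<eta> < 2 powr (0::real)" using assms by (intro powr_less_mono) auto
  then have "(\<lambda>n. (2 powr - \<eta>) ^ n) \<longlonglongrightarrow> 0" by (intro LIMSEQ_realpow_zero) auto
  moreover have "(2 powr - \<eta>) ^ n = 2 powr (- (real n * \<eta>))" for n
    by (simp add: powr_power mult.commute)
  ultimately show ?thesis by simp
qed

context additive_noise
begin

lemma channel_output_measurable:
  "channel_output N n x \<in> M \<rightarrow>\<^sub>M count_space (words n)"
proof -
  have vimage: "channel_output N n x -` {y} \<inter> space M \<in> sets M" if "y \<in> words n" for y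
  proof -
    have "channel_output N n x \<omega> = y \<longleftrightarrow> (\<forall>j\<in>{1..n}. N j \<omega> = (x j \<noteq> y j))" for \<omega>
    proof -
      have "channel_output N n x \<omega> \<in> words n"
        unfolding channel_output_def by (rule restrict_PiE_iff[THEN iffD2]) simp
      then have "channel_output N n x \<omega> = y \<longleftrightarrow> (\<forall>j\<in>{1..n}. channel_output N n x \<omega> j = y j)"
        using PiE_ext[OF _ that] by blast
      also have "\<dots> \<longleftrightarrow> (\<forall>j\<in>{1..n}. N j \<omega> = (x j \<noteq> y j))"
      proof (rule ball_cong[OF refl])
        fix j assume "j \<in> {1..n}"
        then have "channel_output N n x \<omega> j = (x j \<noteq> N j \<omega>)" by (simp only: channel_output_def restrict_apply') 
        then show "(channel_output N n x \<omega> j = y j) = (N j \<omega> = (x j \<noteq> y j))" by blast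
      qed
      finally show ?thesis .
    qed
    then have "channel_output N n x -` {y} \<inter> space M = {\<omega>\<in>space M. \<forall>j\<in>{1..n}. N j \<omega> = (x j \<noteq> y j)}"
      by (intro set_eqI) (simp only: vimage_eq Int_iff singleton_iff mem_Collect_eq conj_commute)
    also have "\<dots> \<in> sets M" by (rule noise_event) auto
    finally show ?thesis .
  qed
  have "channel_output N n x \<in> space M \<rightarrow> words n"
    unfolding channel_output_def by (intro funcsetI restrict_PiE_iff[THEN iffD2]) simp
  with vimage show ?thesis
    by (intro measurable_count_space_eq2[OF words_finite, THEN iffD2] conjI ballI)
qed

text \<open>\<open>Out y\<close> is the entire observation when the output word is \<open>y\<close>:
  the word alone, or the word with the times. Randomness outside \<open>F\<close> reaches the
  receiver only through the finitely many output words.\<close>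

lemma observation_measurable:
  assumes "\<And>y. y \<in> words n \<Longrightarrow> Out y \<in> F \<rightarrow>\<^sub>M K"
  shows "(\<lambda>\<omega>. Out (channel_output N n x \<omega>) \<omega>) \<in> M \<rightarrow>\<^sub>M K"
proof (rule measurable_compose_countable'[OF _ channel_output_measurable])
  show "Out y \<in> M \<rightarrow>\<^sub>M K" if "y \<in> words n" for y
    using assms[OF that] by (rule measurable_F)
  show "countable (words n)" by (intro countable_finite words_finite)
qed

text \<open>For a fixed noise word b, the event that the decoder finds m from the output
  \<open>f m\<close> XOR b lies in \<open>F\<close>. On the part where b has conditional probability
  at most t, its joint probability with N = b is an integral of that conditional probability, hence
  at most t times the probability of the event. As b varies, the outputs run through all words, and
  for each output the events of different messages are disjoint: at most t per word.\<close>

lemma one_shot_converse: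
  assumes Msgs: "finite Msgs" and f: "f \<in> Msgs \<rightarrow> words n"
    and Out: "\<And>y. y \<in> words n \<Longrightarrow> Out y \<in> F \<rightarrow>\<^sub>M K"
    and g: "g \<in> K \<rightarrow>\<^sub>M count_space Msgs" and "0 \<le> t"
  shows "(\<Sum>m\<in>Msgs. prob {\<omega>\<in>space M. g (Out (channel_output N n (f m) \<omega>) \<omega>) = m})
    \<le> real (card Msgs) * prob {\<omega>\<in>space M. t < likelihood n \<omega>} + t * 2 ^ n"
proof -
  have [measurable]: "likelihood n \<in> borel_measurable M" by (rule likelihood_measurable)
  let ?P = "\<lambda>y m. prob {\<omega>\<in>space M. g (Out y \<omega>) = m}"
  have dec: "{\<omega>\<in>space M. g (Out y \<omega>) = m} \<in> sets F" if "y \<in> words n" "m \<in> Msgs" for y m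
  proof -
    have "(\<lambda>\<omega>. g (Out y \<omega>)) \<in> F \<rightarrow>\<^sub>M count_space Msgs"
      using Out[OF that(1)] g by (rule measurable_compose)
    from measurable_sets[OF this, of "{m}"] that(2) show ?thesis
      by (simp add: vimage_def Int_def conj_commute space_F)
  qed
  have each: "prob {\<omega>\<in>space M. g (Out (channel_output N n (f m) \<omega>) \<omega>) = m}
      \<le> prob {\<omega>\<in>space M. t < likelihood n \<omega>} + t * (\<Sum>y\<in>words n. ?P y m)" if m: "m \<in> Msgs" for m
  proof -
    let ?Q = "\<lambda>b \<omega>. \<Prod>j\<in>{1..n}. q j (b j) \<omega>"
    let ?D = "\<lambda>b. {\<omega>\<in>space M. g (Out (xor_word n (f m) b) \<omega>) = m}"
    let ?A = "\<lambda>b. ?D b \<inter> {\<omega>\<in>space M. ?Q b \<omega> \<le> t}"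
    let ?E = "\<lambda>b. {\<omega>\<in>space M. \<forall>j\<in>{1..n}. N j \<omega> = b j}"
    have D: "?D b \<in> sets F" for b using m by (intro dec xor_word_in_words)
    have Q: "?Q b \<in> borel_measurable F" for b by (rule prod_q_measurable_F) auto
    have A: "?A b \<in> sets F" for b
    proof -
      have "{\<omega>\<in>space F. ?Q b \<omega> \<le> t} \<in> sets F" using Q[of b] by measurable
      then show ?thesis using D[of b] by (auto simp: space_F)
    qed
    have AE: "?A b \<inter> ?E b \<in> sets M" for b
      by (rule sets.Int[OF sets_F[OF A] noise_event]) auto
    have U: "(\<Union>b\<in>words n. ?A b \<inter> ?E b) \<in> sets M"
      by (rule sets.finite_UN[OF words_finite AE])
    have L: "{\<omega>\<in>space M. t < likelihood n \<omega>} \<in> sets M" by measurable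
    \<comment> \<open>The first set collects the outcomes whose noise word is too likely to be
      controlled; the other successes are sorted by their noise word b.\<close>
    have "{\<omega>\<in>space M. g (Out (channel_output N n (f m) \<omega>) \<omega>) = m} \<subseteq>
        {\<omega>\<in>space M. t < likelihood n \<omega>} \<union> (\<Union>b\<in>words n. ?A b \<inter> ?E b)"
    proof (intro subsetI, clarify)
      fix \<omega> assume *: "\<omega> \<in> space M" "g (Out (channel_output N n (f m) \<omega>) \<omega>) = m"
        "\<omega> \<notin> (\<Union>b\<in>words n. ?A b \<inter> ?E b)"
      let ?b = "\<lambda>j\<in>{1..n}. N j \<omega>"
      have b: "?b \<in> words n" "\<omega> \<in> ?E ?b" using *(1) by auto
      have ceq: "channel_output N n (f m) \<omega> = xor_word n (f m) ?b"
        by (rule channel_output_eq_xor_word) auto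
      have D: "\<omega> \<in> ?D ?b" using *(1,2) unfolding ceq by (intro CollectI conjI)
      show "t < likelihood n \<omega>"
      proof (rule ccontr)
        assume "\<not> t < likelihood n \<omega>"
        then have "?Q ?b \<omega> \<le> t" by (simp add: likelihood_def)
        with *(1) have "\<omega> \<in> {\<omega>\<in>space M. ?Q ?b \<omega> \<le> t}" by (intro CollectI conjI)
        with D b(2) have "\<omega> \<in> ?A ?b \<inter> ?E ?b" by (intro IntI)
        then have "\<omega> \<in> (\<Union>b\<in>words n. ?A b \<inter> ?E b)" by (rule UN_I[OF b(1)])
        with *(3) show False by contradiction
      qed
    qed
    then have "prob {\<omega>\<in>space M. g (Out (channel_output N n (f m) \<omega>) \<omega>) = m}
        \<le> prob ({\<omega>\<in>space M. t < likelihood n \<omega>} \<union> (\<Union>b\<in>words n. ?A b \<inter> ?E b))"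
      by (rule finite_measure_mono[OF _ sets.Un[OF L U]])
    also have "\<dots> \<le> prob {\<omega>\<in>space M. t < likelihood n \<omega>} + prob (\<Union>b\<in>words n. ?A b \<inter> ?E b)"
      by (rule measure_Un_le[OF L U])
    also have "prob (\<Union>b\<in>words n. ?A b \<inter> ?E b) \<le> (\<Sum>b\<in>words n. prob (?A b \<inter> ?E b))"
      by (rule finite_measure_subadditive_finite[OF words_finite]) (use AE in blast)
    also have "\<dots> \<le> (\<Sum>b\<in>words n. t * prob (?D b))"
    proof (rule sum_mono)
      fix b
      have "prob (?A b \<inter> ?E b) = (\<integral>\<omega>. indicator (?A b) \<omega> * ?Q b \<omega> \<partial>M)"
        by (rule q_cond[OF _ _ A]) auto
      also have "\<dots> \<le> (\<integral>\<omega>. t * indicator (?D b) \<omega> \<partial>M)"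
      proof (rule integral_mono)
        show "integrable M (\<lambda>\<omega>. indicator (?A b) \<omega> * ?Q b \<omega>)"
        proof (rule integrable_const_bound[where B=1])
          show "(\<lambda>\<omega>. indicator (?A b) \<omega> * ?Q b \<omega>) \<in> borel_measurable M"
            by (intro borel_measurable_times borel_measurable_indicator sets_F[OF A] measurable_F[OF Q])
          have "norm (indicator X \<omega> * ?Q b \<omega>) \<le> 1" for X \<omega>
            using prod_q_range[where J="{1..n}" and b=b and \<omega>=\<omega>] by (cases "\<omega> \<in> X") simp_all
          then show "AE \<omega> in M. norm (indicator (?A b) \<omega> * ?Q b \<omega>) \<le> 1" by (intro AE_I2)
        qed
        show "integrable M (\<lambda>\<omega>. t * indicator (?D b) \<omega>)"
          using sets_F[OF D[of b]]
          by (intro integrable_mult_right integrable_real_indicator) (simp_all add: less_top[symmetric])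
        fix \<omega>
        show "indicator (?A b) \<omega> * ?Q b \<omega> \<le> t * indicator (?D b) \<omega>"
        proof (cases "\<omega> \<in> ?A b")
          case True
          then have "\<omega> \<in> ?D b" "?Q b \<omega> \<le> t" by blast+
          with True show ?thesis by (simp only: indicator_simps mult_1 mult_1_right)
        next
          case False
          then have "indicator (?A b) \<omega> = (0::real)" by (rule indicator_simps(2))
          moreover have "0 \<le> t * indicator (?D b) \<omega>"
            using \<open>0 \<le> t\<close> by (intro mult_nonneg_nonneg indicator_pos_le)
          ultimately show ?thesis by (simp only: mult_zero_left)
        qed
      qed
      also have "\<dots> = t * prob (?D b)"
        by (subst Bochner_Integration.integral_mult_right_zero, subst Bochner_Integration.integral_indicator)
          (simp add: Int_absorb2 subset_eq)
      finally show "prob (?A b \<inter> ?E b) \<le> t * prob (?D b)" .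
    qed
    also have "\<dots> = t * (\<Sum>y\<in>words n. ?P y m)"
      unfolding sum_distrib_left[symmetric]
      by (rule arg_cong[OF sum.reindex_bij_betw[OF bij_betw_xor_word, of "\<lambda>y. ?P y m" n "f m"]])
    finally show ?thesis by simp
  qed
  have "(\<Sum>m\<in>Msgs. prob {\<omega>\<in>space M. g (Out (channel_output N n (f m) \<omega>) \<omega>) = m})
    \<le> (\<Sum>m\<in>Msgs. prob {\<omega>\<in>space M. t < likelihood n \<omega>} + t * (\<Sum>y\<in>words n. ?P y m))"
    by (rule sum_mono) (rule each)
  also have "\<dots> = real (card Msgs) * prob {\<omega>\<in>space M. t < likelihood n \<omega>} + t * (\<Sum>y\<in>words n. \<Sum>m\<in>Msgs. ?P y m)"
    by (subst sum.swap) (simp only: sum.distrib sum_constant sum_distrib_left)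
  also have "\<dots> \<le> real (card Msgs) * prob {\<omega>\<in>space M. t < likelihood n \<omega>} + t * (\<Sum>y\<in>words n. 1)"
  proof (intro add_mono order_refl mult_left_mono sum_mono)
    fix y assume y: "y \<in> words n"
    have "(\<Sum>m\<in>Msgs. ?P y m) = prob (\<Union>m\<in>Msgs. {\<omega>\<in>space M. g (Out y \<omega>) = m})"
    proof (rule finite_measure_finite_Union[symmetric, OF Msgs])
      show "(\<lambda>m. {\<omega>\<in>space M. g (Out y \<omega>) = m}) ` Msgs \<subseteq> sets M"
        using sets_F[OF dec[OF y]] by blast
    qed (auto simp: disjoint_family_on_def)
    then show "(\<Sum>m\<in>Msgs. ?P y m) \<le> 1" by simp
  qed fact
  finally show ?thesis by (simp add: card_words[unfolded One_nat_def])
qed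

text \<open>The decoder returns the smallest message whose codeword has likelihood at least
  \<open>t\<close>. It fails only if the true codeword stays below \<open>t\<close> or another one
  reaches it; the probabilities of the latter, summed over ordered pairs of messages, are what
  \<open>greedy_codewords\<close> controls. \<open>lik\<close> is the likelihood as a function of
  the observation, which the decoder can evaluate.\<close>

lemma one_shot_achievability:
  fixes lik :: "(nat \<Rightarrow> bool) \<Rightarrow> 'o \<Rightarrow> real"
  assumes Out: "\<And>y. y \<in> words n \<Longrightarrow> Out y \<in> F \<rightarrow>\<^sub>M K"
    and lik_meas: "\<And>x. x \<in> words n \<Longrightarrow> lik x \<in> borel_measurable K"
    and lik: "\<And>x x' \<omega>. x \<in> words n \<Longrightarrow> x' \<in> words n \<Longrightarrow> \<omega> \<in> space M \<Longrightarrow>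
      lik x (Out (channel_output N n x' \<omega>) \<omega>) = (\<Prod>j\<in>{1..n}. q j (x j \<noteq> (x' j \<noteq> N j \<omega>)) \<omega>)"
    and "0 < t" and "1 \<le> k"
  shows "\<exists>f g. f \<in> {..<k} \<rightarrow> words n \<and> g \<in> K \<rightarrow>\<^sub>M count_space {..<k} \<and>
    (\<Sum>m<k. prob {\<omega>\<in>space M. g (Out (channel_output N n (f m) \<omega>) \<omega>) \<noteq> m})
      \<le> real k * (prob {\<omega>\<in>space M. likelihood n \<omega> < t} + (real k - 1) / (t * 2 ^ n))"
proof -
  let ?q = "\<lambda>x x' \<omega>. \<Prod>j\<in>{1..n}. q j (x' j \<noteq> (x j \<noteq> N j \<omega>)) \<omega>"
  have qm[measurable]: "?q x x' \<in> borel_measurable M" for x x'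
  proof (rule borel_measurable_prod)
    fix j assume "j \<in> {1..n}"
    then have "(\<lambda>\<omega>. q j ((x' j \<noteq> x j) \<noteq> N j \<omega>) \<omega>) \<in> borel_measurable M"
      by (intro q_at_noise_measurable) simp
    moreover have "((x' j \<noteq> x j) \<noteq> N j \<omega>) = (x' j \<noteq> (x j \<noteq> N j \<omega>))" for \<omega> by blast
    ultimately show "(\<lambda>\<omega>. q j (x' j \<noteq> (x j \<noteq> N j \<omega>)) \<omega>) \<in> borel_measurable M" by (simp only:)
  qed
  have qset: "{\<omega>\<in>space M. t \<le> ?q x x' \<omega>} \<in> sets M" for x x' by measurable
  have qint: "integrable M (indicator {\<omega>\<in>space M. t \<le> ?q x x' \<omega>} :: 'w \<Rightarrow> real)" for x x'
    by (rule integrable_real_indicator[OF qset]) (simp add: less_top[symmetric])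
  have [measurable]: "likelihood n \<in> borel_measurable M" by (rule likelihood_measurable)
  \<comment> \<open>The probability that x' reaches the threshold when x is sent. It depends on the
    two words only through their XOR, hence is symmetric.\<close>
  define c where "c = (\<lambda>x x'. prob {\<omega>\<in>space M. t \<le> ?q x x' \<omega>})"
  have sym: "c x x' = c x' x" for x x'
  proof -
    have "?q x x' \<omega> = ?q x' x \<omega>" for \<omega>
      by (intro prod.cong refl arg_cong2[where f="\<lambda>b \<omega>. q _ b \<omega>"]) auto
    then show ?thesis by (simp add: c_def)
  qed
  \<comment> \<open>At every outcome the likelihoods of all words add up to 1, so at most 1/t words
    reach t.\<close>
  have total: "(\<Sum>x'\<in>words n. c x x') \<le> 1 / t" for x
  proof -
    have "(\<Sum>x'\<in>words n. c x x') = (\<Sum>x'\<in>words n. \<integral>\<omega>. indicator {\<omega>\<in>space M. t \<le> ?q x x' \<omega>} \<omega> \<partial>M)"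
      by (simp add: c_def Int_absorb2 subset_eq)
    also have "\<dots> = (\<integral>\<omega>. (\<Sum>x'\<in>words n. indicator {\<omega>\<in>space M. t \<le> ?q x x' \<omega>} \<omega>) \<partial>M)"
      by (rule Bochner_Integration.integral_sum[symmetric]) (rule qint)
    also have "\<dots> \<le> 1 / t"
    proof (rule integral_le_const)
      show "integrable M (\<lambda>\<omega>. \<Sum>x'\<in>words n. indicator {\<omega>\<in>space M. t \<le> ?q x x' \<omega>} \<omega> :: real)"
        by (intro Bochner_Integration.integrable_sum qint)
      show "AE \<omega> in M. (\<Sum>x'\<in>words n. indicator {\<omega>\<in>space M. t \<le> ?q x x' \<omega>} \<omega>) \<le> 1 / t"
      proof (rule AE_I2)
        fix \<omega>
        have "(\<Sum>x'\<in>words n. indicator {\<omega>\<in>space M. t \<le> ?q x x' \<omega>} \<omega>) \<le> (\<Sum>x'\<in>words n. ?q x x' \<omega> / t)"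
          using \<open>0 < t\<close> by (intro sum_mono) (auto simp: indicator_def field_simps intro!: prod_nonneg q_nonneg)
        also have "\<dots> = (\<Sum>x'\<in>words n. ?q x x' \<omega>) / t" by (rule sum_divide_distrib[symmetric])
        also have "(\<Sum>x'\<in>words n. ?q x x' \<omega>) = (\<Prod>j\<in>{1..n}. \<Sum>b\<in>UNIV. q j (b \<noteq> (x j \<noteq> N j \<omega>)) \<omega>)"
          by (rule prod_sum_PiE[symmetric]) auto
        also have "\<dots> = 1"
        proof (intro prod.neutral ballI)
          fix j
          show "(\<Sum>b\<in>UNIV. q j (b \<noteq> (x j \<noteq> N j \<omega>)) \<omega>) = 1"
            unfolding sum_bool using q_sum[of j \<omega>] by (cases "x j"; cases "N j \<omega>") auto
        qed
        finally show "(\<Sum>x'\<in>words n. indicator {\<omega>\<in>space M. t \<le> ?q x x' \<omega>} \<omega>) \<le> 1 / t" .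
      qed
    qed
    finally show ?thesis .
  qed
  have "words n \<noteq> {}" by (auto simp: PiE_eq_empty_iff)
  from greedy_codewords[where c=c and X="words n" and B="1/t" and k=k, OF words_finite this sym total]
  obtain f where f: "\<And>m. f m \<in> words n"
    and fc: "(\<Sum>m<k. \<Sum>m'\<in>{..<k} - {m}. c (f m) (f m')) \<le> real k * (real k - 1) * (1 / t / real (card (words n)))"
    by auto
  define P where "P = (\<lambda>m o'. m < k \<and> t \<le> lik (f m) o')"
  \<comment> \<open>The default 0 is a legitimate message because k >= 1.\<close>
  define g where "g = (\<lambda>o'. if \<exists>m. P m o' then LEAST m. P m o' else 0)"
  have [measurable]: "Measurable.pred K (P m)" for m
    unfolding P_def using lik_meas[OF f[of m]] by measurable
  have g_meas: "g \<in> K \<rightarrow>\<^sub>M count_space {..<k}"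
  proof (subst measurable_count_space_eq2, simp, intro conjI ballI)
    have "g o' < k" for o'
      using LeastI[of "\<lambda>m. P m o'"] \<open>1 \<le> k\<close> by (auto simp: g_def P_def)
    then show "g \<in> space K \<rightarrow> {..<k}" by auto
    have "g \<in> K \<rightarrow>\<^sub>M count_space UNIV" unfolding g_def by measurable
    then show "g -` {a} \<inter> space K \<in> sets K" for a by (rule measurable_sets) simp
  qed
  let ?obs = "\<lambda>m \<omega>. Out (channel_output N n (f m) \<omega>) \<omega>"
  have err: "prob {\<omega>\<in>space M. g (?obs m \<omega>) \<noteq> m} \<le> prob {\<omega>\<in>space M. likelihood n \<omega> < t} + (\<Sum>m'\<in>{..<k} - {m}. c (f m) (f m'))"
    if m: "m < k" for m
  proof -
    have "{\<omega>\<in>space M. g (?obs m \<omega>) \<noteq> m} \<subseteq>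
        {\<omega>\<in>space M. likelihood n \<omega> < t} \<union> (\<Union>m'\<in>{..<k} - {m}. {\<omega>\<in>space M. t \<le> ?q (f m) (f m') \<omega>})"
    proof (intro subsetI, clarify)
      fix \<omega> assume *: "\<omega> \<in> space M" "g (?obs m \<omega>) \<noteq> m"
        "\<omega> \<notin> (\<Union>m'\<in>{..<k} - {m}. {\<omega>\<in>space M. t \<le> ?q (f m) (f m') \<omega>})"
      have l: "lik (f m') (?obs m \<omega>) = ?q (f m) (f m') \<omega>" for m'
        using lik[OF f f *(1)] .
      have no: "\<not> P m' (?obs m \<omega>)" if "m' \<noteq> m" for m'
        using *(1,3) that l[of m'] by (auto simp: P_def)
      have "\<not> P m (?obs m \<omega>)"
      proof
        assume Pm: "P m (?obs m \<omega>)"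
        have "P (LEAST i. P i (?obs m \<omega>)) (?obs m \<omega>)" using Pm by (rule LeastI)
        with no have "(LEAST i. P i (?obs m \<omega>)) = m" by blast
        moreover have "g (?obs m \<omega>) = (LEAST i. P i (?obs m \<omega>))"
          unfolding g_def by (rule if_P, rule exI, rule Pm)
        ultimately show False using *(2) by (simp only:)
      qed
      then have "?q (f m) (f m) \<omega> < t" using m l[of m] by (auto simp: P_def)
      moreover have "?q (f m) (f m) \<omega> = likelihood n \<omega>"
        unfolding likelihood_def by (intro prod.cong refl arg_cong2[where f="\<lambda>b \<omega>. q _ b \<omega>"]) auto
      ultimately show "likelihood n \<omega> < t" by simp
    qed
    moreover have L: "{\<omega>\<in>space M. likelihood n \<omega> < t} \<in> sets M" by measurable
    moreover have U: "(\<Union>m'\<in>{..<k} - {m}. {\<omega>\<in>space M. t \<le> ?q (f m) (f m') \<omega>}) \<in> sets M"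
      by (intro sets.finite_UN) (simp, measurable)
    ultimately have "prob {\<omega>\<in>space M. g (?obs m \<omega>) \<noteq> m} \<le>
        prob ({\<omega>\<in>space M. likelihood n \<omega> < t} \<union> (\<Union>m'\<in>{..<k} - {m}. {\<omega>\<in>space M. t \<le> ?q (f m) (f m') \<omega>}))"
      by (intro finite_measure_mono sets.Un)
    also have "\<dots> \<le> prob {\<omega>\<in>space M. likelihood n \<omega> < t} + prob (\<Union>m'\<in>{..<k} - {m}. {\<omega>\<in>space M. t \<le> ?q (f m) (f m') \<omega>})"
      by (rule measure_Un_le[OF L U])
    also have "prob (\<Union>m'\<in>{..<k} - {m}. {\<omega>\<in>space M. t \<le> ?q (f m) (f m') \<omega>}) \<le> (\<Sum>m'\<in>{..<k} - {m}. c (f m) (f m'))"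
      unfolding c_def by (rule finite_measure_subadditive_finite) (simp, use qset in blast)
    finally show ?thesis by simp
  qed
  have "(\<Sum>m<k. prob {\<omega>\<in>space M. g (?obs m \<omega>) \<noteq> m}) \<le>
      (\<Sum>m<k. prob {\<omega>\<in>space M. likelihood n \<omega> < t} + (\<Sum>m'\<in>{..<k} - {m}. c (f m) (f m')))"
    by (intro sum_mono err) auto
  also have "\<dots> \<le> real k * prob {\<omega>\<in>space M. likelihood n \<omega> < t} + real k * (real k - 1) * (1 / t / real (card (words n)))"
    using fc by (simp add: sum.distrib)
  also have "\<dots> = real k * (prob {\<omega>\<in>space M. likelihood n \<omega> < t} + (real k - 1) / (t * 2 ^ n))"
    by (simp add: card_words[unfolded One_nat_def] field_simps)
  finally show ?thesis using f g_meas by blast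
qed

section \<open>From one-shot bounds to capacity\<close>

context
  fixes tau S :: "nat \<Rightarrow> 'w \<Rightarrow> real" and lam c :: real
    and K :: "nat \<Rightarrow> 'o measure" and Out :: "nat \<Rightarrow> (nat \<Rightarrow> bool) \<Rightarrow> 'w \<Rightarrow> 'o"
  assumes Out: "\<And>n y. y \<in> words n \<Longrightarrow> Out n y \<in> F \<rightarrow>\<^sub>M K n"
    and c: "c \<in> {0..1}" and lam: "0 < lam"
    and decor: "\<And>\<epsilon>. 0 < \<epsilon> \<Longrightarrow> \<exists>k0. \<forall>i\<ge>1. \<forall>k\<ge>k0. \<bar>expectation (\<lambda>\<omega>.
      (binary_entropy (q i True \<omega>) - c) * (binary_entropy (q (i + k) True \<omega>) - c))\<bar> \<le> \<epsilon>"
begin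

abbreviation obs :: "nat \<Rightarrow> (nat \<Rightarrow> bool) \<Rightarrow> 'w \<Rightarrow> 'o" where
  "obs \<equiv> \<lambda>n x \<omega>. Out n (channel_output N n x \<omega>) \<omega>"

lemma decoding_event:
  assumes "g \<in> K n \<rightarrow>\<^sub>M count_space Msgs" "m \<in> Msgs"
  shows "{\<omega>\<in>space M. g (obs n x \<omega>) = m} \<in> sets M" "{\<omega>\<in>space M. g (obs n x \<omega>) \<noteq> m} \<in> sets M"
proof -
  have "(\<lambda>\<omega>. g (obs n x \<omega>)) \<in> M \<rightarrow>\<^sub>M count_space Msgs"
    using observation_measurable[OF Out] assms(1) by (rule measurable_compose)
  then have "(\<lambda>\<omega>. g (obs n x \<omega>)) -` {m} \<inter> space M \<in> sets M"
    by (rule measurable_sets) (use assms(2) in simp)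
  also have "(\<lambda>\<omega>. g (obs n x \<omega>)) -` {m} \<inter> space M = {\<omega>\<in>space M. g (obs n x \<omega>) = m}" by blast
  finally show e: "{\<omega>\<in>space M. g (obs n x \<omega>) = m} \<in> sets M" .
  have "{\<omega>\<in>space M. g (obs n x \<omega>) \<noteq> m} = space M - {\<omega>\<in>space M. g (obs n x \<omega>) = m}" by blast
  then show "{\<omega>\<in>space M. g (obs n x \<omega>) \<noteq> m} \<in> sets M" using e by (simp only: sets.compl_sets)
qed

text \<open>If R exceeded the bound by 2 delta, codes with error below 1/2 would have success
  probabilities adding up to more than |Msgs|/2. But \<open>one_shot_converse\<close> allows at most
  |Msgs|/4 for atypically likely noise and |Msgs|/4 for the term t 2^n.\<close>

lemma achievable_rate_le:
  assumes time: "\<And>n. 1 \<le> n \<Longrightarrow> real n / lam < expectation (all_served_time tau S n)"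
    and R: "achievable M tau S K obs R"
  shows "R \<le> lam * (1 - c)"
proof (rule ccontr)
  assume "\<not> R \<le> lam * (1 - c)"
  define \<delta> where "\<delta> = (R - lam * (1 - c)) / 2"
  \<comment> \<open>Converts delta to bits per symbol: the code will have Rt > 1 - c + 2 eta. One
    eta is spent on the threshold t, the other leaves the decaying factor 2^(-n eta).\<close>
  define \<eta> where "\<eta> = \<delta> / (2 * lam)"
  have \<delta>: "0 < \<delta>" using \<open>\<not> R \<le> lam * (1 - c)\<close> by (simp add: \<delta>_def)
  have \<eta>: "0 < \<eta>" using \<delta> lam by (simp add: \<eta>_def)
  have "\<forall>\<^sub>F n in sequentially. prob {\<omega>\<in>space M. 2 powr (- (real n * (c - \<eta>))) < likelihood n \<omega>} < 1/4"
    using equipartition(2)[OF c \<eta> decor] by (rule order_tendstoD) simp_all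
  moreover have "\<forall>\<^sub>F n in sequentially. 2 powr (- (real n * \<eta>)) < 1/4"
    using powr_neg_tendsto_0[OF \<eta>] by (rule order_tendstoD) simp
  moreover have "\<forall>\<^sub>F n in sequentially. \<exists>Rt T Msgs f g.
          is_code M tau S K n Rt T Msgs f g \<and>
          error_probability M obs n Msgs f g < 1/2 \<and>
          real n * Rt / T > R - \<delta>"
    using R \<delta> unfolding achievable_def by (auto dest: bspec[of _ _ "1/2"])
  ultimately have "\<forall>\<^sub>F n in sequentially. False"
  proof eventually_elim
    case (elim n)
    then obtain Rt T Msgs f g where code: "is_code M tau S K n Rt T Msgs f g"
      and err: "error_probability M obs n Msgs f g < 1/2" and rate: "real n * Rt / T > R - \<delta>" by blast
    from code have n: "1 \<le> n" and Msgs: "finite Msgs" and card: "real (card Msgs) = 2 powr (real n * Rt)"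
      and f: "f \<in> Msgs \<rightarrow> words n" and g: "g \<in> K n \<rightarrow>\<^sub>M count_space Msgs"
      and T: "expectation (all_served_time tau S n) < T" by (simp_all add: is_code_def)
    have npos: "0 < real n" using n by simp
    have card_pos: "0 < real (card Msgs)" unfolding card by simp
    then have ne: "Msgs \<noteq> {}" by auto
    have T: "real n / lam < T" using time[OF n] T by linarith
    have Tpos: "0 < T" using T npos lam by (smt (verit) divide_pos_pos)
    have "0 \<le> lam * (1 - c)" using c lam by simp
    moreover have R\<delta>: "R - \<delta> = lam * (1 - c) + \<delta>" by (simp add: \<delta>_def field_simps)
    ultimately have rpos: "0 < real n * Rt / T" using rate \<delta> by linarith
    then have Rt: "0 < Rt" using npos Tpos by (simp add: zero_less_divide_iff zero_less_mult_iff)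
    \<comment> \<open>As Rt is positive, replacing T by the smaller n / lam can only increase the
      quotient.\<close>
    have "real n * Rt / T \<le> real n * Rt / (real n / lam)"
      using T Tpos npos lam Rt by (intro divide_left_mono mult_pos_pos) auto
    also have "\<dots> = lam * Rt" using npos lam by simp
    finally have "lam * (1 - c) + \<delta> < lam * Rt" using rate R\<delta> by linarith
    moreover have "lam * (1 - c) + \<delta> = lam * (1 - c + 2 * \<eta>)" using lam by (simp add: \<eta>_def field_simps)
    ultimately have Rt_gt: "1 - c + 2 * \<eta> < Rt" using lam by simp
    let ?E = "\<lambda>m. {\<omega>\<in>space M. g (obs n (f m) \<omega>) \<noteq> m}"
    let ?C = "\<lambda>m. {\<omega>\<in>space M. g (obs n (f m) \<omega>) = m}"
    have "(\<Sum>m\<in>Msgs. prob (?E m)) / real (card Msgs) < 1/2"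
      using error_probability_eq_average[where obs=obs and f=f, OF Msgs ne decoding_event(2)[OF g]] err by simp
    then have E: "(\<Sum>m\<in>Msgs. prob (?E m)) < real (card Msgs) / 2" using card_pos by (simp add: field_simps)
    have "prob (?C m) = 1 - prob (?E m)" if "m \<in> Msgs" for m
    proof -
      have "?C m = space M - ?E m" by blast
      then show ?thesis using prob_compl[OF decoding_event(2)[OF g that]] by simp
    qed
    then have "(\<Sum>m\<in>Msgs. prob (?C m)) = real (card Msgs) - (\<Sum>m\<in>Msgs. prob (?E m))"
      by (simp add: sum_subtractf)
    with E have C: "real (card Msgs) / 2 < (\<Sum>m\<in>Msgs. prob (?C m))" by simp
    define t where "t = 2 powr (- (real n * (c - \<eta>)))"
    have "(\<Sum>m\<in>Msgs. prob (?C m)) \<le> real (card Msgs) * prob {\<omega>\<in>space M. t < likelihood n \<omega>} + t * 2 ^ n"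
      by (rule one_shot_converse[where Out="Out n" and t=t, OF Msgs f Out g]) (simp_all add: t_def)
    also have "\<dots> \<le> real (card Msgs) * (1/4) + real (card Msgs) * (1/4)"
    proof (intro add_mono mult_left_mono)
      show "prob {\<omega>\<in>space M. t < likelihood n \<omega>} \<le> 1/4" using elim(1) by (simp add: t_def)
      have "t * 2 ^ n = 2 powr (real n * (1 - c + 2 * \<eta>)) * 2 powr (- (real n * \<eta>))"
        by (simp add: t_def powr_realpow[symmetric] powr_add[symmetric] algebra_simps)
      also have "\<dots> \<le> 2 powr (real n * Rt) * (1/4)"
        using Rt_gt elim(2) npos by (intro mult_mono) auto
      finally show "t * 2 ^ n \<le> real (card Msgs) * (1/4)" by (simp add: card)
    qed simp
    finally show False using C by simp
  qed
  then show False by simp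
qed

text \<open>About 2^(n (1 - c - 3 eta)) messages are sent with decoding threshold 2^(-n (c + eta)).
  Typical noise passes the threshold, and the confusion term is at most 2^(-2 n eta).\<close>

lemma achievable_capacity:
  fixes lik :: "nat \<Rightarrow> (nat \<Rightarrow> bool) \<Rightarrow> 'o \<Rightarrow> real"
  assumes time: "\<And>\<epsilon>. 0 < \<epsilon> \<Longrightarrow> \<forall>\<^sub>F n in sequentially. expectation (all_served_time tau S n) < real n * (1 / lam + \<epsilon>)"
    and lik_meas: "\<And>n x. x \<in> words n \<Longrightarrow> lik n x \<in> borel_measurable (K n)"
    and lik: "\<And>n x x' \<omega>. x \<in> words n \<Longrightarrow> x' \<in> words n \<Longrightarrow> \<omega> \<in> space M \<Longrightarrow>
      lik n x (obs n x' \<omega>) = (\<Prod>j\<in>{1..n}. q j (x j \<noteq> (x' j \<noteq> N j \<omega>)) \<omega>)"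
  shows "achievable M tau S K obs (lam * (1 - c))"
  unfolding achievable_def
proof (intro ballI allI impI)
  fix \<epsilon> \<delta> :: real assume \<epsilon>: "\<epsilon> \<in> {0<..<1}" and \<delta>: "0 < \<delta>"
  \<comment> \<open>Makes delta equal to 4 lam eta + lam^2 eta: 3 lam eta pays for the reduced
    number of messages, the rest for the time 1 / lam + eta per symbol in place of 1 / lam.\<close>
  define \<eta> where "\<eta> = \<delta> / (lam * (4 + lam))"
  have \<eta>: "0 < \<eta>" using \<delta> lam by (simp add: \<eta>_def)
  have \<delta>_eq: "\<delta> = 4 * lam * \<eta> + lam * lam * \<eta>"
  proof -
    have "\<delta> = \<eta> * (lam * (4 + lam))" using lam by (simp add: \<eta>_def)
    then show ?thesis by (simp add: algebra_simps)
  qed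
  have "\<forall>\<^sub>F n in sequentially. prob {\<omega>\<in>space M. likelihood n \<omega> < 2 powr (- (real n * (c + \<eta>)))} < \<epsilon> / 2"
    using equipartition(1)[OF c \<eta> decor] by (rule order_tendstoD) (use \<epsilon> in auto)
  moreover have "\<forall>\<^sub>F n in sequentially. 2 powr (- (real n * (2 * \<eta>))) < \<epsilon> / 2"
    by (rule order_tendstoD[OF powr_neg_tendsto_0]) (use \<eta> \<epsilon> in auto)
  moreover note time[OF \<eta>] eventually_ge_at_top[of 1]
  ultimately show "\<forall>\<^sub>F n in sequentially. \<exists>Rt T Msgs f g.
          is_code M tau S K n Rt T Msgs f g \<and>
          error_probability M obs n Msgs f g < \<epsilon> \<and>
          real n * Rt / T > lam * (1 - c) - \<delta>"
  proof eventually_elim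
    case (elim n)
    have npos: "0 < real n" using elim by simp
    define x where "x = 1 - c - 3 * \<eta>"
    \<comment> \<open>Rounding up gives Rt >= x, while the number k - 1 of competing messages stays
      at most 2^(n x).\<close>
    define k where "k = nat \<lceil>2 powr (real n * x)\<rceil>"
    define t where "t = 2 powr (- (real n * (c + \<eta>)))"
    have "0 < 2 powr (real n * x)" by simp
    then have k: "1 \<le> k" "2 powr (real n * x) \<le> real k" "real k - 1 \<le> 2 powr (real n * x)"
      unfolding k_def by linarith+
    have "0 < t" by (simp add: t_def)
    from one_shot_achievability[where Out="Out n" and K="K n" and lik="lik n", OF Out lik_meas lik this k(1)]
    obtain f g where f: "f \<in> {..<k} \<rightarrow> words n" and g: "g \<in> K n \<rightarrow>\<^sub>M count_space {..<k}"
      and fg: "(\<Sum>m<k. prob {\<omega>\<in>space M. g (obs n (f m) \<omega>) \<noteq> m})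
        \<le> real k * (prob {\<omega>\<in>space M. likelihood n \<omega> < t} + (real k - 1) / (t * 2 ^ n))"
      by blast
    define Rt where "Rt = log 2 (real k) / real n"
    define T where "T = real n * (1 / lam + \<eta>)"
    have nRt: "real n * Rt = log 2 (real k)" using npos by (simp add: Rt_def)
    have code: "is_code M tau S K n Rt T {..<k} f g"
      unfolding is_code_def nRt T_def using elim f g k(1) by auto
    have "error_probability M obs n {..<k} f g =
        (\<Sum>m<k. prob {\<omega>\<in>space M. g (obs n (f m) \<omega>) \<noteq> m}) / real (card {..<k})"
      by (rule error_probability_eq_average) (use k(1) decoding_event(2)[OF g] in \<open>auto simp: lessThan_empty_iff\<close>)
    also have "\<dots> \<le> prob {\<omega>\<in>space M. likelihood n \<omega> < t} + (real k - 1) / (t * 2 ^ n)"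
      using fg k(1) by (simp add: divide_le_eq mult.commute)
    also have "(real k - 1) / (t * 2 ^ n) \<le> 2 powr (real n * x) / (t * 2 ^ n)"
      using k(3) \<open>0 < t\<close> by (intro divide_right_mono) auto
    also have "\<dots> = 2 powr (- (real n * (2 * \<eta>)))"
    proof -
      have "t * 2 ^ n = 2 powr (- (real n * (c + \<eta>)) + real n)"
        by (simp only: t_def powr_add powr_realpow)
      then have "2 powr (real n * x) / (t * 2 ^ n) = 2 powr (real n * x - (- (real n * (c + \<eta>)) + real n))"
        by (simp only: powr_diff)
      also have "real n * x - (- (real n * (c + \<eta>)) + real n) = - (real n * (2 * \<eta>))"
        by (simp add: x_def algebra_simps)
      finally show ?thesis .
    qed
    finally have err: "error_probability M obs n {..<k} f g < \<epsilon>"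
      using elim(1,2) by (simp add: t_def)
    have Rt0: "0 \<le> Rt" unfolding Rt_def using k(1) by simp
    have "real n * x \<le> log 2 (real k)" using k(1,2) by (simp add: le_log_iff)
    then have Rtx: "x \<le> Rt" using npos by (simp add: Rt_def field_simps)
    have pos: "0 < 1 / lam + \<eta>" using lam \<eta> by (simp add: add_pos_pos)
    have nRT: "real n * Rt / T = Rt / (1 / lam + \<eta>)" using npos by (simp add: T_def)
    have "lam * (1 - c) - \<delta> < Rt / (1 / lam + \<eta>)"
    proof -
      have l\<eta>: "0 < lam * \<eta>" "0 < lam * lam * \<eta>" using lam \<eta> by simp_all
      have eq: "lam * (1 - c) - \<delta> = lam * x - lam * \<eta> - lam * (lam * \<eta>)"
        by (simp add: \<delta>_eq x_def algebra_simps)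
      show ?thesis
      \<comment> \<open>If x <= 0, the rate asked for is negative and Rt >= 0 suffices.\<close>
      proof (cases "x \<le> 0")
        case True
        then have "lam * x \<le> 0" using lam by (simp add: mult_nonneg_nonpos)
        then have "lam * (1 - c) - \<delta> < 0" using l\<eta> by (simp add: eq mult.assoc)
        also have "0 \<le> Rt / (1 / lam + \<eta>)" using Rt0 pos by simp
        finally show ?thesis .
      next
        case False
        have "x \<le> 1" using c \<eta> by (simp add: x_def)
        have "(lam * x - lam * \<eta> - lam * (lam * \<eta>)) * (1 / lam + \<eta>) < x"
        proof -
          have "(lam * x - lam * \<eta> - lam * (lam * \<eta>)) * (1 / lam + \<eta>) =
              x + lam * \<eta> * (x - 1) - \<eta> - lam * \<eta> * \<eta> - lam * \<eta> * (lam * \<eta>)"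
            using lam by (simp add: field_simps)
          moreover have "lam * \<eta> * (x - 1) \<le> 0" using l\<eta>(1) \<open>x \<le> 1\<close> by (intro mult_nonneg_nonpos) auto
          moreover have "0 < lam * \<eta> * \<eta>" "0 < lam * \<eta> * (lam * \<eta>)" using lam \<eta> by simp_all
          ultimately show ?thesis using \<eta> by linarith
        qed
        then have "lam * (1 - c) - \<delta> < x / (1 / lam + \<eta>)" unfolding eq using pos by (simp add: less_divide_eq)
        also have "\<dots> \<le> Rt / (1 / lam + \<eta>)" using Rtx pos by (intro divide_right_mono) auto
        finally show ?thesis .
      qed
    qed
    with code err nRT show ?case by (intro exI[of _ Rt] exI[of _ T] exI[of _ "{..<k}"] exI[of _ f] exI[of _ g]) simp
  qed
qed

end

text \<open>The common form of both capacities: \<open>c\<close> is the limiting entropy per symbol,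
  and what the receiver knows enters only through \<open>F\<close>, \<open>Out\<close> and a
  likelihood \<open>lik\<close> that is computable from the observation.\<close>

theorem capacity_eq:
  fixes lik :: "nat \<Rightarrow> (nat \<Rightarrow> bool) \<Rightarrow> 'o \<Rightarrow> real"
  assumes Out: "\<And>n y. y \<in> words n \<Longrightarrow> Out n y \<in> F \<rightarrow>\<^sub>M K n"
    and c: "c \<in> {0..1}" and lam: "0 < lam"
    and decor: "\<And>\<epsilon>. 0 < \<epsilon> \<Longrightarrow> \<exists>k0. \<forall>i\<ge>1. \<forall>k\<ge>k0. \<bar>expectation (\<lambda>\<omega>.
      (binary_entropy (q i True \<omega>) - c) * (binary_entropy (q (i + k) True \<omega>) - c))\<bar> \<le> \<epsilon>"
    and time_lower: "\<And>n. 1 \<le> n \<Longrightarrow> real n / lam < expectation (all_served_time tau S n)"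
    and time_upper: "\<And>\<epsilon>. 0 < \<epsilon> \<Longrightarrow>
      \<forall>\<^sub>F n in sequentially. expectation (all_served_time tau S n) < real n * (1 / lam + \<epsilon>)"
    and lik_meas: "\<And>n x. x \<in> words n \<Longrightarrow> lik n x \<in> borel_measurable (K n)"
    and lik: "\<And>n x x' \<omega>. x \<in> words n \<Longrightarrow> x' \<in> words n \<Longrightarrow> \<omega> \<in> space M \<Longrightarrow>
      lik n x (Out n (channel_output N n x' \<omega>) \<omega>) = (\<Prod>j\<in>{1..n}. q j (x j \<noteq> (x' j \<noteq> N j \<omega>)) \<omega>)"
  shows "capacity M tau S K (\<lambda>n x \<omega>. Out n (channel_output N n x \<omega>) \<omega>) = ereal (lam * (1 - c))"
  unfolding capacity_def
proof (rule antisym)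
  let ?obs = "\<lambda>n x \<omega>. Out n (channel_output N n x \<omega>) \<omega>"
  show "(SUP R\<in>{R. achievable M tau S K ?obs R}. ereal R) \<le> ereal (lam * (1 - c))"
    using achievable_rate_le[where K=K and Out=Out, OF Out c lam decor time_lower]
    by (intro SUP_least) simp
  have "achievable M tau S K ?obs (lam * (1 - c))"
    by (rule achievable_capacity[where K=K and Out=Out and lik=lik, OF Out c lam decor time_upper lik_meas lik])
  then show "ereal (lam * (1 - c)) \<le> (SUP R\<in>{R. achievable M tau S K ?obs R}. ereal R)"
    by (intro SUP_upper) simp
qed

end

section \<open>The queue-channel\<close>

text \<open>A finite index set in the disjoint sum splits into two blocks; probabilities factorise
  first between the blocks and then inside each. A single independent family is wanted because every
  increment of the walk mixes an arrival and a service variable.\<close>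

lemma (in prob_space) indep_vars_Plus:
  assumes X: "indep_vars (\<lambda>_. L) X I" and Y: "indep_vars (\<lambda>_. L) Y J"
    and XY: "indep_var (PiM I (\<lambda>_. L)) (\<lambda>\<omega>. \<lambda>i\<in>I. X i \<omega>) (PiM J (\<lambda>_. L)) (\<lambda>\<omega>. \<lambda>j\<in>J. Y j \<omega>)"
  shows "indep_vars (\<lambda>_. L) (case_sum X Y) (I <+> J)"
  unfolding indep_vars_def2
proof (intro conjI ballI indep_setsI)
  show rv: "random_variable L (case_sum X Y k)" if "k \<in> I <+> J" for k
    using that X Y by (auto simp: indep_vars_def)
  show "{case_sum X Y k -` A \<inter> space M |A. A \<in> sets L} \<subseteq> events" if "k \<in> I <+> J" for k
    using rv[OF that] by (auto intro: measurable_sets)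
  fix A K assume K: "K \<noteq> {}" "K \<subseteq> I <+> J" "finite K"
    and A: "\<forall>k\<in>K. A k \<in> {case_sum X Y k -` B \<inter> space M |B. B \<in> sets L}"
  then have "\<forall>k\<in>K. \<exists>B. A k = case_sum X Y k -` B \<inter> space M \<and> B \<in> sets L" by auto
  from bchoice[OF this] obtain B where B: "\<And>k. k \<in> K \<Longrightarrow> A k = case_sum X Y k -` B k \<inter> space M"
    "\<And>k. k \<in> K \<Longrightarrow> B k \<in> sets L" by auto
  define K1 where "K1 = Inl -` K"
  define K2 where "K2 = Inr -` K"
  have fin: "finite K1" "finite K2" unfolding K1_def K2_def
    using K(3) by (auto intro: finite_vimageI)
  have sub: "K1 \<subseteq> I" "K2 \<subseteq> J" using K(2) by (auto simp: K1_def K2_def)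
  have K_eq: "K = Inl ` K1 \<union> Inr ` K2"
  proof (rule set_eqI)
    show "k \<in> K \<longleftrightarrow> k \<in> Inl ` K1 \<union> Inr ` K2" for k by (cases k) (auto simp: K1_def K2_def)
  qed
  let ?E1 = "{f\<in>space (PiM I (\<lambda>_. L)). \<forall>i\<in>K1. f i \<in> B (Inl i)}"
  let ?E2 = "{f\<in>space (PiM J (\<lambda>_. L)). \<forall>i\<in>K2. f i \<in> B (Inr i)}"
  have E1: "?E1 \<in> sets (PiM I (\<lambda>_. L))"
  proof (rule sets.sets_Collect_finite_All[OF _ fin(1)])
    fix i assume "i \<in> K1"
    then have "i \<in> I" "B (Inl i) \<in> sets L" using sub B(2) by (auto simp: K1_def)
    then show "{f\<in>space (PiM I (\<lambda>_. L)). f i \<in> B (Inl i)} \<in> sets (PiM I (\<lambda>_. L))" by measurable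
  qed
  have E2: "?E2 \<in> sets (PiM J (\<lambda>_. L))"
  proof (rule sets.sets_Collect_finite_All[OF _ fin(2)])
    fix i assume "i \<in> K2"
    then have "i \<in> J" "B (Inr i) \<in> sets L" using sub B(2) by (auto simp: K2_def)
    then show "{f\<in>space (PiM J (\<lambda>_. L)). f i \<in> B (Inr i)} \<in> sets (PiM J (\<lambda>_. L))" by measurable
  qed
  have inX: "(\<lambda>i\<in>I. X i \<omega>) \<in> space (PiM I (\<lambda>_. L))" if "\<omega> \<in> space M" for \<omega>
    using measurable_space[OF indep_var_rv1[OF XY] that] .
  have inY: "(\<lambda>i\<in>J. Y i \<omega>) \<in> space (PiM J (\<lambda>_. L))" if "\<omega> \<in> space M" for \<omega>
    using measurable_space[OF indep_var_rv2[OF XY] that] .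
  have "(\<Inter>k\<in>K. A k) = (\<lambda>\<omega>. ((\<lambda>i\<in>I. X i \<omega>), (\<lambda>j\<in>J. Y j \<omega>))) -` (?E1 \<times> ?E2) \<inter> space M"
  proof (rule set_eqI)
    fix \<omega>
    have "\<omega> \<in> (\<Inter>k\<in>K. A k) \<longleftrightarrow> \<omega> \<in> space M \<and> (\<forall>k\<in>K. case_sum X Y k \<omega> \<in> B k)"
      using K(1) B(1) by blast
    also have "\<dots> \<longleftrightarrow> \<omega> \<in> space M \<and> (\<forall>i\<in>K1. X i \<omega> \<in> B (Inl i)) \<and> (\<forall>i\<in>K2. Y i \<omega> \<in> B (Inr i))"
      unfolding K_eq by (simp add: ball_Un)
    also have "\<dots> \<longleftrightarrow> \<omega> \<in> space M \<and> (\<forall>i\<in>K1. (\<lambda>i\<in>I. X i \<omega>) i \<in> B (Inl i)) \<and> (\<forall>i\<in>K2. (\<lambda>i\<in>J. Y i \<omega>) i \<in> B (Inr i))"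
      using sub by (simp add: subset_eq cong: ball_cong)
    also have "\<dots> \<longleftrightarrow> \<omega> \<in> (\<lambda>\<omega>. ((\<lambda>i\<in>I. X i \<omega>), (\<lambda>j\<in>J. Y j \<omega>))) -` (?E1 \<times> ?E2) \<inter> space M"
      using inX[of \<omega>] inY[of \<omega>] by (simp only: vimage_eq Int_iff mem_Times_iff fst_conv snd_conv mem_Collect_eq) blast
    finally show "\<omega> \<in> (\<Inter>k\<in>K. A k) \<longleftrightarrow> \<omega> \<in> (\<lambda>\<omega>. ((\<lambda>i\<in>I. X i \<omega>), (\<lambda>j\<in>J. Y j \<omega>))) -` (?E1 \<times> ?E2) \<inter> space M" .
  qed
  then have "prob (\<Inter>k\<in>K. A k) = prob ((\<lambda>\<omega>. \<lambda>i\<in>I. X i \<omega>) -` ?E1 \<inter> space M) * prob ((\<lambda>\<omega>. \<lambda>j\<in>J. Y j \<omega>) -` ?E2 \<inter> space M)"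
    by (simp only: indep_varD[OF XY E1 E2])
  also have "prob ((\<lambda>\<omega>. \<lambda>i\<in>I. X i \<omega>) -` ?E1 \<inter> space M) = (\<Prod>i\<in>K1. prob (A (Inl i)))"
  proof (cases "K1 = {}")
    case True
    have "(\<lambda>\<omega>. \<lambda>i\<in>I. X i \<omega>) -` ?E1 \<inter> space M = space M" using True inX by auto
    then show ?thesis using True by (simp add: prob_space)
  next
    case False
    have "(\<lambda>\<omega>. \<lambda>i\<in>I. X i \<omega>) -` ?E1 \<inter> space M = (\<Inter>i\<in>K1. X i -` B (Inl i) \<inter> space M)"
      using False sub(1) inX by (auto simp: subset_eq)
    also have "prob \<dots> = (\<Prod>i\<in>K1. prob (X i -` B (Inl i) \<inter> space M))"
      by (rule indep_varsD[OF X False fin(1) sub(1)]) (use B(2) in \<open>auto simp: K1_def\<close>)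
    also have "\<dots> = (\<Prod>i\<in>K1. prob (A (Inl i)))"
      by (intro prod.cong) (auto simp: B(1) K1_def)
    finally show ?thesis .
  qed
  also have "prob ((\<lambda>\<omega>. \<lambda>j\<in>J. Y j \<omega>) -` ?E2 \<inter> space M) = (\<Prod>i\<in>K2. prob (A (Inr i)))"
  proof (cases "K2 = {}")
    case True
    have "(\<lambda>\<omega>. \<lambda>j\<in>J. Y j \<omega>) -` ?E2 \<inter> space M = space M" using True inY by auto
    then show ?thesis using True by (simp add: prob_space)
  next
    case False
    have "(\<lambda>\<omega>. \<lambda>j\<in>J. Y j \<omega>) -` ?E2 \<inter> space M = (\<Inter>i\<in>K2. Y i -` B (Inr i) \<inter> space M)"
      using False sub(2) inY by (auto simp: subset_eq)
    also have "prob \<dots> = (\<Prod>i\<in>K2. prob (Y i -` B (Inr i) \<inter> space M))"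
      by (rule indep_varsD[OF Y False fin(2) sub(2)]) (use B(2) in \<open>auto simp: K2_def\<close>)
    also have "\<dots> = (\<Prod>i\<in>K2. prob (A (Inr i)))"
      by (intro prod.cong) (auto simp: B(1) K2_def)
    finally show ?thesis .
  qed
  also have "(\<Prod>i\<in>K1. prob (A (Inl i))) * (\<Prod>i\<in>K2. prob (A (Inr i))) = (\<Prod>k\<in>K. prob (A k))"
    unfolding K_eq using fin by (subst prod.union_disjoint) (auto simp: prod.reindex)
  finally show "prob (\<Inter>k\<in>K. A k) = (\<Prod>k\<in>K. prob (A k))" .
qed

text \<open>The image under X of the measure with density \<open>indicator E\<close> is
  \<open>prob E\<close> times the law of X. It will be applied with E an event about past flips and
  X the next waiting time.\<close>

lemma (in prob_space) integral_indicator_mult_independent: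
  fixes h :: "real \<Rightarrow> real"
  assumes E[measurable]: "E \<in> events" and X[measurable]: "X \<in> borel_measurable M"
    and h[measurable]: "h \<in> borel_measurable borel"
    and indep: "\<And>B. B \<in> sets borel \<Longrightarrow> prob (E \<inter> (X -` B \<inter> space M)) = prob E * prob (X -` B \<inter> space M)"
  shows "expectation (\<lambda>\<omega>. indicator E \<omega> * h (X \<omega>)) = prob E * expectation (\<lambda>\<omega>. h (X \<omega>))"
proof -
  have eq: "distr (density M (\<lambda>\<omega>. ennreal (indicator E \<omega>))) borel X = density (distr M borel X) (\<lambda>_. ennreal (prob E))"
  proof (rule measure_eqI)
    fix B assume "B \<in> sets (distr (density M (\<lambda>\<omega>. ennreal (indicator E \<omega>))) borel X)"
    then have B[measurable]: "B \<in> sets borel" by simp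
    have "emeasure (distr (density M (\<lambda>\<omega>. ennreal (indicator E \<omega>))) borel X) B =
        emeasure (density M (\<lambda>\<omega>. ennreal (indicator E \<omega>))) (X -` B \<inter> space M)"
      by (subst emeasure_distr) simp_all
    also have "\<dots> = (\<integral>\<^sup>+\<omega>. ennreal (indicator E \<omega>) * indicator (X -` B \<inter> space M) \<omega> \<partial>M)"
      by (rule emeasure_density) measurable
    also have "\<dots> = (\<integral>\<^sup>+\<omega>. indicator (E \<inter> (X -` B \<inter> space M)) \<omega> \<partial>M)"
      by (intro nn_integral_cong) (simp add: indicator_def)
    also have "\<dots> = emeasure M (E \<inter> (X -` B \<inter> space M))"
      by (rule nn_integral_indicator) measurable
    also have "\<dots> = ennreal (prob E) * ennreal (prob (X -` B \<inter> space M))"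
      by (simp only: emeasure_eq_measure indep[OF B] ennreal_mult[OF measure_nonneg measure_nonneg])
    also have "\<dots> = ennreal (prob E) * emeasure (distr M borel X) B"
      by (simp only: emeasure_eq_measure emeasure_distr[OF X B])
    also have "\<dots> = emeasure (density (distr M borel X) (\<lambda>_. ennreal (prob E))) B"
      by (subst emeasure_density) (simp_all add: nn_integral_cmult)
    finally show "emeasure (distr (density M (\<lambda>\<omega>. ennreal (indicator E \<omega>))) borel X) B =
        emeasure (density (distr M borel X) (\<lambda>_. ennreal (prob E))) B" .
  qed simp
  have "expectation (\<lambda>\<omega>. indicator E \<omega> * h (X \<omega>)) = (\<integral>x. h x \<partial>distr (density M (\<lambda>\<omega>. ennreal (indicator E \<omega>))) borel X)"
    by (subst integral_distr) (simp_all add: integral_density)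
  also have "\<dots> = (\<integral>x. prob E * h x \<partial>distr M borel X)"
    unfolding eq by (subst integral_density) simp_all
  also have "\<dots> = prob E * expectation (\<lambda>\<omega>. h (X \<omega>))"
    by (subst integral_distr) simp_all
  finally show ?thesis .
qed

section \<open>The queue as a reflected walk and its completion times\<close>

context queue_channel
begin

text \<open>The change in waiting time from symbol l + 1 to symbol l + 2 before reflection; hence
  the different shifts of the two indices.\<close>

definition V :: "nat \<Rightarrow> 'w \<Rightarrow> real" where
  "V l \<omega> = S (Suc l) \<omega> - tau (Suc (Suc l)) \<omega>"

lemma waiting_time_nonneg: "0 \<le> waiting_time tau S j \<omega>"
proof (cases j)
  case (Suc k)
  then show ?thesis by (cases k) (auto simp: waiting_time_def)
qed (simp add: waiting_time_def arrival_time_def)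

lemma waiting_time_eq_reflected_walk:
  "waiting_time tau S (Suc k) \<omega> = reflected_walk (\<lambda>l. V l \<omega>) k"
proof (induction k)
  case 0
  show ?case using waiting_time_1 by simp
next
  case (Suc k)
  have "arrival_time tau (Suc (Suc k)) \<omega> - arrival_time tau (Suc k) \<omega> = tau (Suc (Suc k)) \<omega>"
    by (simp add: arrival_time_def)
  moreover have "waiting_time tau S (Suc (Suc k)) \<omega> = max (waiting_time tau S (Suc k) \<omega> + S (Suc k) \<omega> -
      (arrival_time tau (Suc (Suc k)) \<omega> - arrival_time tau (Suc k) \<omega>)) 0"
    by (rule waiting_time_Suc) simp
  ultimately have "waiting_time tau S (Suc (Suc k)) \<omega> = max (reflected_walk (\<lambda>l. V l \<omega>) k + S (Suc k) \<omega> - tau (Suc (Suc k)) \<omega>) 0"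
    by (simp only: Suc)
  also have "\<dots> = reflected_walk (\<lambda>l. V l \<omega>) (Suc k)"
    by (simp add: V_def max.commute)
  finally show ?case .
qed

lemma waiting_time_Suc_eq: "waiting_time tau S (Suc k) = (\<lambda>\<omega>. reflected_walk (\<lambda>l. V l \<omega>) k)"
  by (rule ext) (rule waiting_time_eq_reflected_walk)

lemma tau_measurable: "1 \<le> j \<Longrightarrow> tau j \<in> borel_measurable M"
  using interarrival_indep by (auto simp: indep_vars_def)

lemma S_measurable: "1 \<le> j \<Longrightarrow> S j \<in> borel_measurable M"
  using service_indep by (auto simp: indep_vars_def)

lemma tau_integrable: "1 \<le> j \<Longrightarrow> integrable M (tau j)"
  using erlang_ith_moment_integrable[OF lam(1) interarrival_exponential[of j], of 1] by simp

lemma tau_expectation: "1 \<le> j \<Longrightarrow> expectation (tau j) = 1 / lam"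
  by (rule exponential_distributed_expectation[OF lam(1) interarrival_exponential[of j]])

lemma S_integrable: "1 \<le> j \<Longrightarrow> integrable M (S j)"
  and S_expectation: "1 \<le> j \<Longrightarrow> expectation (S j) = 1"
proof -
  assume j: "1 \<le> j"
  show "integrable M (S j)"
    by (rule integrable_distr[OF S_measurable[OF j], of "\<lambda>s. s"]) (simp only: service_law[OF j] service_mean(1))
  show "expectation (S j) = 1"
    using service_mean(2) unfolding service_law[OF j, symmetric]
    by (subst (asm) integral_distr[OF S_measurable[OF j] measurable_ident_sets[OF refl]])
qed

lemma indep_arrivals_services:
  "indep_vars (\<lambda>_. borel) (case_sum tau S) ({1..} <+> {1..})"
  by (intro indep_vars_Plus interarrival_indep service_indep arrivals_indep_services)

text \<open>The pairs of variables entering different increments are disjoint, so grouping preserves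
  independence. Each increment is the difference of independent variables with fixed laws, and the
  drift is 1 - 1/lam, negative by lam < 1.\<close>

lemma negative_drift_walk_V: "negative_drift_walk M V"
proof
  let ?K = "\<lambda>l. {Inr (Suc l), Inl (Suc (Suc l))}"
  have "indep_vars (\<lambda>l. PiM (?K l) (\<lambda>_. borel)) (\<lambda>l \<omega>. restrict (\<lambda>i. case_sum tau S i \<omega>) (?K l)) UNIV"
    by (rule indep_vars_restrict[OF indep_arrivals_services]) (auto simp: disjoint_family_on_def)
  from indep_vars_compose2[OF this, of "\<lambda>l f. f (Inr (Suc l)) - f (Inl (Suc (Suc l)))" "\<lambda>_. borel"]
  show "indep_vars (\<lambda>_. borel) V UNIV"
    by (simp add: V_def[abs_def])
  show "distr M borel (V l) = distr M borel (V 0)" for l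
  proof -
    have "distr M borel (V l) = distr (FS \<Otimes>\<^sub>M density lborel (exponential_density lam)) borel (\<lambda>(s, t). s - t)" for l
    proof -
      have "indep_var borel ((\<lambda>f. f (Inr (Suc l))) \<circ> (\<lambda>\<omega>. restrict (\<lambda>i. case_sum tau S i \<omega>) {Inr (Suc l)}))
        borel ((\<lambda>f. f (Inl (Suc (Suc l)))) \<circ> (\<lambda>\<omega>. restrict (\<lambda>i. case_sum tau S i \<omega>) {Inl (Suc (Suc l))}))"
        by (rule indep_var_compose[OF indep_var_restrict[OF indep_arrivals_services]]) auto
      then have ind: "indep_var borel (S (Suc l)) borel (tau (Suc (Suc l)))" by (simp add: comp_def)
      have [measurable]: "S (Suc l) \<in> borel_measurable M" "tau (Suc (Suc l)) \<in> borel_measurable M"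
        by (simp_all add: S_measurable tau_measurable)
      have law: "distr M borel (tau (Suc (Suc l))) = density lborel (exponential_density lam)"
        using distributed_distr_eq_density[OF interarrival_exponential[of "Suc (Suc l)"]]
        by (simp cong: distr_cong)
      have "FS \<Otimes>\<^sub>M density lborel (exponential_density lam) =
          distr M (borel \<Otimes>\<^sub>M borel) (\<lambda>\<omega>. (S (Suc l) \<omega>, tau (Suc (Suc l)) \<omega>))"
        using ind unfolding indep_var_distribution_eq by (simp add: law service_law)
      then have "distr (FS \<Otimes>\<^sub>M density lborel (exponential_density lam)) borel (\<lambda>(s, t). s - t) =
          distr M borel ((\<lambda>(s, t). s - t) \<circ> (\<lambda>\<omega>. (S (Suc l) \<omega>, tau (Suc (Suc l)) \<omega>)))"
        by (simp only:) (intro distr_distr; measurable)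
      then show ?thesis by (simp add: comp_def V_def[abs_def])
    qed
    then show ?thesis by simp
  qed
  show "integrable M (V 0)" unfolding V_def
    by (intro Bochner_Integration.integrable_diff S_integrable tau_integrable) auto
  have "expectation (V 0) = 1 - 1 / lam" unfolding V_def
    by (subst Bochner_Integration.integral_diff) (auto simp: S_integrable tau_integrable S_expectation tau_expectation)
  moreover have "1 < 1 / lam" using lam by simp
  ultimately show "expectation (V 0) < 0" by linarith
qed

lemma waiting_time_measurable: "1 \<le> j \<Longrightarrow> waiting_time tau S j \<in> borel_measurable M"
proof -
  assume "1 \<le> j"
  then obtain k where k: "j = Suc k" by (cases j) auto
  interpret w: negative_drift_walk M V by (rule negative_drift_walk_V)
  show ?thesis unfolding k waiting_time_Suc_eq by (rule w.W_measurable)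
qed

lemma services_nonneg: "AE \<omega> in M. \<forall>j\<ge>1. 0 \<le> S j \<omega>"
proof -
  have "AE \<omega> in M. 1 \<le> j \<longrightarrow> 0 \<le> S j \<omega>" for j
  proof (cases "1 \<le> j")
    case True
    have "AE s in distr M borel (S j). 0 \<le> s" 
      unfolding service_law[OF True] by (rule service_nonneg)
    then show ?thesis using AE_distrD[OF S_measurable[OF True]] by simp
  qed simp
  then show ?thesis by (simp add: AE_all_countable)
qed

text \<open>With nonnegative service times, completion times increase in FIFO order, so the last
  symbol attains the maximum.\<close>

lemma all_served_time_eq:
  assumes S: "\<forall>j\<ge>1. 0 \<le> S j \<omega>" and n: "1 \<le> n"
  shows "all_served_time tau S n \<omega> = (\<Sum>i=1..n. tau i \<omega>) + waiting_time tau S n \<omega> + S n \<omega>"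
proof -
  have successor: "departure_time tau S j \<omega> + S j \<omega> \<le> departure_time tau S (Suc j) \<omega> + S (Suc j) \<omega>" if "1 \<le> j" for j
  proof -
    obtain i where i: "j = Suc i" using \<open>1 \<le> j\<close> by (cases j) auto
    have "0 \<le> S (Suc j) \<omega>" using S by simp
    then show ?thesis unfolding i by simp
  qed
  have mono: "departure_time tau S j \<omega> + S j \<omega> \<le> departure_time tau S n \<omega> + S n \<omega>" if "1 \<le> j" "j \<le> n" for j
    using that(2)
  proof (induction n rule: dec_induct)
    case (step m)
    with \<open>1 \<le> j\<close> show ?case using successor[of m] by linarith
  qed simp
  have "all_served_time tau S n \<omega> = departure_time tau S n \<omega> + S n \<omega>"
    unfolding all_served_time_def using n mono by (intro Max_eqI) auto
  then show ?thesis by (simp add: waiting_time_def arrival_time_def)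
qed

lemma waiting_time_integrable: "integrable M (waiting_time tau S (Suc k))"
proof -
  interpret w: negative_drift_walk M V by (rule negative_drift_walk_V)
  have "integrable M (w.W k)"
    by (rule reflected_walk_sublinear(2)[OF w.indep w.ident w.increment_integrable w.drift, of 1]) simp
  then show ?thesis unfolding waiting_time_Suc_eq .
qed

lemma expectation_all_served_time:
  assumes "1 \<le> n"
  shows "expectation (all_served_time tau S n) = real n / lam + expectation (waiting_time tau S n) + 1"
proof -
  obtain k where n: "n = Suc k" using assms by (cases n) auto
  have "expectation (all_served_time tau S n) =
    expectation (\<lambda>\<omega>. (\<Sum>i=1..n. tau i \<omega>) + waiting_time tau S n \<omega> + S n \<omega>)"
  proof (rule integral_cong_AE)
    show ae: "AE \<omega> in M. all_served_time tau S n \<omega> = (\<Sum>i=1..n. tau i \<omega>) + waiting_time tau S n \<omega> + S n \<omega>"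
      using services_nonneg by eventually_elim (rule all_served_time_eq[OF _ assms])
    show "(\<lambda>\<omega>. (\<Sum>i=1..n. tau i \<omega>) + waiting_time tau S n \<omega> + S n \<omega>) \<in> borel_measurable M"
      using assms by (intro borel_measurable_add borel_measurable_sum tau_measurable waiting_time_measurable S_measurable) auto
    have D: "(\<lambda>\<omega>. departure_time tau S j \<omega> + S j \<omega>) \<in> borel_measurable M" if "1 \<le> j" for j
    proof -
      have "(\<lambda>\<omega>. (waiting_time tau S j \<omega> + (\<Sum>i=1..j. tau i \<omega>)) + S j \<omega>) \<in> borel_measurable M"
        using that by (intro borel_measurable_add borel_measurable_sum tau_measurable waiting_time_measurable S_measurable) auto
      then show ?thesis by (simp add: waiting_time_def arrival_time_def)
    qed
    have "(\<lambda>\<omega>. Max ((\<lambda>j. departure_time tau S j \<omega> + S j \<omega>) ` {1..n})) \<in> borel_measurable M"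
      using D assms by (intro borel_measurable_Max) auto
    then show "all_served_time tau S n \<in> borel_measurable M" by (simp add: all_served_time_def[abs_def])
  qed
  also have "\<dots> = (\<Sum>i=1..n. expectation (tau i)) + expectation (waiting_time tau S n) + expectation (S n)"
    using waiting_time_integrable[of k] assms
    by (subst Bochner_Integration.integral_add Bochner_Integration.integral_sum;
        auto simp: n tau_integrable S_integrable intro!: Bochner_Integration.integrable_sum Bochner_Integration.integrable_add)+
  also have "\<dots> = real n / lam + expectation (waiting_time tau S n) + 1"
    using assms by (simp add: tau_expectation S_expectation)
  finally show ?thesis .
qed

text \<open>The mean 1 of the last service makes the inequality strict; waiting can only add to
  it.\<close>

lemma all_served_time_lower:
  assumes "1 \<le> n"
  shows "real n / lam < expectation (all_served_time tau S n)"
proof -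
  have "0 \<le> expectation (waiting_time tau S n)"
    by (rule Bochner_Integration.integral_nonneg) (rule waiting_time_nonneg)
  then show ?thesis using expectation_all_served_time[OF assms] by linarith
qed

lemma all_served_time_upper:
  assumes "0 < \<epsilon>"
  shows "\<forall>\<^sub>F n in sequentially. expectation (all_served_time tau S n) < real n * (1 / lam + \<epsilon>)"
proof -
  interpret w: negative_drift_walk M V by (rule negative_drift_walk_V)
  have "\<forall>\<^sub>F k in sequentially. expectation (w.W k) \<le> \<epsilon> / 2 * real k"
    by (rule reflected_walk_sublinear(1)[OF w.indep w.ident w.increment_integrable w.drift]) (use assms in simp)
  \<comment> \<open>One half of epsilon k covers the growth of the mean wait, the other the mean 1
    of the last service.\<close>
  moreover obtain k0 where "2 / \<epsilon> \<le> real k0" using real_arch_simple by blast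
  then have "\<forall>\<^sub>F k in sequentially. 2 / \<epsilon> \<le> real k"
    by (intro eventually_sequentiallyI[of k0]) linarith
  ultimately have "\<forall>\<^sub>F k in sequentially. expectation (all_served_time tau S (Suc k)) < real (Suc k) * (1 / lam + \<epsilon>)"
  proof eventually_elim
    case (elim k)
    have "1 \<le> \<epsilon> / 2 * real k" using elim(2) assms by (simp add: field_simps)
    moreover have "expectation (waiting_time tau S (Suc k)) \<le> \<epsilon> / 2 * real k"
      using elim(1) unfolding waiting_time_Suc_eq .
    moreover have "expectation (all_served_time tau S (Suc k)) =
        real (Suc k) / lam + expectation (waiting_time tau S (Suc k)) + 1"
      by (rule expectation_all_served_time) simp
    moreover have "real (Suc k) * (1 / lam + \<epsilon>) = real (Suc k) / lam + \<epsilon> + 2 * (\<epsilon> / 2 * real k)"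
      by (simp add: distrib_left distrib_right)
    ultimately show ?case using assms by linarith
  qed
  then show ?thesis by (subst (asm) eventually_sequentially_Suc[of "\<lambda>n. _ n < _ n"])
qed

section \<open>The noise conditioned on the timing\<close>

abbreviation timing :: "'w measure" where
  "timing \<equiv> timing_algebra M tau S"

lemma timings_measurable:
  "(\<lambda>\<omega>. \<lambda>j\<in>{1..}. (tau j \<omega>, S j \<omega>)) \<in> M \<rightarrow>\<^sub>M (\<Pi>\<^sub>M j\<in>{1..}. borel)"
  by (rule measurable_restrict) (intro borel_measurable_Pair tau_measurable S_measurable; simp)

lemma subalgebra_timing: "subalgebra M timing"
  unfolding subalgebra_def timing_algebra_def
proof
  show "sets (vimage_algebra (space M) (\<lambda>\<omega>. \<lambda>j\<in>{1..}. (tau j \<omega>, S j \<omega>)) (\<Pi>\<^sub>M j\<in>{1..}. borel)) \<subseteq> events"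
    by (rule sets_image_in_sets[OF sets_eq_imp_space_eq[OF refl, symmetric]]) (rule timings_measurable)
qed simp

lemma timing_component:
  assumes "1 \<le> j"
  shows "tau j \<in> borel_measurable timing" "S j \<in> borel_measurable timing"
proof -
  have "(\<lambda>\<omega>. \<lambda>j\<in>{1..}. (tau j \<omega>, S j \<omega>)) \<in> timing \<rightarrow>\<^sub>M (\<Pi>\<^sub>M j\<in>{1..}. borel)"
    unfolding timing_algebra_def
    by (rule measurable_vimage_algebra1) (use measurable_space[OF timings_measurable] in auto)
  then have "(\<lambda>\<omega>. (\<lambda>j\<in>{1..}. (tau j \<omega>, S j \<omega>)) j) \<in> timing \<rightarrow>\<^sub>M borel"
    by (rule measurable_compose) (rule measurable_component_singleton, use assms in simp)
  then have pair: "(\<lambda>\<omega>. (tau j \<omega>, S j \<omega>)) \<in> timing \<rightarrow>\<^sub>M borel"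
    using assms by (simp only: restrict_apply' atLeast_iff)
  then have prod: "(\<lambda>\<omega>. (tau j \<omega>, S j \<omega>)) \<in> timing \<rightarrow>\<^sub>M borel \<Otimes>\<^sub>M borel"
    by (simp only: borel_prod)
  show "tau j \<in> borel_measurable timing" "S j \<in> borel_measurable timing"
    using measurable_compose[OF prod measurable_fst] measurable_compose[OF prod measurable_snd]
    by (simp_all only: fst_conv snd_conv)
qed

lemma arrival_time_timing: "arrival_time tau j \<in> borel_measurable timing"
proof -
  have "(\<lambda>\<omega>. \<Sum>i=1..j. tau i \<omega>) \<in> borel_measurable timing"
    by (intro borel_measurable_sum timing_component) simp
  then show ?thesis by (simp only: arrival_time_def[abs_def])
qed

lemma waiting_time_timing:
  assumes "1 \<le> j"
  shows "waiting_time tau S j \<in> borel_measurable timing"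
proof -
  obtain k where "j = Suc k" using assms by (cases j) auto
  moreover have "(\<lambda>\<omega>. reflected_walk (\<lambda>l. V l \<omega>) k) \<in> borel_measurable timing"
    unfolding V_def
    by (intro borel_measurable_reflected_walk borel_measurable_diff timing_component) simp_all
  ultimately show ?thesis by (simp only: waiting_time_Suc_eq)
qed

lemma departure_time_timing:
  assumes "1 \<le> j"
  shows "departure_time tau S j \<in> borel_measurable timing"
proof -
  have "(\<lambda>\<omega>. waiting_time tau S j \<omega> + arrival_time tau j \<omega>) \<in> borel_measurable timing"
    using assms by (intro borel_measurable_add waiting_time_timing arrival_time_timing)
  then show ?thesis by (simp add: waiting_time_def)
qed

definition flip_law :: "real \<Rightarrow> bool \<Rightarrow> real" where
  "flip_law p b = (if b then p else 1 - p)"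

text \<open>The assumption on the conditional expectation, integrated over a timing event; this is
  the form in which \<open>q_cond\<close> asks for it.\<close>

lemma timing_prob:
  assumes J: "finite J" "J \<subseteq> {1..}" and A: "A \<in> sets timing"
  shows "prob (A \<inter> {\<omega>\<in>space M. \<forall>j\<in>J. N j \<omega> = b j}) =
    (\<integral>\<omega>. indicator A \<omega> * (\<Prod>j\<in>J. flip_law (phi (waiting_time tau S j \<omega>)) (b j)) \<partial>M)"
proof -
  let ?E = "{\<omega>\<in>space M. \<forall>j\<in>J. N j \<omega> = b j}"
  interpret sigma_finite_subalgebra M timing
    by (rule finite_measure_subalgebra_is_sigma_finite)
      (simp add: finite_measure_subalgebra_def finite_measure_subalgebra_axioms_def subalgebra_timing finite_measure_axioms)
  have "{\<omega>\<in>space M. N j \<omega> = b j} \<in> sets M" if "j \<in> J" for j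
  proof -
    have "N j -` {b j} \<inter> space M \<in> sets M"
      using J that by (intro measurable_sets[OF noise_measurable]) auto
    also have "N j -` {b j} \<inter> space M = {\<omega>\<in>space M. N j \<omega> = b j}" by blast
    finally show ?thesis .
  qed
  then have E: "?E \<in> sets M" using J by (intro sets.sets_Collect_finite_All)
  have AM: "A \<in> sets M" using A subalgebra_timing by (auto simp: subalgebra_def)
  have "prob (A \<inter> ?E) = (\<integral>\<omega>. indicator (A \<inter> ?E) \<omega> \<partial>M)"
    using AM E by (simp add: Int_absorb2 sets.sets_into_space)
  also have "\<dots> = (\<integral>\<omega>\<in>A. indicator ?E \<omega> \<partial>M)"
    by (simp add: set_lebesgue_integral_def indicator_inter_arith)
  also have "\<dots> = (\<integral>\<omega>\<in>A. real_cond_exp M timing (indicator ?E) \<omega> \<partial>M)"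
    by (rule real_cond_exp_intA[OF _ A]) (use E in \<open>simp add: less_top[symmetric]\<close>)
  also have "\<dots> = (\<integral>\<omega>. indicator A \<omega> * (\<Prod>j\<in>J. flip_law (phi (waiting_time tau S j \<omega>)) (b j)) \<partial>M)"
    unfolding set_lebesgue_integral_def
  proof (rule integral_cong_AE)
    show "AE \<omega> in M. indicator A \<omega> *\<^sub>R real_cond_exp M timing (indicator ?E) \<omega> =
        indicator A \<omega> * (\<Prod>j\<in>J. flip_law (phi (waiting_time tau S j \<omega>)) (b j))"
      using noise_given_timing[OF J, of b] by eventually_elim (simp add: flip_law_def)
    show "(\<lambda>\<omega>. indicator A \<omega> *\<^sub>R real_cond_exp M timing (indicator ?E) \<omega>) \<in> borel_measurable M"
      using AM by (intro borel_measurable_scaleR borel_measurable_indicator borel_measurable_cond_exp2)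
    have "(\<lambda>\<omega>. flip_law (phi (waiting_time tau S j \<omega>)) (b j)) \<in> borel_measurable M" if "j \<in> J" for j
    proof -
      have "(\<lambda>\<omega>. phi (waiting_time tau S j \<omega>)) \<in> borel_measurable M"
        using that J by (intro measurable_compose[OF waiting_time_measurable phi_measurable]) auto
      then show ?thesis by (cases "b j") (simp_all add: flip_law_def)
    qed
    then show "(\<lambda>\<omega>. indicator A \<omega> * (\<Prod>j\<in>J. flip_law (phi (waiting_time tau S j \<omega>)) (b j))) \<in> borel_measurable M"
      using AM by (intro borel_measurable_times borel_measurable_indicator borel_measurable_prod)
  qed
  finally show ?thesis .
qed

end

section \<open>Capacity with known times\<close>

locale queue_channel_with_limit = queue_channel M lam FS phi tau S N
  for M :: "'w measure" and lam FS phi tau S N +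
  fixes \<pi> :: "real measure"
  assumes phi_range: "phi \<in> {0..} \<rightarrow> {0..1/2}"
    and limit_law: "real_distribution \<pi>"
      "weak_conv_m (\<lambda>j. distr M borel (waiting_time tau S j)) \<pi>"
begin

lemma phi_waiting_time: "phi (waiting_time tau S j \<omega>) \<in> {0..1/2}"
  using phi_range waiting_time_nonneg[of j \<omega>] by auto

lemma noise_given_timing_additive:
  "additive_noise M timing (\<lambda>j b \<omega>. flip_law (phi (waiting_time tau S j \<omega>)) b) N"
proof
  show "subalgebra M timing" by (rule subalgebra_timing)
  show "N j \<in> M \<rightarrow>\<^sub>M count_space UNIV" if "1 \<le> j" for j using that by (rule noise_measurable)
  show "(\<lambda>\<omega>. flip_law (phi (waiting_time tau S j \<omega>)) b) \<in> borel_measurable timing" if "1 \<le> j" for j b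
  proof -
    have "(\<lambda>\<omega>. phi (waiting_time tau S j \<omega>)) \<in> borel_measurable timing"
      by (rule measurable_compose[OF waiting_time_timing[OF that] phi_measurable])
    then show ?thesis by (cases b) (simp_all add: flip_law_def)
  qed
  show "0 \<le> flip_law (phi (waiting_time tau S j \<omega>)) b" for j b \<omega>
    using phi_waiting_time[of j \<omega>] by (simp add: flip_law_def)
  show "flip_law (phi (waiting_time tau S j \<omega>)) True + flip_law (phi (waiting_time tau S j \<omega>)) False = 1" for j \<omega>
    by (simp add: flip_law_def)
  show "prob (A \<inter> {\<omega>\<in>space M. \<forall>j\<in>J. N j \<omega> = b j}) =
      (\<integral>\<omega>. indicator A \<omega> * (\<Prod>j\<in>J. flip_law (phi (waiting_time tau S j \<omega>)) (b j)) \<partial>M)"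
    if "finite J" "J \<subseteq> {1..}" "A \<in> sets timing" for J b A
    using that by (rule timing_prob)
qed

lemma walk_with_limit_V: "walk_with_limit M V \<pi>"
proof -
  interpret w: negative_drift_walk M V by (rule negative_drift_walk_V)
  have "weak_conv_m (\<lambda>k. distr M borel (w.W k)) \<pi>"
    unfolding weak_conv_m_def weak_conv_def
  proof (intro allI impI)
    fix x assume "isCont (cdf \<pi>) x"
    then have "(\<lambda>j. cdf (distr M borel (waiting_time tau S j)) x) \<longlonglongrightarrow> cdf \<pi> x"
      using limit_law(2) by (simp add: weak_conv_m_def weak_conv_def)
    from LIMSEQ_Suc[OF this] show "(\<lambda>k. cdf (distr M borel (w.W k)) x) \<longlonglongrightarrow> cdf \<pi> x"
      by (simp only: waiting_time_Suc_eq)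
  qed
  then show ?thesis
    by (intro walk_with_limit.intro walk_with_limit_axioms.intro w.negative_drift_walk_axioms limit_law(1))
qed

text \<open>The indicator of the negative half-line is bounded and measurable, so its mean, which is
  0 at all times, converges to its integral under \<pi>. It matters because \<open>phi\<close> is
  controlled on nonnegative arguments only.\<close>

lemma limit_nonneg: "AE w in \<pi>. 0 \<le> w"
proof -
  interpret w: walk_with_limit M V \<pi> by (rule walk_with_limit_V)
  have "(\<lambda>k. expectation (\<lambda>\<omega>. indicator {..<0} (w.W k \<omega>) :: real)) \<longlonglongrightarrow> (\<integral>x. indicator {..<0::real} x \<partial>\<pi>)"
    by (rule w.walk_expectation_tendsto[where h="indicator {..<0}"]) (simp_all add: indicator_def)
  moreover have "expectation (\<lambda>\<omega>. indicator {..<0} (w.W k \<omega>) :: real) = 0" for k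
  proof -
    have "indicator {..<0} (w.W k \<omega>) = (0::real)" for \<omega>
      by (rule indicator_simps(2)) (simp add: not_less reflected_walk_nonneg)
    then show ?thesis by (simp only: integral_zero)
  qed
  ultimately have "(\<integral>x. indicator {..<0::real} x \<partial>\<pi>) = (0::real)"
    by (simp add: LIMSEQ_const_iff)
  then have "measure \<pi> {..<0} = 0" by simp
  then have "{..<0} \<in> null_sets \<pi>" by (intro null_setsI) (simp_all add: w.\<pi>.emeasure_eq_measure)
  then show ?thesis by (rule AE_I'[rotated 1, rotated 1]) auto
qed

text \<open>Allows \<open>phi\<close> to be replaced by its composition with \<open>max 0\<close>,
  which is a probability for every real argument, as the walk lemmas demand.\<close>

lemma limit_integral_max:
  assumes "f \<in> borel_measurable borel"
  shows "(\<integral>w. f (max 0 w) \<partial>\<pi>) = (\<integral>w. f w \<partial>\<pi>)"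
proof -
  interpret p: real_distribution \<pi> by (rule limit_law)
  have [measurable]: "f \<in> borel_measurable borel" by fact
  show ?thesis
  proof (rule integral_cong_AE)
    show "AE w in \<pi>. f (max 0 w) = f w"
      using limit_nonneg by eventually_elim simp
  qed simp_all
qed

lemma binary_entropy_measurable: "binary_entropy \<in> borel_measurable borel"
  unfolding binary_entropy_def[abs_def] by measurable

theorem capacity_known:
  "capacity_known_times M tau S N = ereal (lam * (1 - (\<integral>w. binary_entropy (phi w) \<partial>\<pi>)))"
proof -
  interpret A: additive_noise M timing "\<lambda>j b \<omega>. flip_law (phi (waiting_time tau S j \<omega>)) b" N
    by (rule noise_given_timing_additive)
  interpret w: walk_with_limit M V \<pi> by (rule walk_with_limit_V)
  let ?h = "\<lambda>w. binary_entropy (phi (max 0 w))"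
  have h: "?h \<in> borel_measurable borel"
    using measurable_compose[OF phi_measurable binary_entropy_measurable]
    by (rule measurable_compose[rotated]) measurable
  have h_range: "?h w \<in> {0..1}" for w
    using phi_range by (intro binary_entropy_range) (auto simp: Pi_iff dest!: bspec[of _ _ "max 0 w"])
  have c_eq: "(\<integral>w. binary_entropy (phi w) \<partial>\<pi>) = (\<integral>w. ?h w \<partial>\<pi>)"
    using limit_integral_max[OF measurable_compose[OF phi_measurable binary_entropy_measurable]] by simp
  let ?c = "\<integral>w. ?h w \<partial>\<pi>"
  have hb: "integrable \<pi> ?h"
    by (rule w.\<pi>.integrable_const_bound[where B=1]) (use h h_range in auto)
  have c: "?c \<in> {0..1}"
    using h_range by (auto intro!: Bochner_Integration.integral_nonneg w.\<pi>.integral_le_const hb)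
  let ?Out = "\<lambda>n y \<omega>. (y, \<lambda>j\<in>{1..n}. arrival_time tau j \<omega>, \<lambda>j\<in>{1..n}. departure_time tau S j \<omega>)"
  let ?K = "\<lambda>n. (\<Pi>\<^sub>M j\<in>{1..n}. count_space (UNIV::bool set)) \<Otimes>\<^sub>M
            (\<Pi>\<^sub>M j\<in>{1..n}. borel) \<Otimes>\<^sub>M (\<Pi>\<^sub>M j\<in>{1..n}. borel :: real measure)"
  \<comment> \<open>Departure minus arrival is the waiting time, so this receiver can evaluate the
    flip probabilities.\<close>
  define lik where "lik = (\<lambda>(n::nat) (x::nat \<Rightarrow> bool) (y::nat \<Rightarrow> bool, a, d). \<Prod>j\<in>{1..n}. flip_law (phi (d j - a j)) (x j \<noteq> y j) :: real)"
  have "capacity M tau S ?K (\<lambda>n x \<omega>. ?Out n (channel_output N n x \<omega>) \<omega>) = ereal (lam * (1 - ?c))"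
  proof (rule A.capacity_eq[where lik=lik])
    show "?Out n y \<in> timing \<rightarrow>\<^sub>M ?K n" if "y \<in> words n" for n y
    proof (intro measurable_Pair measurable_restrict)
      show "(\<lambda>\<omega>. y) \<in> timing \<rightarrow>\<^sub>M (\<Pi>\<^sub>M j\<in>{1..n}. count_space UNIV)"
        using that by (intro measurable_const) (simp add: space_PiM)
    qed (simp_all add: arrival_time_timing departure_time_timing)
    show "?c \<in> {0..1}" by (rule c)
    show "0 < lam" by (rule lam)
    show "real n / lam < expectation (all_served_time tau S n)" if "1 \<le> n" for n
      using that by (rule all_served_time_lower)
    show "\<forall>\<^sub>F n in sequentially. expectation (all_served_time tau S n) < real n * (1 / lam + \<epsilon>)" if "0 < \<epsilon>" for \<epsilon>
      using that by (rule all_served_time_upper)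
    show "lik n x \<in> borel_measurable (?K n)" for n x
    proof -
      have "(\<lambda>(y, a, d). flip_law (phi (d j - a j)) (x j \<noteq> y j)) \<in> borel_measurable (?K n)" if j: "j \<in> {1..n}" for j
      proof -
        have [measurable]: "phi \<in> borel_measurable borel" by (rule phi_measurable)
        have y: "(\<lambda>o'. fst o' j) \<in> ?K n \<rightarrow>\<^sub>M count_space UNIV"
          and a: "(\<lambda>o'. fst (snd o') j) \<in> borel_measurable (?K n)"
          and d: "(\<lambda>o'. snd (snd o') j) \<in> borel_measurable (?K n)"
          using measurable_compose[OF measurable_fst measurable_component_singleton[OF j]]
            measurable_compose[OF measurable_compose[OF measurable_snd measurable_fst] measurable_component_singleton[OF j]]
            measurable_compose[OF measurable_compose[OF measurable_snd measurable_snd] measurable_component_singleton[OF j]]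
          by blast+
        have p: "(\<lambda>o'. phi (snd (snd o') j - fst (snd o') j)) \<in> borel_measurable (?K n)"
          by (rule measurable_compose[OF borel_measurable_diff[OF d a] phi_measurable])
        have ne: "Measurable.pred (?K n) (\<lambda>o'. x j \<noteq> fst o' j)"
          by (rule measurable_compose[OF y]) simp
        have "(\<lambda>o'. if x j \<noteq> fst o' j then phi (snd (snd o') j - fst (snd o') j)
            else 1 - phi (snd (snd o') j - fst (snd o') j)) \<in> borel_measurable (?K n)"
          by (rule measurable_If[OF p borel_measurable_diff[OF borel_measurable_const p] ne[unfolded pred_def]])
        then show ?thesis by (simp only: flip_law_def split_beta')
      qed
      then have "(\<lambda>o'. \<Prod>j\<in>{1..n}. (\<lambda>(y, a, d). flip_law (phi (d j - a j)) (x j \<noteq> y j)) o') \<in> borel_measurable (?K n)"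
        by (rule borel_measurable_prod)
      then show ?thesis by (simp only: lik_def split_beta')
    qed
    show "lik n x (?Out n (channel_output N n x' \<omega>) \<omega>) =
      (\<Prod>j\<in>{1..n}. flip_law (phi (waiting_time tau S j \<omega>)) (x j \<noteq> (x' j \<noteq> N j \<omega>)))" for n x x' \<omega>
      unfolding lik_def prod.case
      by (rule prod.cong[OF refl]) (simp only: restrict_apply' channel_output_def waiting_time_def)
    fix \<epsilon> :: real assume "0 < \<epsilon>"
    from w.walk_decorrelates[OF h h_range this]
    obtain k0 where k0: "\<And>i k. k0 \<le> k \<Longrightarrow> \<bar>expectation (\<lambda>\<omega>. (?h (w.W i \<omega>) - ?c) * (?h (w.W (i + k) \<omega>) - ?c))\<bar> \<le> \<epsilon>"
      by blast
    show "\<exists>k0. \<forall>i\<ge>1. \<forall>k\<ge>k0. \<bar>expectation (\<lambda>\<omega>.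
      (binary_entropy (flip_law (phi (waiting_time tau S i \<omega>)) True) - ?c) *
      (binary_entropy (flip_law (phi (waiting_time tau S (i + k) \<omega>)) True) - ?c))\<bar> \<le> \<epsilon>"
    proof (intro exI[of _ k0] allI impI)
      fix i k :: nat assume "1 \<le> i" "k0 \<le> k"
      \<comment> \<open>Symbol i sits at time i - 1 of the walk; the lag k is unaffected.\<close>
      then obtain l where i: "i = Suc l" by (cases i) auto
      have eq: "binary_entropy (flip_law (phi (waiting_time tau S (Suc m) \<omega>)) True) = ?h (w.W m \<omega>)" for m \<omega>
        using reflected_walk_nonneg by (simp add: flip_law_def waiting_time_eq_reflected_walk max_absorb2)
      show "\<bar>expectation (\<lambda>\<omega>.
        (binary_entropy (flip_law (phi (waiting_time tau S i \<omega>)) True) - ?c) *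
        (binary_entropy (flip_law (phi (waiting_time tau S (i + k) \<omega>)) True) - ?c))\<bar> \<le> \<epsilon>"
        using k0[OF \<open>k0 \<le> k\<close>, of l] by (simp only: i add_Suc eq)
    qed
  qed
  then show ?thesis by (simp only: capacity_known_times_def c_eq)
qed

section \<open>Capacity with unknown times\<close>

definition mean_flip :: "nat \<Rightarrow> real" where
  "mean_flip j = expectation (\<lambda>\<omega>. phi (waiting_time tau S j \<omega>))"

lemma phi_waiting_time_integrable:
  assumes "1 \<le> j"
  shows "integrable M (\<lambda>\<omega>. phi (waiting_time tau S j \<omega>))"
proof (rule integrable_const_bound[where B=1])
  show "AE \<omega> in M. norm (phi (waiting_time tau S j \<omega>)) \<le> 1"
  proof (rule AE_I2)
    show "norm (phi (waiting_time tau S j \<omega>)) \<le> 1" for \<omega>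
      using phi_waiting_time[of j \<omega>] by auto
  qed
  show "(\<lambda>\<omega>. phi (waiting_time tau S j \<omega>)) \<in> borel_measurable M"
    by (rule measurable_compose[OF waiting_time_measurable[OF assms] phi_measurable])
qed

lemma mean_flip_range:
  assumes "1 \<le> j"
  shows "mean_flip j \<in> {0..1/2}"
proof -
  have "0 \<le> mean_flip j" unfolding mean_flip_def
    by (rule Bochner_Integration.integral_nonneg) (use phi_waiting_time in auto)
  moreover have "mean_flip j \<le> 1/2" unfolding mean_flip_def
    by (rule integral_le_const[OF phi_waiting_time_integrable[OF assms]]) (use phi_waiting_time in auto)
  ultimately show ?thesis by simp
qed

lemma mean_flip_tendsto: "mean_flip \<longlonglongrightarrow> (\<integral>w. phi w \<partial>\<pi>)"
proof (rule LIMSEQ_imp_Suc)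
  interpret w: walk_with_limit M V \<pi> by (rule walk_with_limit_V)
  let ?h = "\<lambda>w. phi (max 0 w)"
  have h: "?h \<in> borel_measurable borel"
    using phi_measurable by (rule measurable_compose[rotated]) measurable
  have h_range: "?h w \<in> {0..1}" for w
    using phi_range by (auto simp: Pi_iff dest!: bspec[of _ _ "max 0 w"])
  have "mean_flip (Suc k) = expectation (\<lambda>\<omega>. ?h (w.W k \<omega>))" for k
    using reflected_walk_nonneg by (simp add: mean_flip_def waiting_time_eq_reflected_walk max_absorb2)
  then show "(\<lambda>k. mean_flip (Suc k)) \<longlonglongrightarrow> (\<integral>w. phi w \<partial>\<pi>)"
    using w.walk_expectation_tendsto[OF h h_range] limit_integral_max[OF phi_measurable] by simp
qed

context
  assumes unpredictable: "unpredictable_given_noise M tau S N"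
begin

text \<open>Unpredictability speaks of complete words of length n. Prescribing the flips on
  \<open>J\<close> only is a disjoint union of the complete words agreeing with \<open>b\<close> on
  \<open>J\<close>, over which the product rule is summed.\<close>

lemma noise_block_independent_of_waiting_time:
  assumes n: "1 \<le> n" and J: "J \<subseteq> {1..n}" and B: "B \<in> sets borel"
  shows "prob ({\<omega>\<in>space M. \<forall>j\<in>J. N j \<omega> = b j} \<inter> (waiting_time tau S (Suc n) -` B \<inter> space M)) =
    prob {\<omega>\<in>space M. \<forall>j\<in>J. N j \<omega> = b j} * prob (waiting_time tau S (Suc n) -` B \<inter> space M)"
proof -
  interpret A: additive_noise M timing "\<lambda>j b \<omega>. flip_law (phi (waiting_time tau S j \<omega>)) b" N
    by (rule noise_given_timing_additive)
  let ?X = "waiting_time tau S (Suc n) -` B \<inter> space M"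
  let ?E = "\<lambda>w. {\<omega>\<in>space M. \<forall>j\<in>{1..n}. N j \<omega> = w j}"
  let ?I = "{w \<in> words n. \<forall>j\<in>J. w j = b j}"
  have X: "?X \<in> sets M" using waiting_time_measurable[of "Suc n"] B by (intro measurable_sets) simp_all
  have E: "?E w \<in> sets M" for w by (rule A.noise_event) auto
  \<comment> \<open>Unpredictability is silent about words of probability 0, but for these both
    sides vanish.\<close>
  have word: "prob (?E w \<inter> ?X) = prob (?E w) * prob ?X" for w
  proof (cases "prob (?E w) = 0")
    case True
    have "prob (?E w \<inter> ?X) \<le> prob (?E w)" by (rule finite_measure_mono[OF Int_lower1 E])
    with True have "prob (?E w \<inter> ?X) = 0" using measure_nonneg[of M "?E w \<inter> ?X"] by linarith
    then show ?thesis by (simp only: True mult_zero_left)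
  next
    case False
    then have pos: "0 < prob (?E w)" using measure_nonneg[of M "?E w"] by linarith
    have eqs: "{\<omega>\<in>space M. waiting_time tau S (n + 1) \<omega> \<in> B} = ?X"
      "{\<omega>\<in>space M. waiting_time tau S (n + 1) \<omega> \<in> B \<and> (\<forall>j\<in>{1..n}. N j \<omega> = w j)} = ?E w \<inter> ?X"
      by (rule set_eqI, simp only: Suc_eq_plus1 vimage_eq Int_iff mem_Collect_eq, blast)+
    have "\<P>(\<omega> in M. waiting_time tau S (n + 1) \<omega> \<in> B \<bar> \<forall>j\<in>{1..n}. N j \<omega> = w j)
        = \<P>(\<omega> in M. waiting_time tau S (n + 1) \<omega> \<in> B)"
      using unpredictable n B pos unfolding unpredictable_given_noise_def by (meson order_refl)
    then have "prob (?E w \<inter> ?X) / prob (?E w) = prob ?X"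
      unfolding cond_prob_def eqs .
    with pos show ?thesis by (simp add: field_simps)
  qed
  have fin: "finite ?I" by (rule finite_subset[OF _ words_finite[of n]]) blast
  have split: "{\<omega>\<in>space M. \<forall>j\<in>J. N j \<omega> = b j} = (\<Union>w\<in>?I. ?E w)"
  proof (rule set_eqI, rule iffI)
    fix \<omega> assume \<omega>: "\<omega> \<in> {\<omega>\<in>space M. \<forall>j\<in>J. N j \<omega> = b j}"
    let ?w = "\<lambda>j\<in>{1..n}. N j \<omega>"
    have "?w j = b j" if "j \<in> J" for j
    proof -
      have "j \<in> {1..n}" using J that by blast
      then have "?w j = N j \<omega>" by (rule restrict_apply')
      with \<omega> that show ?thesis by simp
    qed
    then have "?w \<in> ?I" by (intro CollectI conjI ballI) simp_all
    moreover have "\<omega> \<in> ?E ?w" using \<omega> by simp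
    ultimately show "\<omega> \<in> (\<Union>w\<in>?I. ?E w)" by (rule UN_I[of ?w ?I \<omega> ?E])
  next
    fix \<omega> assume "\<omega> \<in> (\<Union>w\<in>?I. ?E w)"
    then obtain w where w: "w \<in> ?I" "\<omega> \<in> ?E w" by (rule UN_E)
    have "N j \<omega> = b j" if "j \<in> J" for j
    proof -
      have "j \<in> {1..n}" using J that by blast
      with w that show ?thesis by simp
    qed
    with w(2) show "\<omega> \<in> {\<omega>\<in>space M. \<forall>j\<in>J. N j \<omega> = b j}" by simp
  qed
  have disj: "disjoint_family_on ?E ?I"
    unfolding disjoint_family_on_def
  proof (intro ballI impI)
    fix w w' assume w: "w \<in> ?I" "w' \<in> ?I" "w \<noteq> w'"
    show "?E w \<inter> ?E w' = {}"
    proof (rule equals0I)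
      fix \<omega> assume \<omega>: "\<omega> \<in> ?E w \<inter> ?E w'"
      have "w j = w' j" if "j \<in> {1..n}" for j
      proof -
        have "N j \<omega> = w j" "N j \<omega> = w' j" using \<omega> that by blast+
        then show ?thesis by (rule trans[OF sym])
      qed
      then have "w = w'" using w by (intro PiE_ext[of w "{1..n}" "\<lambda>_. UNIV" w']) simp_all
      with w(3) show False by contradiction
    qed
  qed
  have disjX: "disjoint_family_on (\<lambda>w. ?E w \<inter> ?X) ?I"
    using disj unfolding disjoint_family_on_def by blast
  have "prob ((\<Union>w\<in>?I. ?E w) \<inter> ?X) = prob (\<Union>w\<in>?I. ?E w \<inter> ?X)"
    by (simp only: Int_UN_distrib2 UN_extend_simps)
  also have "\<dots> = (\<Sum>w\<in>?I. prob (?E w \<inter> ?X))"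
    by (rule finite_measure_finite_Union[OF fin _ disjX]) (use sets.Int[OF E X] in blast)
  also have "\<dots> = (\<Sum>w\<in>?I. prob (?E w)) * prob ?X"
    by (simp only: word sum_distrib_right)
  also have "(\<Sum>w\<in>?I. prob (?E w)) = prob (\<Union>w\<in>?I. ?E w)"
    by (rule finite_measure_finite_Union[OF fin _ disj, symmetric]) (use E in blast)
  finally show ?thesis by (simp only: split)
qed

text \<open>Given the timing, the flip of symbol n + 1 has the conditional law determined by its
  waiting time. That waiting time is independent of the earlier flips by unpredictability, so the
  factor of the last flip separates as an expectation, and the earlier flips are left to the
  induction hypothesis.\<close>

lemma noise_independent:
  assumes "J \<subseteq> {1..n}"
  shows "prob {\<omega>\<in>space M. \<forall>j\<in>J. N j \<omega> = b j} = (\<Prod>j\<in>J. flip_law (mean_flip j) (b j))"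
  using assms
proof (induction n arbitrary: J)
  case 0
  then have "J = {}" by simp
  then show ?case by (simp add: prob_space)
next
  case (Suc n)
  interpret A: additive_noise M timing "\<lambda>j b \<omega>. flip_law (phi (waiting_time tau S j \<omega>)) b" N
    by (rule noise_given_timing_additive)
  show ?case
  proof (cases "Suc n \<in> J")
    case False
    then have "J \<subseteq> {1..n}" using Suc.prems by (auto simp: le_Suc_eq)
    then show ?thesis by (rule Suc.IH)
  next
    case True
    define J' where "J' = J - {Suc n}"
    have J': "J' \<subseteq> {1..n}" using Suc.prems by (auto simp: J'_def le_Suc_eq)
    have J_eq: "J = insert (Suc n) J'" "Suc n \<notin> J'" using True by (auto simp: J'_def)
    have fin: "finite J'" using J' finite_subset by blast
    have sub: "J' \<subseteq> {1..}" "J \<subseteq> {1..}" "finite J" using J' fin by (auto simp: J_eq)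
    let ?E = "\<lambda>J. {\<omega>\<in>space M. \<forall>j\<in>J. N j \<omega> = b j}"
    let ?h = "\<lambda>w. flip_law (phi w) (b (Suc n))"
    let ?W = "waiting_time tau S (Suc n)"
    have h: "?h \<in> borel_measurable borel"
      using phi_measurable by (cases "b (Suc n)") (simp_all add: flip_law_def)
    have W: "?W \<in> borel_measurable M" by (rule waiting_time_measurable) simp
    have hW: "(\<lambda>\<omega>. ?h (?W \<omega>)) \<in> borel_measurable timing"
      by (rule measurable_compose[OF waiting_time_timing h]) simp
    have "space M \<in> sets timing" using sets.top[of timing] by (simp only: A.space_F)
    have "prob (?E J) = prob (space M \<inter> ?E J)" by (rule arg_cong[where f=prob]) blast
    also have "\<dots> = (\<integral>\<omega>. indicator (space M) \<omega> * (\<Prod>j\<in>J. flip_law (phi (waiting_time tau S j \<omega>)) (b j)) \<partial>M)"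
      by (rule A.q_cond[OF sub(3,2)]) fact
    also have "\<dots> = (\<integral>\<omega>. (\<Prod>j\<in>J'. flip_law (phi (waiting_time tau S j \<omega>)) (b j)) * ?h (?W \<omega>) \<partial>M)"
    proof (rule Bochner_Integration.integral_cong[OF refl])
      fix \<omega> assume "\<omega> \<in> space M"
      then show "indicator (space M) \<omega> * (\<Prod>j\<in>J. flip_law (phi (waiting_time tau S j \<omega>)) (b j)) =
          (\<Prod>j\<in>J'. flip_law (phi (waiting_time tau S j \<omega>)) (b j)) * ?h (?W \<omega>)"
        unfolding J_eq(1) using fin J_eq(2) by (simp add: mult.commute)
    qed
    \<comment> \<open>\<open>conditional_integral\<close> read backwards: the conditional
      probabilities of the earlier flips become their event again, while the last factor stays,
      being a function of the timing.\<close>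
    also have "\<dots> = (\<integral>\<omega>. indicator (?E J') \<omega> * ?h (?W \<omega>) \<partial>M)"
      by (rule A.conditional_integral(2)[OF fin sub(1) hW, symmetric])
    also have "\<dots> = prob (?E J') * expectation (\<lambda>\<omega>. ?h (?W \<omega>))"
    proof (rule integral_indicator_mult_independent[OF A.noise_event[OF fin sub(1)] W h])
      fix B :: "real set" assume B: "B \<in> sets borel"
      show "prob (?E J' \<inter> (?W -` B \<inter> space M)) = prob (?E J') * prob (?W -` B \<inter> space M)"
      \<comment> \<open>The first symbol has no past, and unpredictability starts at n = 1; here the
        event is the whole space.\<close>
      proof (cases "n = 0")
        case True
        then have "J' = {}" using J' by simp
        then have "?E J' = space M" by simp
        then show ?thesis by (simp only: prob_space mult_1 Int_left_absorb Int_commute)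
      next
        case False
        then show ?thesis by (intro noise_block_independent_of_waiting_time[OF _ J' B]) simp
      qed
    qed
    also have "expectation (\<lambda>\<omega>. ?h (?W \<omega>)) = flip_law (mean_flip (Suc n)) (b (Suc n))"
    proof (cases "b (Suc n)")
      case True
      then show ?thesis by (simp add: flip_law_def mean_flip_def)
    next
      case False
      then show ?thesis using phi_waiting_time_integrable[of "Suc n"]
        by (simp add: flip_law_def mean_flip_def prob_space)
    qed
    also have "prob (?E J') = (\<Prod>j\<in>J'. flip_law (mean_flip j) (b j))" by (rule Suc.IH[OF J'])
    finally show ?thesis unfolding J_eq(1) using fin J_eq(2) by (simp add: mult.commute)
  qed
qed

text \<open>Over the trivial sigma-algebra, \<open>q_cond\<close> is the unconditional product law.
  Index 0 belongs to no symbol; the value 0 there makes \<open>q\<close> a probability at every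
  index, as the locale demands.\<close>

lemma noise_unconditional_additive:
  "additive_noise M (sigma (space M) {}) (\<lambda>j b \<omega>. flip_law (if 1 \<le> j then mean_flip j else 0) b) N"
proof
  show "subalgebra M (sigma (space M) {})"
    by (auto simp: subalgebra_def sigma_sets_empty_eq)
  show "N j \<in> M \<rightarrow>\<^sub>M count_space UNIV" if "1 \<le> j" for j using that by (rule noise_measurable)
  show "0 \<le> flip_law (if 1 \<le> j then mean_flip j else 0) b" for j b
    using mean_flip_range[of j] by (cases "1 \<le> j") (auto simp: flip_law_def)
  show "flip_law (if 1 \<le> j then mean_flip j else 0) True + flip_law (if 1 \<le> j then mean_flip j else 0) False = 1" for j
    by (simp add: flip_law_def)
  show "prob (A \<inter> {\<omega>\<in>space M. \<forall>j\<in>J. N j \<omega> = b j}) =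
      (\<integral>\<omega>. indicator A \<omega> * (\<Prod>j\<in>J. flip_law (if 1 \<le> j then mean_flip j else 0) (b j)) \<partial>M)"
    if J: "finite J" "J \<subseteq> {1..}" and A: "A \<in> sets (sigma (space M) {})" for J b A
  proof -
    have "A = {} \<or> A = space M" using A by (simp add: sigma_sets_empty_eq)
    then show ?thesis
    proof
      assume "A = space M"
      have "J \<subseteq> {1..Max J}" using J by auto
      then have "prob {\<omega>\<in>space M. \<forall>j\<in>J. N j \<omega> = b j} = (\<Prod>j\<in>J. flip_law (mean_flip j) (b j))"
        by (rule noise_independent)
      also have "\<dots> = (\<Prod>j\<in>J. flip_law (if 1 \<le> j then mean_flip j else 0) (b j))"
        using J(2) by (intro prod.cong) auto
      also have "\<dots> = (\<integral>\<omega>. indicator A \<omega> * (\<Prod>j\<in>J. flip_law (if 1 \<le> j then mean_flip j else 0) (b j)) \<partial>M)"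
        unfolding \<open>A = space M\<close> by (simp add: prob_space)
      also have "{\<omega>\<in>space M. \<forall>j\<in>J. N j \<omega> = b j} = A \<inter> {\<omega>\<in>space M. \<forall>j\<in>J. N j \<omega> = b j}"
        unfolding \<open>A = space M\<close> by blast
      finally show ?thesis .
    qed simp
  qed
qed simp

text \<open>The conditional entropies are constants here, so their decorrelation reduces to their
  convergence, which follows from that of \<open>mean_flip\<close> by continuity of the entropy up
  to the end points of [0, 1]. In the product of deviations the first factor is at most 1 in
  absolute value, and the second is small as soon as k, hence i + k, is large.\<close>

theorem capacity_unknown:
  "capacity_unknown_times M tau S N = ereal (lam * (1 - binary_entropy (\<integral>w. phi w \<partial>\<pi>)))"
proof -
  interpret A: additive_noise M "sigma (space M) {}" "\<lambda>j b \<omega>. flip_law (if 1 \<le> j then mean_flip j else 0) b" N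
    by (rule noise_unconditional_additive)
  let ?p = "\<integral>w. phi w \<partial>\<pi>"
  let ?c = "binary_entropy ?p"
  let ?K = "\<lambda>n. \<Pi>\<^sub>M j\<in>{1..n}. count_space (UNIV::bool set)"
  have range: "\<forall>\<^sub>F j in sequentially. mean_flip j \<in> {0..1}"
  proof (rule eventually_sequentiallyI[of 1])
    show "mean_flip j \<in> {0..1}" if "1 \<le> j" for j
      using mean_flip_range[OF that] unfolding atLeastAtMost_iff by linarith
  qed
  have p: "?p \<in> {0..1}"
    by (rule Lim_in_closed_set[OF closed_real_atLeastAtMost range sequentially_bot mean_flip_tendsto])
  have c: "?c \<in> {0..1}" using p by (rule binary_entropy_range)
  have lim: "(\<lambda>j. binary_entropy (mean_flip j)) \<longlonglongrightarrow> ?c"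
    by (rule continuous_on_tendsto_compose[OF continuous_on_binary_entropy mean_flip_tendsto p range])
  define lik where "lik = (\<lambda>n (x :: nat \<Rightarrow> bool) y. \<Prod>j\<in>{1..n::nat}. flip_law (if 1 \<le> j then mean_flip j else 0) (x j \<noteq> y j))"
  have "capacity M tau S ?K (\<lambda>n x \<omega>. (\<lambda>n y \<omega>. y) n (channel_output N n x \<omega>) \<omega>) = ereal (lam * (1 - ?c))"
  proof (rule A.capacity_eq[where lik=lik])
    show "(\<lambda>\<omega>. y) \<in> sigma (space M) {} \<rightarrow>\<^sub>M ?K n" if "y \<in> words n" for n y
      using that by (intro measurable_const) (simp add: space_PiM)
    show "?c \<in> {0..1}" by (rule c)
    show "0 < lam" by (rule lam)
    show "real n / lam < expectation (all_served_time tau S n)" if "1 \<le> n" for n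
      using that by (rule all_served_time_lower)
    show "\<forall>\<^sub>F n in sequentially. expectation (all_served_time tau S n) < real n * (1 / lam + \<epsilon>)" if "0 < \<epsilon>" for \<epsilon>
      using that by (rule all_served_time_upper)
    show "lik n x \<in> borel_measurable (?K n)" for n x
      unfolding lik_def
    proof (rule borel_measurable_prod)
      fix j assume "j \<in> {1..n}"
      then show "(\<lambda>y. flip_law (if 1 \<le> j then mean_flip j else 0) (x j \<noteq> y j)) \<in> borel_measurable (?K n)"
        by (rule measurable_compose[OF measurable_component_singleton]) simp
    qed
    show "lik n x (channel_output N n x' \<omega>) =
      (\<Prod>j\<in>{1..n}. flip_law (if 1 \<le> j then mean_flip j else 0) (x j \<noteq> (x' j \<noteq> N j \<omega>)))" for n x x' \<omega>
      unfolding lik_def by (rule prod.cong[OF refl]) (simp only: restrict_apply' channel_output_def)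
    fix \<epsilon> :: real assume "0 < \<epsilon>"
    then obtain k0 where k0: "\<And>k. k0 \<le> k \<Longrightarrow> \<bar>binary_entropy (mean_flip k) - ?c\<bar> < \<epsilon>"
      using LIMSEQ_D[OF lim] unfolding real_norm_def by blast
    show "\<exists>k0. \<forall>i\<ge>1. \<forall>k\<ge>k0. \<bar>expectation (\<lambda>\<omega>.
      (binary_entropy (flip_law (if 1 \<le> i then mean_flip i else 0) True) - ?c) *
      (binary_entropy (flip_law (if 1 \<le> i + k then mean_flip (i + k) else 0) True) - ?c))\<bar> \<le> \<epsilon>"
    proof (intro exI[of _ k0] allI impI)
      fix i k :: nat assume ik: "1 \<le> i" "k0 \<le> k"
      have "mean_flip i \<in> {0..1}"
        using mean_flip_range[OF ik(1)] unfolding atLeastAtMost_iff by linarith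
      then have "binary_entropy (mean_flip i) \<in> {0..1}" by (rule binary_entropy_range)
      with c have "\<bar>binary_entropy (mean_flip i) - ?c\<bar> \<le> 1" unfolding atLeastAtMost_iff by linarith
      moreover have "\<bar>binary_entropy (mean_flip (i + k)) - ?c\<bar> \<le> \<epsilon>" using k0[of "i + k"] ik by simp
      ultimately have "\<bar>(binary_entropy (mean_flip i) - ?c) * (binary_entropy (mean_flip (i + k)) - ?c)\<bar> \<le> 1 * \<epsilon>"
        unfolding abs_mult by (intro mult_mono) auto
      then show "\<bar>expectation (\<lambda>\<omega>.
        (binary_entropy (flip_law (if 1 \<le> i then mean_flip i else 0) True) - ?c) *
        (binary_entropy (flip_law (if 1 \<le> i + k then mean_flip (i + k) else 0) True) - ?c))\<bar> \<le> \<epsilon>"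
        using ik(1) trans_le_add1[OF ik(1), of k]
        by (simp only: flip_law_def if_True lebesgue_integral_const prob_space scaleR_one)
    qed
  qed
  then show ?thesis by (simp only: capacity_unknown_times_def)
qed

end

end

theorem corollary2:
  fixes M :: "'w measure"
    and lam :: real
    and FS \<pi> :: "real measure"
    and phi :: "real \<Rightarrow> real"
    and tau S :: "nat \<Rightarrow> 'w \<Rightarrow> real"
    and N :: "nat \<Rightarrow> 'w \<Rightarrow> bool"
  assumes channel: "queue_channel M lam FS phi tau S N"
    and phi_range: "phi \<in> {0..} \<rightarrow> {0..1/2}"
    and limit_law: "real_distribution \<pi>"
      "weak_conv_m (\<lambda>j. distr M borel (waiting_time tau S j)) \<pi>"
  shows "capacity_known_times M tau S N
           = ereal (lam * (1 - (\<integral>w. binary_entropy (phi w) \<partial>\<pi>))) \<and>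
         (unpredictable_given_noise M tau S N \<longrightarrow>
          capacity_unknown_times M tau S N
            = ereal (lam * (1 - binary_entropy (\<integral>w. phi w \<partial>\<pi>))))"
proof -
  interpret queue_channel_with_limit M lam FS phi tau S N \<pi>
    by (intro queue_channel_with_limit.intro queue_channel_with_limit_axioms.intro channel phi_range limit_law)
  show ?thesis using capacity_known capacity_unknown by blast
qed

end
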